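(* Let $p\in(2,\infty)$ and $s\in(0,\frac{p-2}{p}]$. Then, for any locally bounded, local weak solution $u\in W^{s,p}_{\rm loc}(\Omega)\cap L^{p-1}_{sp}(\mathbb{R}^N)$ of $(-\Delta_p)^s u=0$ in $\Omega$, we have $$u\in W^{\gamma,q}_{\rm loc}(\Omega)\qquad\text{for any } q\in[p,\infty)\text{ and } \gamma\in\big[s,\tfrac{sp}{p-2}\big).$$ Moreover, for all such $q$ and $\gamma$ there exists a constant $C=C(N,p,s,q,\gamma)\ge 1$ (depending only on these parameters) such that for any ball $B_R\equiv B_R(x_o)\Subset\Omega$ we have $$[u]_{W^{\gamma,q}(B_{\frac12R})}\le\frac{C}{R^{\gamma}}\Big[R^{s-N(\frac1p-\frac1q)}[u]_{W^{s,p}(B_R)}+R^{\frac Nq}\big(\|u\|_{L^\infty(B_R)}+\mathrm{Tail}(u;R)\big)\Big].$$ The constant $C$ blows up as $\gamma\uparrow\frac{sp}{p-2}$.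
   Context: $N\ge2$ and $\Omega\subset\mathbb{R}^N$ is a bounded open set. $B_R(x_o)$ is the ball of radius $R$ and center $x_o$; balls written without center are concentric with center $x_o$. $B_R(x_o)\Subset\Omega$ means that the closure of the ball is contained in $\Omega$. For $q\in[1,\infty)$, $\gamma\in(0,1)$ and an open set $E$, $W^{\gamma,q}(E)$ is the space of measurable $w:E\to\mathbb{R}$ with $\|w\|_{L^q(E)}+[w]_{W^{\gamma,q}(E)}<\infty$, where $[w]_{W^{\gamma,q}(E)}:=\big[\iint_{E\times E}\frac{|w(x)-w(y)|^q}{|x-y|^{N+\gamma q}}\,dx\,dy\big]^{1/q}$; $w\in W^{\gamma,q}_{\rm loc}(\Omega)$ means $w\in W^{\gamma,q}(B)$ for every ball $B\Subset\Omega$. $L^{p-1}_{sp}(\mathbb{R}^N)$ is the set of $w\in L^{p-1}_{\rm loc}(\mathbb{R}^N)$ with $\int_{\mathbb{R}^N}\frac{|w(x)|^{p-1}}{(1+|x|)^{N+sp}}\,dx<\infty$. The tail is $\mathrm{Tail}(u;R)\equiv\mathrm{Tail}(u;x_o,R):=\big[R^{sp}\int_{\mathbb{R}^N\setminus B_R(x_o)}\frac{|u(x)|^{p-1}}{|x-x_o|^{N+sp}}\,dx\big]^{\frac1{p-1}}$, where $x_o$ is the center of the ball under consideration. A function $u\in W^{s,p}_{\rm loc}(\Omega)\cap L^{p-1}_{sp}(\mathbb{R}^N)$ is a local weak solution of $(-\Delta_p)^su=0$ in $\Omega$ if $\iint_{\mathbb{R}^N\times\mathbb{R}^N}\frac{|u(x)-u(y)|^{p-2}(u(x)-u(y))(\varphi(x)-\varphi(y))}{|x-y|^{N+sp}}\,dx\,dy=0$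 for every $\varphi\in W^{s,p}(\Omega)$ compactly supported in $\Omega$ and extended by $0$ outside $\Omega$. "Locally bounded" means $u\in L^\infty_{\rm loc}(\Omega)$. Saying that a constant "blows up" refers to the admissible constant provided by the result (it is not asserted to stay bounded in the indicated limit); no lower bound on the optimal constant is meant. *)

theory Defs
  imports "HOL-Probability.Essential_Supremum"
begin

text \<open>Norms, seminorms and tails take values in \<^typ>\<open>ennreal\<close>, so that finiteness is a genuine
  statement and no integral silently becomes 0.\<close>

text \<open>The power \<open>x\<^sup>a\<close> on \<open>[0,\<infinity>]\<close>, only meant for \<open>a > 0\<close>.\<close>

definition enn_powr :: "ennreal \<Rightarrow> real \<Rightarrow> ennreal" where
  "enn_powr x a = (if x = \<infinity> then \<infinity> else ennreal (enn2real x powr a))"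

definition compactly_contained :: "'a::topological_space set \<Rightarrow> 'a set \<Rightarrow> bool" where
  "compactly_contained B \<Omega> \<longleftrightarrow> compact (closure B) \<and> closure B \<subseteq> \<Omega>"

definition Lq_norm :: "real \<Rightarrow> 'a::euclidean_space set \<Rightarrow> ('a \<Rightarrow> real) \<Rightarrow> ennreal" where
  "Lq_norm q E w = enn_powr (\<integral>\<^sup>+x. ennreal (\<bar>w x\<bar> powr q) \<partial>lebesgue_on E) (1 / q)"

text \<open>For \<open>w\<close> not measurable on \<open>E\<close> the library's \<^const>\<open>esssup\<close> is \<open>\<infinity>\<close>, so finiteness
  includes measurability.\<close>

definition Linf_norm :: "'a::euclidean_space set \<Rightarrow> ('a \<Rightarrow> real) \<Rightarrow> ennreal" where
  "Linf_norm E w = esssup (lebesgue_on E) (\<lambda>x. ennreal \<bar>w x\<bar>)"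

text \<open>On the diagonal, a null set, the integrand has the value 0 because \<open>0 powr a = 0\<close>.\<close>

definition gagliardo :: "real \<Rightarrow> real \<Rightarrow> 'a::euclidean_space set \<Rightarrow> ('a \<Rightarrow> real) \<Rightarrow> ennreal" where
  "gagliardo \<gamma> q E w =
     enn_powr
       (\<integral>\<^sup>+(x, y). ennreal (\<bar>w x - w y\<bar> powr q / norm (x - y) powr (real DIM('a) + \<gamma> * q))
          \<partial>(lebesgue_on E \<Otimes>\<^sub>M lebesgue_on E))
       (1 / q)"

text \<open>The spaces below consist of total functions; only the values on \<open>E\<close> (respectively on
  balls contained in \<open>\<Omega>\<close>) matter.\<close>

definition frac_sobolev :: "real \<Rightarrow> real \<Rightarrow> 'a::euclidean_space set \<Rightarrow> ('a \<Rightarrow> real) set" where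
  "frac_sobolev \<gamma> q E =
     {w. w \<in> borel_measurable (lebesgue_on E) \<and> Lq_norm q E w + gagliardo \<gamma> q E w < \<infinity>}"

definition frac_sobolev_loc :: "real \<Rightarrow> real \<Rightarrow> 'a::euclidean_space set \<Rightarrow> ('a \<Rightarrow> real) set" where
  "frac_sobolev_loc \<gamma> q \<Omega> =
     {w. \<forall>x r. 0 < r \<and> compactly_contained (ball x r) \<Omega> \<longrightarrow> w \<in> frac_sobolev \<gamma> q (ball x r)}"

definition locally_bounded :: "'a::euclidean_space set \<Rightarrow> ('a \<Rightarrow> real) \<Rightarrow> bool" where
  "locally_bounded \<Omega> w \<longleftrightarrow>
     (\<forall>x r. 0 < r \<and> compactly_contained (ball x r) \<Omega> \<longrightarrow> Linf_norm (ball x r) w < \<infinity>)"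

text \<open>The space \<open>L\<^bsup>p-1\<^esup>\<^bsub>sp\<^esub>(\<real>\<^sup>N)\<close>.\<close>

definition tail_space :: "real \<Rightarrow> real \<Rightarrow> ('a::euclidean_space \<Rightarrow> real) set" where
  "tail_space s p =
     {w. w \<in> borel_measurable lebesgue \<and>
         (\<forall>x r. 0 < r \<longrightarrow> Lq_norm (p - 1) (ball x r) w < \<infinity>) \<and>
         (\<integral>\<^sup>+x. ennreal (\<bar>w x\<bar> powr (p - 1) / (1 + norm x) powr (real DIM('a) + s * p))
            \<partial>lebesgue) < \<infinity>}"

definition Tail :: "real \<Rightarrow> real \<Rightarrow> ('a::euclidean_space \<Rightarrow> real) \<Rightarrow> 'a \<Rightarrow> real \<Rightarrow> ennreal" where
  "Tail s p u x0 R =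
     enn_powr
       (ennreal (R powr (s * p)) *
         (\<integral>\<^sup>+x. ennreal (\<bar>u x\<bar> powr (p - 1) / norm (x - x0) powr (real DIM('a) + s * p))
            \<partial>lebesgue_on (- ball x0 R)))
       (1 / (p - 1))"

text \<open>Test functions are taken to be already extended by 0: a total function whose support is a
  compact subset of \<open>\<Omega>\<close> vanishes outside \<open>\<Omega>\<close>. That the double integral equals 0 includes
  that it exists as a Lebesgue integral.\<close>

definition local_weak_solution ::
    "real \<Rightarrow> real \<Rightarrow> 'a::euclidean_space set \<Rightarrow> ('a \<Rightarrow> real) \<Rightarrow> bool" where
  "local_weak_solution s p \<Omega> u \<longleftrightarrow>
     u \<in> frac_sobolev_loc s p \<Omega> \<and> u \<in> tail_space s p \<and>
     (\<forall>\<phi> \<in> frac_sobolev s p \<Omega>. compactly_contained {x. \<phi> x \<noteq> 0} \<Omega> \<longrightarrow>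
        has_bochner_integral (lebesgue \<Otimes>\<^sub>M lebesgue)
          (\<lambda>(x, y). \<bar>u x - u y\<bar> powr (p - 2) * (u x - u y) * (\<phi> x - \<phi> y)
             / norm (x - y) powr (real DIM('a) + s * p)) 0)"

end

theory Submission
  imports Defs
begin

text \<open>
  Write \<open>N\<close> for the dimension, \<open>\<Theta> = sp/(p-2)\<close> and \<open>\<tau>\<^sub>h u(x) = u(x+h) - u(x)\<close>. The proof measures
  regularity by the decay of \<open>\<integral> |\<tau>\<^sub>h u|\<^sup>q\<close> as \<open>h \<rightarrow> 0\<close>, of order \<open>|h|\<^bsup>\<theta>q\<^esup>\<close>, and improves \<open>\<theta>\<close> until
  it is as close to \<open>\<Theta>\<close> as desired. For \<open>\<gamma> < \<theta>\<close> such a decay gives \<open>W\<^bsup>\<gamma>,q\<^esup>\<close>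
  (\<open>kernel_energy_le_of_translations\<close>).

  The equation is translation invariant, so \<open>u(x+h)\<close> solves it as well. Subtracting the two
  equations and testing with \<open>\<eta>\<^sup>2 |\<tau>\<^sub>h u|\<^bsup>q-p\<^esup> \<tau>\<^sub>h u\<close>, where \<open>\<eta>\<close> is a cutoff, the monotonicity of
  \<open>t \<mapsto> |t|\<^bsup>p-2\<^esup> t\<close> bounds the energy
  \<open>\<integral>\<integral> |\<tau>\<^sub>h u(x) - \<tau>\<^sub>h u(y)|\<^sup>q |x-y|\<^bsup>-N-sp\<^esup>\<close> over a ball by two errors.
  The near error comes from differentiating the cutoff and is quadratic in \<open>\<tau>\<^sub>h u\<close> beyond the power
  \<open>q-p\<close>; the far error comes from points outside the ball, and there the shift by \<open>h\<close> is moved from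
  \<open>u\<close> to the smooth kernel, which makes it of the same order. If \<open>\<integral> |\<tau>\<^sub>h u|\<^sup>q\<close> decays like
  \<open>|h|\<^bsup>\<theta>q\<^esup>\<close>, then both errors decay like \<open>|h|\<^bsup>\<theta>(q-p+2)\<^esup>\<close> (\<open>translated_energy_bound\<close>).

  The energy on the left, of order \<open>sp\<close>, controls one more difference at the price \<open>|h|\<^bsup>sp\<^esup>\<close>
  (\<open>translation_difference_le_kernel_energy\<close>). So the second difference \<open>\<tau>\<^sub>h\<tau>\<^sub>h u\<close> has order
  \<open>\<theta>' = (sp + \<theta>(q-p+2))/q\<close> in \<open>L\<^sup>q\<close>, and because \<open>\<theta>' < 1\<close> the first difference has that order too
  (\<open>first_difference_le_of_second\<close>). The map \<open>\<theta> \<mapsto> \<theta>'\<close> is an affine contraction with fixed point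
  \<open>\<Theta>\<close>, and the assumption \<open>s \<le> (p-2)/p\<close> says precisely \<open>\<Theta> \<le> 1\<close>. Iterating it gives every \<open>\<theta> < \<Theta>\<close>.

  The near error is under control only when \<open>\<theta>(p-2) > sp-2\<close>, since the cutoff gains just two powers of
  \<open>|x-y|\<close> against the kernel. For \<open>q = p\<close> the starting value \<open>\<theta> = s\<close> satisfies this because \<open>s < 1\<close>. Larger
  exponents \<open>q\<close> are reached in steps of bounded ratio: boundedness of \<open>u\<close> turns order \<open>\<theta>\<close> in \<open>L\<^bsup>q\<^esup>\<close>
  into order \<open>\<theta>q/q'\<close> in \<open>L\<^bsup>q'\<^esup>\<close>, and a value of \<open>\<theta>\<close> near \<open>\<Theta>\<close> leaves room for a fixed ratio
  \<open>q'/q > 1\<close> (\<open>nikolskii_all_exponents\<close>).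

  All constants must be independent of the solution. By scaling and homogeneity it suffices to treat
  solutions on the unit ball whose sup norm, seminorm and tail are at most \<open>1\<close>
  (\<open>normalized_solution\<close>), and each step above is proved uniformly for this whole family. Scaling back
  (\<open>rescaled_solution\<close>) produces exactly the powers of \<open>R\<close> in the theorem.
\<close>

section \<open>Pointwise inequalities for signed powers\<close>

definition signed_power :: "real \<Rightarrow> real \<Rightarrow> real" where
  "signed_power r t = \<bar>t\<bar> powr r * t"

lemma powr_add_le_signed:
  fixes A B r :: real
  assumes "0 \<le> r"
  shows "(\<bar>A\<bar> + \<bar>B\<bar>) powr r \<le> 2 powr r * (\<bar>A\<bar> powr r + \<bar>B\<bar> powr r)"
proof -
  have "(\<bar>A\<bar> + \<bar>B\<bar>) powr r \<le> (2 * max \<bar>A\<bar> \<bar>B\<bar>) powr r"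
    using assms by (intro powr_mono2) auto
  also have "\<dots> = 2 powr r * max \<bar>A\<bar> \<bar>B\<bar> powr r"
    by (simp add: powr_mult)
  also have "\<dots> \<le> 2 powr r * (\<bar>A\<bar> powr r + \<bar>B\<bar> powr r)"
    by (intro mult_left_mono) (auto simp: max_def)
  finally show ?thesis .
qed

text \<open>
  With \<open>\<alpha> = |A|\<^sup>r\<close> and \<open>\<beta> = |B|\<^sup>r\<close> the right-hand side equals
  \<open>(\<alpha>+\<beta>)(A-B)\<^sup>2/2 + (\<alpha>-\<beta>)(A\<^sup>2-B\<^sup>2)/2\<close>. The last term is nonnegative because \<open>|t|\<^sup>r\<close> and \<open>t\<^sup>2\<close>
  are both increasing in \<open>|t|\<close>, and \<open>\<alpha>+\<beta>\<close> is comparable to \<open>(|A|+|B|)\<^sup>r\<close>.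
\<close>

lemma signed_power_monotone:
  fixes A B r :: real
  assumes "0 \<le> r"
  shows "2 powr (-(r + 1)) * ((\<bar>A\<bar> + \<bar>B\<bar>) powr r * (A - B)\<^sup>2)
           \<le> (signed_power r A - signed_power r B) * (A - B)"
proof -
  define \<alpha> \<beta> where "\<alpha> = \<bar>A\<bar> powr r" and "\<beta> = \<bar>B\<bar> powr r"
  have mono: "0 \<le> (\<alpha> - \<beta>) * (A\<^sup>2 - B\<^sup>2)"
  proof (cases "\<bar>B\<bar> \<le> \<bar>A\<bar>")
    case True
    then have "\<beta> \<le> \<alpha>" "B\<^sup>2 \<le> A\<^sup>2" unfolding \<alpha>_def \<beta>_def using assms by (auto intro: powr_mono2 simp: abs_le_square_iff)
    then show ?thesis by (intro mult_nonneg_nonneg) auto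
  next
    case False
    then have "\<alpha> \<le> \<beta>" "A\<^sup>2 \<le> B\<^sup>2" unfolding \<alpha>_def \<beta>_def using assms by (auto intro: powr_mono2 simp: abs_le_square_iff[symmetric])
    then show ?thesis by (intro mult_nonpos_nonpos) auto
  qed
  have "2 powr (-(r + 1)) * (\<bar>A\<bar> + \<bar>B\<bar>) powr r \<le> 2 powr (-(r+1)) * (2 powr r * (\<alpha> + \<beta>))"
    unfolding \<alpha>_def \<beta>_def by (intro mult_left_mono powr_add_le_signed assms) auto
  also have "\<dots> = (\<alpha> + \<beta>) / 2"
    using powr_add[of 2 "-(r+1)" r] by (simp add: powr_minus mult.assoc[symmetric])
  finally have "2 powr (-(r + 1)) * (\<bar>A\<bar> + \<bar>B\<bar>) powr r * (A - B)\<^sup>2 \<le> (\<alpha> + \<beta>) / 2 * (A - B)\<^sup>2"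
    by (rule mult_right_mono) auto
  also have "\<dots> \<le> (\<alpha> + \<beta>) / 2 * (A - B)\<^sup>2 + (\<alpha> - \<beta>) * (A\<^sup>2 - B\<^sup>2) / 2"
    using mono by simp
  also have "\<dots> = (\<alpha> * A - \<beta> * B) * (A - B)"
    by (simp add: power2_eq_square field_simps)
  finally show ?thesis unfolding signed_power_def \<alpha>_def \<beta>_def by (simp add: mult.assoc)
qed

text \<open>
  Convexity of \<open>t\<^bsup>r+1\<^esup>\<close>, in the form that also serves exponents \<open>r < 1\<close>, for which
  \<open>t\<^sup>r\<close> itself has unbounded slope at \<open>0\<close>.
\<close>

lemma powr_Suc_diff_le:
  fixes x y r :: real
  assumes "0 \<le> y" "y \<le> x" "0 \<le> r"
  shows "x powr r * x - y powr r * y \<le> (r + 1) * x powr r * (x - y)"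
proof (cases "y = 0 \<or> x = y")
  case True
  then show ?thesis using assms by (auto simp: algebra_simps)
next
  case False
  then have y: "0 < y" "y < x" using assms by auto
  have "\<exists>z. y < z \<and> z < x \<and> x powr (r+1) - y powr (r+1) = (x - y) * ((r+1) * z powr r)"
  proof (rule MVT2)
    show "y < x" by (rule y)
    fix z assume "y \<le> z" "z \<le> x"
    then show "((\<lambda>z. z powr (r+1)) has_real_derivative (r + 1) * z powr r) (at z)"
      using y by (auto intro!: derivative_eq_intros)
  qed
  then obtain z where z: "y < z" "z < x" "x powr (r+1) - y powr (r+1) = (x - y) * ((r+1) * z powr r)" by blast
  have "z powr r \<le> x powr r" using z y assms by (intro powr_mono2) auto
  then have "(x - y) * ((r+1) * z powr r) \<le> (x - y) * ((r+1) * x powr r)"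
    using y assms by (intro mult_left_mono) auto
  with z(3) show ?thesis using y by (simp add: powr_add mult_ac)
qed

lemma signed_power_diff_le:
  fixes A B r :: real
  assumes "0 \<le> r"
  shows "\<bar>signed_power r A - signed_power r B\<bar> \<le> (r + 2) * ((\<bar>A\<bar> + \<bar>B\<bar>) powr r * \<bar>A - B\<bar>)"
proof -
  have *: "\<bar>signed_power r A - signed_power r B\<bar> \<le> (r + 2) * ((\<bar>A\<bar> + \<bar>B\<bar>) powr r * \<bar>A - B\<bar>)"
    if le: "\<bar>B\<bar> \<le> \<bar>A\<bar>" for A B
  proof -
    have m: "\<bar>B\<bar> powr r \<le> \<bar>A\<bar> powr r" using le assms by (intro powr_mono2) auto
    have "signed_power r A - signed_power r B = \<bar>A\<bar> powr r * (A - B) + (\<bar>A\<bar> powr r - \<bar>B\<bar> powr r) * B"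
      by (simp add: signed_power_def algebra_simps)
    also have "\<bar>\<dots>\<bar> \<le> \<bar>A\<bar> powr r * \<bar>A - B\<bar> + (\<bar>A\<bar> powr r - \<bar>B\<bar> powr r) * \<bar>B\<bar>"
      using m by (intro order_trans[OF abs_triangle_ineq]) (simp add: abs_mult)
    also have "(\<bar>A\<bar> powr r - \<bar>B\<bar> powr r) * \<bar>B\<bar> \<le> \<bar>A\<bar> powr r * \<bar>A\<bar> - \<bar>B\<bar> powr r * \<bar>B\<bar>"
      using le by (simp add: left_diff_distrib mult_left_mono)
    also have "\<dots> \<le> (r + 1) * \<bar>A\<bar> powr r * (\<bar>A\<bar> - \<bar>B\<bar>)"
      using le assms by (intro powr_Suc_diff_le) auto
    also have "\<dots> \<le> (r + 1) * \<bar>A\<bar> powr r * \<bar>A - B\<bar>"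
      using assms by (intro mult_left_mono) auto
    finally have "\<bar>signed_power r A - signed_power r B\<bar> \<le> (r + 2) * (\<bar>A\<bar> powr r * \<bar>A - B\<bar>)"
      by (simp add: algebra_simps)
    also have "\<dots> \<le> (r + 2) * ((\<bar>A\<bar> + \<bar>B\<bar>) powr r * \<bar>A - B\<bar>)"
      using assms by (intro mult_left_mono mult_right_mono powr_mono2) auto
    finally show ?thesis .
  qed
  show ?thesis
  proof (cases "\<bar>B\<bar> \<le> \<bar>A\<bar>")
    case True
    then show ?thesis by (rule *)
  next
    case False
    then have "\<bar>signed_power r B - signed_power r A\<bar> \<le> (r + 2) * ((\<bar>B\<bar> + \<bar>A\<bar>) powr r * \<bar>B - A\<bar>)"
      by (intro *) auto
    then show ?thesis by (simp add: abs_minus_commute add.commute)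
  qed
qed

lemma abs_signed_power: "\<bar>signed_power r t\<bar> = \<bar>t\<bar> powr r * \<bar>t\<bar>"
  by (simp add: signed_power_def abs_mult)

text \<open>
  The algebraic core of the energy estimate. Here \<open>A\<close> and \<open>B\<close> are differences of the translated and
  of the original function at a pair of points, \<open>a\<close> and \<open>b\<close> the values of \<open>\<tau>\<^sub>h u\<close>, and \<open>\<eta>\<close> and \<open>\<zeta>\<close> those of
  the cutoff. The test difference splits into a part with \<open>\<eta>\<^sup>2+\<zeta>\<^sup>2\<close>, which is coercive by
  monotonicity of both powers, and a part with \<open>\<eta>\<^sup>2-\<zeta>\<^sup>2 = (\<eta>-\<zeta>)(\<eta>+\<zeta>)\<close>, whose factor \<open>\<eta>+\<zeta>\<close> is absorbed
  by the first part.
\<close>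

lemma tested_monotonicity:
  fixes A B a b \<eta> \<zeta> r t :: real
  assumes r: "0 \<le> r" and t: "0 \<le> t" and d: "a - b = A - B"
  defines "X \<equiv> (\<bar>A\<bar> + \<bar>B\<bar>) powr r * (\<bar>a\<bar> + \<bar>b\<bar>) powr t"
    and "c \<equiv> 2 powr (-(r + t + 2))"
  shows "c / 4 * (X * (a - b)\<^sup>2 * (\<eta>\<^sup>2 + \<zeta>\<^sup>2)) - (r + 2)\<^sup>2 / (2 * c) * (X * (\<bar>a\<bar> + \<bar>b\<bar>)\<^sup>2 * (\<eta> - \<zeta>)\<^sup>2)
    \<le> (signed_power r A - signed_power r B) * (signed_power t a * \<eta>\<^sup>2 - signed_power t b * \<zeta>\<^sup>2)"
proof (cases "a = b")
  case True
  then have "A = B" using d by simp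
  then show ?thesis using True by (auto simp: X_def c_def)
next
  case False
  define D where "D = signed_power r A - signed_power r B"
  define E where "E = signed_power t a - signed_power t b"
  define F where "F = signed_power t a + signed_power t b"
  define S T where "S = (\<bar>A\<bar> + \<bar>B\<bar>) powr r" and "T = (\<bar>a\<bar> + \<bar>b\<bar>) powr t"
  define \<delta> where "\<delta> = a - b"
  define m where "m = \<bar>a\<bar> + \<bar>b\<bar>"
  have \<delta>: "\<delta> \<noteq> 0" using False by (simp add: \<delta>_def)
  have c0: "0 < c" by (simp add: c_def)
  have X: "X = S * T" by (simp add: X_def S_def T_def)
  have X0: "0 \<le> X" by (simp add: X_def)
  have ceq: "c = 2 powr (-(r+1)) * 2 powr (-(t+1))"
    by (simp add: c_def powr_add[symmetric])
  have 1: "2 powr (-(r+1)) * (S * \<delta>\<^sup>2) \<le> D * \<delta>"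
    using signed_power_monotone[OF r, of A B] unfolding S_def D_def \<delta>_def d .
  have 2: "2 powr (-(t+1)) * (T * \<delta>\<^sup>2) \<le> E * \<delta>"
    using signed_power_monotone[OF t, of a b] unfolding T_def E_def \<delta>_def .
  have "(2 powr (-(r+1)) * (S * \<delta>\<^sup>2)) * (2 powr (-(t+1)) * (T * \<delta>\<^sup>2)) \<le> (D * \<delta>) * (E * \<delta>)"
    by (intro mult_mono 1 2 order_trans[OF _ 1]) (auto simp: S_def T_def)
  then have "(c * X * \<delta>\<^sup>2) * \<delta>\<^sup>2 \<le> (D * E) * \<delta>\<^sup>2"
    by (simp add: ceq X mult_ac power2_eq_square)
  then have DE: "c * X * \<delta>\<^sup>2 \<le> D * E" using \<delta> by simp
  have D: "\<bar>D\<bar> \<le> (r + 2) * (S * \<bar>\<delta>\<bar>)"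
    using signed_power_diff_le[OF r, of A B] unfolding S_def D_def \<delta>_def d .
  have "\<bar>F\<bar> \<le> \<bar>a\<bar> powr t * \<bar>a\<bar> + \<bar>b\<bar> powr t * \<bar>b\<bar>"
    unfolding F_def by (intro order_trans[OF abs_triangle_ineq]) (simp add: abs_signed_power)
  also have "\<dots> \<le> T * \<bar>a\<bar> + T * \<bar>b\<bar>"
    unfolding T_def using t by (intro add_mono mult_right_mono powr_mono2) auto
  finally have F: "\<bar>F\<bar> \<le> T * m" by (simp add: m_def distrib_left)
  have "\<bar>D * F * (\<eta>\<^sup>2 - \<zeta>\<^sup>2)\<bar> = \<bar>D\<bar> * \<bar>F\<bar> * (\<bar>\<eta> - \<zeta>\<bar> * \<bar>\<eta> + \<zeta>\<bar>)"
    by (simp add: abs_mult[symmetric] power2_eq_square algebra_simps)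
  also have "\<dots> \<le> ((r + 2) * (S * \<bar>\<delta>\<bar>)) * (T * m) * (\<bar>\<eta> - \<zeta>\<bar> * \<bar>\<eta> + \<zeta>\<bar>)"
    using r by (intro mult_right_mono mult_mono D F) (auto simp: S_def)
  also have "\<dots> = (r + 2) * X * ((\<bar>\<delta>\<bar> * \<bar>\<eta> + \<zeta>\<bar>) * (m * \<bar>\<eta> - \<zeta>\<bar>))"
    by (simp add: X)
  finally have DF: "\<bar>D * F * (\<eta>\<^sup>2 - \<zeta>\<^sup>2)\<bar> \<le> (r + 2) * X * ((\<bar>\<delta>\<bar> * \<bar>\<eta> + \<zeta>\<bar>) * (m * \<bar>\<eta> - \<zeta>\<bar>))" .
  \<comment> \<open>With this \<open>\<epsilon>\<close> Young's inequality uses up exactly half of the coercive term.\<close>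
  define \<epsilon> where "\<epsilon> = c / (2 * (r + 2))"
  have e: "0 < \<epsilon>" using c0 r by (simp add: \<epsilon>_def)
  have young: "P * Q \<le> \<epsilon> / 2 * P\<^sup>2 + Q\<^sup>2 / (2 * \<epsilon>)" for P Q :: real
  proof -
    have "0 \<le> (\<epsilon> * P - Q)\<^sup>2 / (2 * \<epsilon>)" using e by simp
    also have "\<dots> = \<epsilon> / 2 * P\<^sup>2 + Q\<^sup>2 / (2 * \<epsilon>) - P * Q"
      using e by (simp add: field_simps power2_eq_square)
    finally show ?thesis by simp
  qed
  have "(\<bar>\<delta>\<bar> * \<bar>\<eta> + \<zeta>\<bar>) * (m * \<bar>\<eta> - \<zeta>\<bar>) \<le> \<epsilon> / 2 * (\<bar>\<delta>\<bar> * \<bar>\<eta> + \<zeta>\<bar>)\<^sup>2 + (m * \<bar>\<eta> - \<zeta>\<bar>)\<^sup>2 / (2 * \<epsilon>)"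
    by (rule young)
  also have "\<dots> \<le> \<epsilon> * (\<delta>\<^sup>2 * (\<eta>\<^sup>2 + \<zeta>\<^sup>2)) + (m\<^sup>2 * (\<eta> - \<zeta>)\<^sup>2) / (2 * \<epsilon>)"
  proof -
    have "(\<eta> + \<zeta>)\<^sup>2 \<le> 2 * (\<eta>\<^sup>2 + \<zeta>\<^sup>2)" using sum_squares_ge_zero[of "\<eta> - \<zeta>" 0]
      by (simp add: power2_eq_square algebra_simps)
    then have "\<delta>\<^sup>2 * (\<eta> + \<zeta>)\<^sup>2 \<le> \<delta>\<^sup>2 * (2 * (\<eta>\<^sup>2 + \<zeta>\<^sup>2))" by (intro mult_left_mono) auto
    then have "\<epsilon> / 2 * (\<delta>\<^sup>2 * (\<eta> + \<zeta>)\<^sup>2) \<le> \<epsilon> / 2 * (\<delta>\<^sup>2 * (2 * (\<eta>\<^sup>2 + \<zeta>\<^sup>2)))"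
      by (rule mult_left_mono) (use e in simp)
    moreover have "\<epsilon> / 2 * (\<delta>\<^sup>2 * (2 * (\<eta>\<^sup>2 + \<zeta>\<^sup>2))) = \<epsilon> * (\<delta>\<^sup>2 * (\<eta>\<^sup>2 + \<zeta>\<^sup>2))" by simp
    ultimately show ?thesis unfolding power_mult_distrib power2_abs by linarith
  qed
  finally have "(r + 2) * X * ((\<bar>\<delta>\<bar> * \<bar>\<eta> + \<zeta>\<bar>) * (m * \<bar>\<eta> - \<zeta>\<bar>))
     \<le> (r + 2) * X * (\<epsilon> * (\<delta>\<^sup>2 * (\<eta>\<^sup>2 + \<zeta>\<^sup>2)) + (m\<^sup>2 * (\<eta> - \<zeta>)\<^sup>2) / (2 * \<epsilon>))"
    using r X0 by (intro mult_left_mono) auto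
  also have "\<dots> = c / 2 * (X * \<delta>\<^sup>2 * (\<eta>\<^sup>2 + \<zeta>\<^sup>2)) + (r + 2)\<^sup>2 / c * (X * m\<^sup>2 * (\<eta> - \<zeta>)\<^sup>2)"
  proof -
    have 1: "(r + 2) * \<epsilon> = c / 2" and 2: "(r + 2) / (2 * \<epsilon>) = (r + 2)\<^sup>2 / c"
      using r c0 unfolding \<epsilon>_def by (simp_all add: power2_eq_square field_simps)
    have "(r + 2) * X * (\<epsilon> * Y + Z / (2 * \<epsilon>)) = ((r + 2) * \<epsilon>) * (X * Y) + ((r + 2) / (2 * \<epsilon>)) * (X * Z)" for Y Z
      using e by (simp add: field_simps)
    then show ?thesis by (simp add: 1 2 mult.assoc)
  qed
  finally have DF2: "\<bar>D * F * (\<eta>\<^sup>2 - \<zeta>\<^sup>2)\<bar> \<le> c / 2 * (X * \<delta>\<^sup>2 * (\<eta>\<^sup>2 + \<zeta>\<^sup>2)) + (r + 2)\<^sup>2 / c * (X * m\<^sup>2 * (\<eta> - \<zeta>)\<^sup>2)"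
    using DF by linarith
  have DE2: "c * (X * \<delta>\<^sup>2 * (\<eta>\<^sup>2 + \<zeta>\<^sup>2)) \<le> D * E * (\<eta>\<^sup>2 + \<zeta>\<^sup>2)"
    using mult_right_mono[OF DE, of "\<eta>\<^sup>2 + \<zeta>\<^sup>2"] by (simp add: mult_ac)
  have "D * (signed_power t a * \<eta>\<^sup>2 - signed_power t b * \<zeta>\<^sup>2) = (D * E * (\<eta>\<^sup>2 + \<zeta>\<^sup>2) + D * F * (\<eta>\<^sup>2 - \<zeta>\<^sup>2)) / 2"
    by (simp add: E_def F_def algebra_simps)
  also have "\<dots> \<ge> (c * (X * \<delta>\<^sup>2 * (\<eta>\<^sup>2 + \<zeta>\<^sup>2)) - (c / 2 * (X * \<delta>\<^sup>2 * (\<eta>\<^sup>2 + \<zeta>\<^sup>2)) + (r + 2)\<^sup>2 / c * (X * m\<^sup>2 * (\<eta> - \<zeta>)\<^sup>2))) / 2"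
    using DE2 DF2 by (intro divide_right_mono) linarith+
  finally show ?thesis unfolding D_def[symmetric] \<delta>_def[symmetric] m_def[symmetric] by (simp add: field_simps)
qed

text \<open>
  The coercive term of \<open>tested_monotonicity\<close> dominates the \<open>q\<close>-th power of the difference of
  \<open>\<tau>\<^sub>h u\<close>, because \<open>|a-b|\<close> is at most \<open>|a|+|b|\<close> and at most \<open>|A|+|B|\<close>.
\<close>

lemma powr_diff_le_product:
  fixes A B a b p q :: real
  assumes "2 \<le> p" "p \<le> q" and d: "a - b = A - B"
  shows "\<bar>a - b\<bar> powr q \<le> (\<bar>A\<bar> + \<bar>B\<bar>) powr (p - 2) * (\<bar>a\<bar> + \<bar>b\<bar>) powr (q - p) * (a - b)\<^sup>2"
proof (cases "a = b")
  case False
  have "\<bar>a - b\<bar> powr q = \<bar>A - B\<bar> powr (p - 2) * \<bar>a - b\<bar> powr (q - p) * \<bar>a - b\<bar> powr 2"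
    unfolding d[symmetric] powr_add[symmetric] by simp
  also have "\<dots> \<le> (\<bar>A\<bar> + \<bar>B\<bar>) powr (p - 2) * (\<bar>a\<bar> + \<bar>b\<bar>) powr (q - p) * (a - b)\<^sup>2"
    using assms False by (intro mult_mono powr_mono2) auto
  finally show ?thesis .
qed auto

text \<open>
  Young's inequality with constant \<open>1\<close>: the product is at most the larger of the two terms. Used
  pointwise, it takes the place of Hoelder's inequality for integrals.
\<close>

lemma powr_mult_le_add:
  fixes x y \<alpha> \<beta> :: real
  assumes "0 \<le> x" "0 \<le> y" "0 \<le> \<alpha>" "0 \<le> \<beta>"
  shows "x powr \<alpha> * y powr \<beta> \<le> x powr (\<alpha> + \<beta>) + y powr (\<alpha> + \<beta>)"
proof (cases "x \<le> y")
  case True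
  have "x powr \<alpha> * y powr \<beta> \<le> y powr \<alpha> * y powr \<beta>" using True assms by (intro mult_right_mono powr_mono2) auto
  then show ?thesis unfolding powr_add[symmetric, of y] by (rule add_increasing[OF powr_ge_zero])
next
  case False
  have "x powr \<alpha> * y powr \<beta> \<le> x powr \<alpha> * x powr \<beta>" using False assms by (intro mult_left_mono powr_mono2) auto
  then show ?thesis unfolding powr_add[symmetric, of x] by (rule add_increasing2[OF powr_ge_zero])
qed

lemma powr_le_one_add:
  fixes x :: real
  assumes "0 \<le> x" "0 \<le> \<alpha>" "\<alpha> \<le> \<beta>"
  shows "x powr \<alpha> \<le> 1 + x powr \<beta>"
  using powr_mult_le_add[of x 1 \<alpha> "\<beta> - \<alpha>"] assms by simp

lemma add_powr_le:
  fixes x y q :: real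
  assumes "0 \<le> x" "0 \<le> y" "0 \<le> q"
  shows "(x + y) powr q \<le> 2 powr q * (x powr q + y powr q)"
  using powr_add_le_signed[of q x y] assms by simp

lemma abs_diff_powr_le:
  fixes x y q :: real
  assumes "0 \<le> q"
  shows "\<bar>x - y\<bar> powr q \<le> 2 powr q * (\<bar>x\<bar> powr q + \<bar>y\<bar> powr q)"
proof -
  have "\<bar>x - y\<bar> powr q \<le> (\<bar>x\<bar> + \<bar>y\<bar>) powr q" using assms by (intro powr_mono2) auto
  also have "\<dots> \<le> 2 powr q * (\<bar>x\<bar> powr q + \<bar>y\<bar> powr q)" using assms by (intro add_powr_le) auto
  finally show ?thesis .
qed

lemma powr_neg_diff_le:
  fixes x y m \<beta> :: real
  assumes m: "0 < m" "m \<le> x" "m \<le> y" and \<beta>: "0 \<le> \<beta>"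
  shows "\<bar>x powr (-\<beta>) - y powr (-\<beta>)\<bar> \<le> \<beta> * m powr (-\<beta>-1) * \<bar>x - y\<bar>"
proof -
  have *: "\<bar>x powr (-\<beta>) - y powr (-\<beta>)\<bar> \<le> \<beta> * m powr (-\<beta>-1) * \<bar>x - y\<bar>" if "x < y" "m \<le> x" for x y
  proof -
    have "\<exists>z. x < z \<and> z < y \<and> y powr (-\<beta>) - x powr (-\<beta>) = (y - x) * ((-\<beta>) * z powr (-\<beta>-1))"
    proof (rule MVT2)
      fix z assume "x \<le> z" "z \<le> y"
      then show "((\<lambda>z. z powr (-\<beta>)) has_real_derivative (-\<beta>) * z powr (-\<beta> - 1)) (at z)"
        using m that by (auto intro!: derivative_eq_intros)
    qed (use that in auto)
    then obtain z where z: "x < z" "z < y" "y powr (-\<beta>) - x powr (-\<beta>) = (y - x) * ((-\<beta>) * z powr (-\<beta>-1))" by blast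
    have "z powr (-\<beta>-1) \<le> m powr (-\<beta>-1)"
      using that z m \<beta> by (intro powr_mono2') auto
    then have "(y - x) * (\<beta> * z powr (-\<beta>-1)) \<le> (y - x) * (\<beta> * m powr (-\<beta>-1))"
      using that \<beta> by (intro mult_left_mono) auto
    moreover have "\<bar>x powr (-\<beta>) - y powr (-\<beta>)\<bar> = (y - x) * (\<beta> * z powr (-\<beta>-1))"
    proof -
      have "x powr (-\<beta>) - y powr (-\<beta>) = (y - x) * (\<beta> * z powr (-\<beta>-1))" using z(3) by simp
      then show ?thesis using that \<beta> by (simp add: abs_mult)
    qed
    ultimately show ?thesis using that by (simp add: mult_ac)
  qed
  show ?thesis
    using *[of x y] *[of y x] m by (cases "x = y") (auto simp: abs_minus_commute linorder_neq_iff)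
qed

section \<open>Radial integrals\<close>

lemma ball_in_borel [measurable]: "ball (c :: 'a::metric_space) r \<in> sets borel"
  by simp

lemma nn_integral_lborel_translate:
  fixes f :: "'a::euclidean_space \<Rightarrow> ennreal"
  assumes [measurable]: "f \<in> borel_measurable borel"
  shows "(\<integral>\<^sup>+x. f (c + x) \<partial>lborel) = (\<integral>\<^sup>+x. f x \<partial>lborel)"
  by (subst (2) lborel_distr_plus[of c, symmetric]) (simp add: nn_integral_distr)

text \<open>
  A function bounded by \<open>a\<^sub>k\<close> on a shell inside the ball of radius \<open>r\<^sub>k\<close> has integral at most
  \<open>\<Sum> a\<^sub>k |B(r\<^sub>k)|\<close>. Both radial integrals below are geometric series of this kind.
\<close>

lemma nn_integral_dyadic_le:
  fixes a r :: "nat \<Rightarrow> real" and f :: "'a::euclidean_space \<Rightarrow> ennreal"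
  assumes f: "\<And>x. x \<in> S \<Longrightarrow> x \<noteq> 0 \<Longrightarrow> \<exists>k. norm x < r k \<and> f x \<le> ennreal (a k)"
    and a: "\<And>k. 0 \<le> a k" and r: "\<And>k. 0 < r k"
    and sum: "summable (\<lambda>k. a k * r k powr real DIM('a))"
  shows "(\<integral>\<^sup>+x\<in>S. f x \<partial>lborel) < \<infinity>"
proof -
  have le: "g k \<le> (\<Sum>k. g k)" for g :: "nat \<Rightarrow> ennreal" and k
    using sum_le_suminf[of g "{k}"] by simp
  have ae: "AE x::'a in lborel. x \<noteq> 0"
    by (rule AE_lborel_singleton)
  have "(\<integral>\<^sup>+x\<in>S. f x \<partial>lborel) \<le> (\<integral>\<^sup>+x. (\<Sum>k. ennreal (a k) * indicator (ball 0 (r k)) (x::'a)) \<partial>lborel)"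
  proof (rule nn_integral_mono_AE, rule eventually_mono[OF ae])
    fix x :: 'a assume elim: "x \<noteq> 0"
    show "f x * indicator S x \<le> (\<Sum>k. ennreal (a k) * indicator (ball 0 (r k)) x)"
    proof (cases "x \<in> S")
      case True
      then obtain k where k: "norm x < r k" "f x \<le> ennreal (a k)" using f elim by blast
      have "f x * indicator S x \<le> ennreal (a k) * indicator (ball 0 (r k)) x"
        using True k by (simp add: indicator_def dist_norm)
      also have "\<dots> \<le> (\<Sum>k. ennreal (a k) * indicator (ball 0 (r k)) x)"
        by (rule le)
      finally show ?thesis .
    qed simp
  qed
  also have "\<dots> = (\<Sum>k. \<integral>\<^sup>+x. ennreal (a k) * indicator (ball 0 (r k)) (x::'a) \<partial>lborel)"
    by (rule nn_integral_suminf) auto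
  also have "\<dots> = (\<Sum>k. ennreal (unit_ball_vol DIM('a) * (a k * r k powr real DIM('a))))"
  proof (rule suminf_cong)
    fix k
    have "(\<integral>\<^sup>+x. ennreal (a k) * indicator (ball 0 (r k)) (x::'a) \<partial>lborel) = ennreal (a k) * emeasure lborel (ball (0::'a) (r k))"
      by (rule nn_integral_cmult_indicator) auto
    also have "\<dots> = ennreal (a k) * ennreal (unit_ball_vol DIM('a) * r k ^ DIM('a))"
      using r[of k] by (subst emeasure_ball) auto
    also have "\<dots> = ennreal (unit_ball_vol DIM('a) * (a k * r k powr real DIM('a)))"
      using r[of k] a[of k] by (simp add: ennreal_mult[symmetric] powr_realpow mult_ac)
    finally show "(\<integral>\<^sup>+x. ennreal (a k) * indicator (ball 0 (r k)) (x::'a) \<partial>lborel) = ennreal (unit_ball_vol DIM('a) * (a k * r k powr real DIM('a)))" .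
  qed
  also have "\<dots> = ennreal (\<Sum>k. unit_ball_vol DIM('a) * (a k * r k powr real DIM('a)))"
    using sum a by (intro suminf_ennreal2 summable_mult) auto
  also have "\<dots> < \<infinity>" by simp
  finally show ?thesis .
qed

lemma exists_dyadic_shell:
  fixes x R :: real
  assumes "0 < x" "x < R"
  shows "\<exists>k::nat. R / 2 ^ Suc k \<le> x \<and> x < R / 2 ^ k"
proof -
  obtain n where n: "R / x < 2 ^ n" using real_arch_pow[of 2 "R / x"] by auto
  define k where "k = (LEAST n. R / 2 ^ n \<le> x)"
  have ex: "R / 2 ^ n \<le> x" using n assms by (simp add: field_simps)
  have k: "R / 2 ^ k \<le> x" unfolding k_def by (rule LeastI, rule ex)
  then have "k \<noteq> 0" using assms by (intro notI) simp
  then obtain j where j: "k = Suc j" by (cases k) auto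
  have "\<not> (R / 2 ^ j \<le> x)" using not_less_Least[of j "\<lambda>n. R / 2 ^ n \<le> x"] j unfolding k_def by simp
  then show ?thesis using k j by (intro exI[of _ j]) auto
qed

lemma powr_dyadic: "(2 powr b) ^ k = (2 ^ k) powr (b::real)"
  by (simp add: powr_realpow[symmetric] powr_powr mult.commute)

lemma nn_integral_norm_powr_ball:
  fixes \<sigma> R :: real
  assumes "0 < \<sigma>" "0 < R"
  shows "(\<integral>\<^sup>+x\<in>ball (0::'a::euclidean_space) R. ennreal (norm x powr (\<sigma> - real DIM('a))) \<partial>lborel) < \<infinity>"
proof -
  let ?N = "real DIM('a)"
  define r where "r = (\<lambda>k::nat. R / 2 ^ k)"
  define a where "a = (\<lambda>k. r k powr \<sigma> * (r k / 2) powr (-?N))"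
  have r: "0 < r k" for k using assms by (simp add: r_def)
  show ?thesis
  proof (rule nn_integral_dyadic_le[where r = r and a = a])
    fix x :: 'a assume x: "x \<in> ball 0 R" "x \<noteq> 0"
    then obtain k where k: "R / 2 ^ Suc k \<le> norm x" "norm x < R / 2 ^ k"
      using exists_dyadic_shell[of "norm x" R] by auto
    have "norm x powr (\<sigma> - ?N) = norm x powr \<sigma> * norm x powr (-?N)"
      by (simp add: powr_add[symmetric])
    also have "\<dots> \<le> a k"
      unfolding a_def using k assms r[of k] x by (intro mult_mono powr_mono2 powr_mono2') (auto simp: r_def)
    finally show "\<exists>k. norm x < r k \<and> ennreal (norm x powr (\<sigma> - ?N)) \<le> ennreal (a k)"
      using k by (intro exI[of _ k]) (auto simp: r_def intro!: ennreal_leI)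
  next
    have "a k * r k powr ?N = 2 powr ?N * R powr \<sigma> * (2 powr (-\<sigma>)) ^ k" for k
    proof -
      have "a k * r k powr ?N = r k powr \<sigma> * 2 powr ?N"
        using r[of k] by (simp add: a_def powr_divide powr_minus field_simps)
      also have "r k powr \<sigma> = R powr \<sigma> * (2 powr (-\<sigma>)) ^ k"
        unfolding powr_dyadic using assms by (simp add: r_def powr_divide powr_minus field_simps)
      finally show ?thesis by simp
    qed
    moreover have "summable (\<lambda>k. 2 powr ?N * R powr \<sigma> * (2 powr (-\<sigma>)) ^ k)"
      using assms by (intro summable_mult summable_geometric) (simp add: powr_minus field_simps)
    ultimately show "summable (\<lambda>k. a k * r k powr real DIM('a))" by simp
  qed (auto simp: r a_def)
qed

lemma nn_integral_norm_powr_outside_ball: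
  fixes \<sigma> R :: real
  assumes "0 < \<sigma>" "0 < R"
  shows "(\<integral>\<^sup>+x\<in>- ball (0::'a::euclidean_space) R. ennreal (norm x powr (- (real DIM('a) + \<sigma>))) \<partial>lborel) < \<infinity>"
proof -
  let ?N = "real DIM('a)"
  define r where "r = (\<lambda>k::nat. 2 * R * 2 ^ k)"
  define a where "a = (\<lambda>k. (r k / 2) powr (- (?N + \<sigma>)))"
  have r: "0 < r k" for k using assms by (simp add: r_def)
  show ?thesis
  proof (rule nn_integral_dyadic_le[where r = r and a = a])
    fix x :: 'a assume x: "x \<in> - ball 0 R" "x \<noteq> 0"
    then have R: "R \<le> norm x" by (auto simp: dist_norm)
    obtain n where n: "norm x / R < 2 ^ n" using real_arch_pow[of 2 "norm x / R"] by auto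
    define k where "k = (LEAST n. norm x < 2 * R * 2 ^ n)"
    have "norm x < 2 * R * 2 ^ n" using n assms R by (simp add: field_simps)
    then have k: "norm x < 2 * R * 2 ^ k" unfolding k_def by (rule LeastI)
    have k2: "R * 2 ^ k \<le> norm x"
    proof (cases k)
      case 0 then show ?thesis using R by simp
    next
      case (Suc j)
      have "\<not> (norm x < 2 * R * 2 ^ j)" using not_less_Least[of j "\<lambda>n. norm x < 2 * R * 2 ^ n"] Suc unfolding k_def by simp
      then show ?thesis using Suc by simp
    qed
    have "norm x powr (- (?N + \<sigma>)) \<le> a k"
      unfolding a_def using k2 assms r[of k] x by (intro powr_mono2') (auto simp: r_def)
    then show "\<exists>k. norm x < r k \<and> ennreal (norm x powr (- (?N + \<sigma>))) \<le> ennreal (a k)"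
      using k by (intro exI[of _ k]) (auto simp: r_def intro!: ennreal_leI)
  next
    have "a k * r k powr ?N = 2 powr ?N * R powr (-\<sigma>) * (2 powr (-\<sigma>)) ^ k" for k
    proof -
      have "a k * r k powr ?N = (r k / 2) powr (- \<sigma>) * ((r k / 2) powr (- ?N) * r k powr ?N)"
        by (simp add: a_def powr_diff powr_minus field_simps powr_add)
      also have "(r k / 2) powr (- ?N) * r k powr ?N = 2 powr ?N"
        using r[of k] by (simp add: powr_divide powr_minus field_simps)
      also have "(r k / 2) powr (- \<sigma>) = R powr (-\<sigma>) * (2 powr (-\<sigma>)) ^ k"
        unfolding powr_dyadic using assms by (simp add: r_def powr_mult)
      finally show ?thesis by simp
    qed
    moreover have "summable (\<lambda>k. 2 powr ?N * R powr (-\<sigma>) * (2 powr (-\<sigma>)) ^ k)"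
      using assms by (intro summable_mult summable_geometric) (simp add: powr_minus field_simps)
    ultimately show "summable (\<lambda>k. a k * r k powr real DIM('a))" by simp
  qed (auto simp: r a_def)
qed

section \<open>Energies and translations\<close>

text \<open>
  The \<open>q\<close>-th power of the Gagliardo seminorm of order \<open>\<sigma>/q\<close>. It is parametrised by
  \<open>\<sigma>\<close> because the kernel exponent \<open>N + sp\<close> stays fixed while \<open>q\<close> varies, and it is written as an iterated
  integral so that translations and Tonelli apply directly.
\<close>

definition kernel_energy :: "real \<Rightarrow> real \<Rightarrow> 'a::euclidean_space set \<Rightarrow> ('a \<Rightarrow> real) \<Rightarrow> ennreal" where
  "kernel_energy \<sigma> q E w =
     (\<integral>\<^sup>+x\<in>E. (\<integral>\<^sup>+y\<in>E. ennreal (\<bar>w x - w y\<bar> powr q * norm (x - y) powr (- (real DIM('a) + \<sigma>))) \<partial>lborel) \<partial>lborel)"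

lemma kernel_energy_mono_set:
  "A \<subseteq> B \<Longrightarrow> kernel_energy \<sigma> q A w \<le> kernel_energy \<sigma> q B w"
  unfolding kernel_energy_def by (intro nn_integral_mono mult_mono) (auto simp: indicator_def)

abbreviation translation_energy :: "real \<Rightarrow> real \<Rightarrow> 'a::euclidean_space \<Rightarrow> ('a \<Rightarrow> real) \<Rightarrow> ennreal" where
  "translation_energy q \<rho> h w \<equiv> (\<integral>\<^sup>+x\<in>ball 0 \<rho>. ennreal (\<bar>w (x + h) - w x\<bar> powr q) \<partial>lborel)"

lemma nn_integral_indicator_translate_le:
  fixes G :: "'a::euclidean_space \<Rightarrow> ennreal"
  assumes [measurable]: "G \<in> borel_measurable borel" and "norm h + \<rho> \<le> R"
  shows "(\<integral>\<^sup>+x\<in>ball 0 \<rho>. G (x + h) \<partial>lborel) \<le> (\<integral>\<^sup>+x\<in>ball 0 R. G x \<partial>lborel)"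
proof -
  have "(\<integral>\<^sup>+x\<in>ball 0 \<rho>. G (x + h) \<partial>lborel) \<le> (\<integral>\<^sup>+x. G (h + x) * indicator (ball 0 R) (h + x) \<partial>lborel)"
  proof (rule nn_integral_mono)
    fix x :: 'a
    have "norm (h + x) < R" if "norm x < \<rho>" using that assms norm_triangle_ineq[of h x] by linarith
    then show "G (x + h) * indicator (ball 0 \<rho>) x \<le> G (h + x) * indicator (ball 0 R) (h + x)"
      by (auto simp: indicator_def add.commute)
  qed
  also have "\<dots> = (\<integral>\<^sup>+x\<in>ball 0 R. G x \<partial>lborel)"
    by (rule nn_integral_lborel_translate) measurable
  finally show ?thesis .
qed

text \<open>
  Both values are compared with \<open>w(z)\<close> and averaged over all \<open>z\<close> in the ball of radius
  \<open>|h|\<close> around \<open>x\<close>. There \<open>|x-z|\<close> and \<open>|x+h-z|\<close> are at most \<open>2|h|\<close>, so the kernel may be inserted at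
  the cost of \<open>|h|\<^bsup>N+\<sigma>\<^esup>\<close>, of which the average gives back \<open>|h|\<^sup>N\<close>.
\<close>

lemma translation_difference_le_kernel_energy:
  fixes w :: "'a::euclidean_space \<Rightarrow> real" and h :: 'a
  assumes [measurable]: "w \<in> borel_measurable borel" and q: "0 < q" and \<sigma>: "0 < \<sigma>" and R: "norm h + \<rho> \<le> R"
  defines "C \<equiv> 2 powr (q + 1 + real DIM('a) + \<sigma>) / unit_ball_vol (real DIM('a))"
  shows "translation_energy q \<rho> h w
     \<le> ennreal (C * norm h powr \<sigma>) * kernel_energy \<sigma> q (ball 0 R) w"
proof (cases "h = 0")
  case False
  let ?N = "real DIM('a)"
  define v where "v = unit_ball_vol ?N * norm h powr ?N"
  define K where "K = 2 powr q * (2 * norm h) powr (?N + \<sigma>)"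
  define e where "e = (\<lambda>x z::'a. ennreal (\<bar>w x - w z\<bar> powr q * norm (x - z) powr (- (?N + \<sigma>))))"
  define G where "G = (\<lambda>x. \<integral>\<^sup>+z\<in>ball 0 R. e x z \<partial>lborel)"
  have [measurable]: "(\<lambda>(x, z). e x z) \<in> borel_measurable (borel \<Otimes>\<^sub>M borel)"
    unfolding e_def by measurable
  have [measurable]: "G \<in> borel_measurable borel" unfolding G_def by measurable
  have v0: "0 < v" using False by (simp add: v_def)
  have vol: "emeasure lborel (ball x (norm h)) = ennreal v" for x :: 'a
    using False by (subst emeasure_ball) (auto simp: v_def powr_realpow)
  have key: "ennreal (\<bar>w y - w z\<bar> powr q) \<le> ennreal ((2 * norm h) powr (?N + \<sigma>)) * e y z" if "norm (y - z) \<le> 2 * norm h" for y z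
  proof (cases "y = z")
    case yz: False
    have "1 = norm (y - z) powr (?N + \<sigma>) * norm (y - z) powr (- (?N + \<sigma>))" using yz by (simp add: powr_add[symmetric])
    also have "\<dots> \<le> (2 * norm h) powr (?N + \<sigma>) * norm (y - z) powr (- (?N + \<sigma>))"
      using that \<sigma> by (intro mult_right_mono powr_mono2) auto
    finally have "\<bar>w y - w z\<bar> powr q * 1 \<le> \<bar>w y - w z\<bar> powr q * ((2 * norm h) powr (?N + \<sigma>) * norm (y - z) powr (- (?N + \<sigma>)))"
      by (rule mult_left_mono) auto
    then show ?thesis unfolding e_def by (simp add: ennreal_mult[symmetric] mult_ac ennreal_leI)
  qed simp
  have point: "ennreal v * ennreal (\<bar>w (x + h) - w x\<bar> powr q) \<le> ennreal K * (G (x + h) + G x)"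
    if x: "x \<in> ball 0 \<rho>" for x
  proof -
    have "ennreal v * ennreal (\<bar>w (x + h) - w x\<bar> powr q) = (\<integral>\<^sup>+z. ennreal (\<bar>w (x + h) - w x\<bar> powr q) * indicator (ball x (norm h)) z \<partial>lborel)"
      by (subst nn_integral_cmult_indicator) (auto simp: vol mult.commute)
    also have "\<dots> \<le> (\<integral>\<^sup>+z. ennreal K * (e (x + h) z * indicator (ball 0 R) z + e x z * indicator (ball 0 R) z) \<partial>lborel)"
    proof (rule nn_integral_mono)
      fix z
      show "ennreal (\<bar>w (x + h) - w x\<bar> powr q) * indicator (ball x (norm h)) z
        \<le> ennreal K * (e (x + h) z * indicator (ball 0 R) z + e x z * indicator (ball 0 R) z)"
      proof (cases "z \<in> ball x (norm h)")
        case True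
        then have d: "norm (x - z) < norm h" by (simp add: dist_norm)
        have d2: "norm (x + h - z) \<le> 2 * norm h" using d norm_triangle_ineq[of "x - z" h] by (simp add: algebra_simps)
        have "norm z < R" using x R d norm_triangle_ineq[of x "z - x"] by (simp add: norm_minus_commute)
        have "\<bar>w (x + h) - w x\<bar> powr q \<le> 2 powr q * (\<bar>w (x + h) - w z\<bar> powr q + \<bar>w x - w z\<bar> powr q)"
          using abs_diff_powr_le[of q "w (x + h) - w z" "w x - w z"] q by simp
        then have "ennreal (\<bar>w (x + h) - w x\<bar> powr q)
           \<le> ennreal (2 powr q) * (ennreal (\<bar>w (x + h) - w z\<bar> powr q) + ennreal (\<bar>w x - w z\<bar> powr q))"
          by (simp add: ennreal_mult[symmetric] ennreal_leI ennreal_plus[symmetric] del: ennreal_plus)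
        also have "\<dots> \<le> ennreal (2 powr q) * (ennreal ((2 * norm h) powr (?N + \<sigma>)) * e (x + h) z + ennreal ((2 * norm h) powr (?N + \<sigma>)) * e x z)"
          using d d2 norm_ge_zero[of h] by (intro mult_left_mono add_mono key) (simp_all del: norm_ge_zero)
        also have "\<dots> = ennreal K * (e (x + h) z + e x z)"
          unfolding K_def by (simp add: ennreal_mult distrib_left mult.assoc)
        finally show ?thesis using \<open>norm z < R\<close> True by simp
      qed simp
    qed
    also have "\<dots> = ennreal K * (G (x + h) + G x)"
      unfolding G_def by (subst nn_integral_cmult, measurable, subst nn_integral_add, measurable)
    finally show ?thesis .
  qed
  have GE: "kernel_energy \<sigma> q (ball 0 R) w = (\<integral>\<^sup>+x\<in>ball 0 R. G x \<partial>lborel)"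
    unfolding kernel_energy_def G_def e_def ..
  have "ennreal v * translation_energy q \<rho> h w
     = (\<integral>\<^sup>+x. ennreal v * (ennreal (\<bar>w (x + h) - w x\<bar> powr q) * indicator (ball 0 \<rho>) x) \<partial>lborel)"
    by (subst nn_integral_cmult) auto
  also have "\<dots> \<le> (\<integral>\<^sup>+x. ennreal K * (G (x + h) * indicator (ball 0 \<rho>) x + G x * indicator (ball 0 \<rho>) x) \<partial>lborel)"
  proof (rule nn_integral_mono)
    fix x
    show "ennreal v * (ennreal (\<bar>w (x + h) - w x\<bar> powr q) * indicator (ball 0 \<rho>) x)
       \<le> ennreal K * (G (x + h) * indicator (ball 0 \<rho>) x + G x * indicator (ball 0 \<rho>) x)"
      using point[of x] by (cases "x \<in> ball 0 \<rho>") auto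
  qed
  also have "\<dots> = ennreal K * ((\<integral>\<^sup>+x\<in>ball 0 \<rho>. G (x + h) \<partial>lborel) + (\<integral>\<^sup>+x\<in>ball 0 \<rho>. G x \<partial>lborel))"
    by (subst nn_integral_cmult, measurable, subst nn_integral_add, measurable)
  also have "\<dots> \<le> ennreal K * (kernel_energy \<sigma> q (ball 0 R) w + kernel_energy \<sigma> q (ball 0 R) w)"
  proof (intro mult_left_mono add_mono)
    show "(\<integral>\<^sup>+x\<in>ball 0 \<rho>. G (x + h) \<partial>lborel) \<le> kernel_energy \<sigma> q (ball 0 R) w"
      unfolding GE by (rule nn_integral_indicator_translate_le) (use R in auto)
    have "\<rho> \<le> R" using R norm_ge_zero[of h] by linarith
    then show "(\<integral>\<^sup>+x\<in>ball 0 \<rho>. G x \<partial>lborel) \<le> kernel_energy \<sigma> q (ball 0 R) w"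
      unfolding GE by (intro nn_integral_mono mult_left_mono) (auto simp: indicator_def)
  qed auto
  also have "\<dots> = ennreal (2 * K) * kernel_energy \<sigma> q (ball 0 R) w"
    by (simp add: mult_2[symmetric] ennreal_mult K_def mult_ac)
  finally have "ennreal (1 / v) * (ennreal v * translation_energy q \<rho> h w)
    \<le> ennreal (1 / v) * (ennreal (2 * K) * kernel_energy \<sigma> q (ball 0 R) w)"
    by (rule mult_left_mono) auto
  then have "translation_energy q \<rho> h w
    \<le> ennreal (1 / v * (2 * K)) * kernel_energy \<sigma> q (ball 0 R) w"
    using v0 unfolding mult.assoc[symmetric] by (simp add: ennreal_mult[symmetric] K_def)
  also have "1 / v * (2 * K) = C * norm h powr \<sigma>"
    using False unfolding v_def K_def C_def
    by (simp add: powr_add powr_mult field_simps)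
  finally show ?thesis .
qed (use q in simp)

text \<open>
  From \<open>\<tau>\<^sub>2\<^sub>hw = 2\<tau>\<^sub>hw + \<tau>\<^sub>h\<tau>\<^sub>hw\<close> the first difference at \<open>h\<close> is half of that at \<open>2h\<close>, up to the
  second difference. Since \<open>\<theta> < 1\<close>, half of \<open>(2|h|)\<^sup>\<theta>\<close> is smaller than \<open>|h|\<^sup>\<theta>\<close> by a fixed factor, which leaves
  room for the second difference. The bound then propagates from the outermost dyadic shell
  of \<open>h\<close> to all smaller ones. The constant serves all functions at once.
\<close>

lemma first_difference_le_of_second:
  fixes \<theta> q h0 \<rho> C K :: real
  assumes \<theta>: "\<theta> < 1" and q: "0 < q" and h0: "0 < h0" and C: "0 \<le> C" and K: "0 \<le> K"
  shows "\<exists>M\<ge>0. \<forall>w :: 'a::euclidean_space \<Rightarrow> real. w \<in> borel_measurable borel \<longrightarrow>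
     (\<forall>h. norm h < h0 \<longrightarrow> (\<integral>\<^sup>+x\<in>ball 0 \<rho>. ennreal (\<bar>w (x + 2 *\<^sub>R h) - 2 * w (x + h) + w x\<bar> powr q) \<partial>lborel) \<le> ennreal (C * norm h powr (\<theta> * q))) \<longrightarrow>
     (\<forall>h. norm h < h0 \<longrightarrow> translation_energy q \<rho> h w \<le> ennreal K) \<longrightarrow>
     (\<forall>h. norm h < h0 \<longrightarrow> translation_energy q \<rho> h w \<le> ennreal (M * norm h powr (\<theta> * q)))"
proof -
  \<comment> \<open>\<open>1+\<delta>\<close> lies strictly between \<open>1\<close> and \<open>2\<^bsup>1-\<theta>\<^esup>\<close>, which gives \<open>\<mu> < 1\<close> below.\<close>
  define \<delta> where "\<delta> = 2 powr ((1 - \<theta>) / 2) - 1"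
  define a where "a = ((1 + \<delta>) / 2) powr q"
  define b where "b = ((1 + 1 / \<delta>) / 2) powr q"
  define \<mu> where "\<mu> = a * 2 powr (\<theta> * q)"
  have \<delta>: "0 < \<delta>" using \<theta> by (simp add: \<delta>_def)
  have "\<mu> = 2 powr (((1 - \<theta>) / 2 - 1 + \<theta>) * q)"
    unfolding \<mu>_def a_def \<delta>_def by (simp add: powr_divide powr_powr powr_add[symmetric] powr_diff[symmetric] algebra_simps)
  also have "\<dots> < 1" 
  proof -
    have "(1 - \<theta>) / 2 - 1 + \<theta> < 0" using \<theta> by (simp add: field_simps)
    then have "((1 - \<theta>) / 2 - 1 + \<theta>) * q < 0" using q by (rule mult_neg_pos)
    then show ?thesis using powr_less_mono[of "((1 - \<theta>) / 2 - 1 + \<theta>) * q" 0 2] by simp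
  qed
  finally have \<mu>: "\<mu> < 1" .
  have ab: "0 \<le> a" "0 \<le> b" "0 \<le> \<mu>" by (auto simp: a_def b_def \<mu>_def)
  \<comment> \<open>A lower bound of \<open>|h|\<^bsup>\<theta>q\<^esup>\<close> on the outermost shell, for either sign of \<open>\<theta>\<close>.\<close>
  define B where "B = (if 0 \<le> \<theta> then (h0 / 2) powr (\<theta> * q) else h0 powr (\<theta> * q))"
  have B: "0 < B" using h0 by (simp add: B_def)
  have Bh: "B \<le> norm h powr (\<theta> * q)" if "h0 / 2 \<le> norm h" "norm h < h0" for h :: 'a
  proof (cases "0 \<le> \<theta>")
    case True
    then show ?thesis using that q h0 unfolding B_def by (auto intro!: powr_mono2)
  next
    case False
    then show ?thesis using that q h0 unfolding B_def by (auto intro!: powr_mono2' simp: mult_nonpos_nonneg)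
  qed
  define M where "M = max (K / B) (b * C / (1 - \<mu>))"
  have M: "0 \<le> M" using K B by (simp add: M_def le_max_iff_disj)
  have MK: "K \<le> M * B" using B unfolding M_def by (simp add: max_def field_simps)
  have MC: "\<mu> * M + b * C \<le> M"
  proof -
    have "b * C / (1 - \<mu>) \<le> M" by (simp add: M_def)
    then have "b * C \<le> M * (1 - \<mu>)" using \<mu> by (simp add: field_simps)
    then show ?thesis by (simp add: algebra_simps)
  qed
  have pt: "\<bar>s\<bar> powr q \<le> a * \<bar>y\<bar> powr q + b * \<bar>z\<bar> powr q" if s: "2 * s = y - z" for s y z :: real
  proof (cases "\<bar>z\<bar> \<le> \<delta> * \<bar>y\<bar>")
    case True
    have "\<bar>s\<bar> \<le> (1 + \<delta>) / 2 * \<bar>y\<bar>" using True s \<delta> by (simp add: field_simps)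
    then have "\<bar>s\<bar> powr q \<le> ((1 + \<delta>) / 2 * \<bar>y\<bar>) powr q" using q by (intro powr_mono2) auto
    also have "\<dots> = a * \<bar>y\<bar> powr q" unfolding a_def using \<delta> by (subst powr_mult) auto
    finally show ?thesis using ab by (simp add: add_increasing2)
  next
    case False
    have "\<bar>y\<bar> \<le> \<bar>z\<bar> / \<delta>" using False \<delta> by (simp add: field_simps)
    then have "\<bar>s\<bar> \<le> (1 + 1 / \<delta>) / 2 * \<bar>z\<bar>" using s by (simp add: distrib_right)
    then have "\<bar>s\<bar> powr q \<le> ((1 + 1 / \<delta>) / 2 * \<bar>z\<bar>) powr q" using q by (intro powr_mono2) auto
    also have "\<dots> = b * \<bar>z\<bar> powr q" unfolding b_def using \<delta> by (subst powr_mult) auto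
    finally show ?thesis using ab by (simp add: add_increasing)
  qed
  show ?thesis
  proof (intro exI[of _ M] conjI allI impI)
    show "0 \<le> M" by (rule M)
    fix w :: "'a \<Rightarrow> real" and h :: 'a
    assume [measurable]: "w \<in> borel_measurable borel"
    define F where "F = (\<lambda>h. \<integral>\<^sup>+x\<in>ball 0 \<rho>. ennreal (\<bar>w (x + h) - w x\<bar> powr q) \<partial>lborel)"
    define F2 where "F2 = (\<lambda>h. \<integral>\<^sup>+x\<in>ball 0 \<rho>. ennreal (\<bar>w (x + 2 *\<^sub>R h) - 2 * w (x + h) + w x\<bar> powr q) \<partial>lborel)"
    assume 2: "\<forall>h. norm h < h0 \<longrightarrow> F2 h \<le> ennreal (C * norm h powr (\<theta> * q))"
      and 1: "\<forall>h. norm h < h0 \<longrightarrow> F h \<le> ennreal K"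
    have rec: "F h \<le> ennreal a * F (2 *\<^sub>R h) + ennreal b * F2 h" for h
    proof -
      have "F h \<le> (\<integral>\<^sup>+x. ennreal a * (ennreal (\<bar>w (x + 2 *\<^sub>R h) - w x\<bar> powr q) * indicator (ball 0 \<rho>) x)
         + ennreal b * (ennreal (\<bar>w (x + 2 *\<^sub>R h) - 2 * w (x + h) + w x\<bar> powr q) * indicator (ball 0 \<rho>) x) \<partial>lborel)"
        unfolding F_def
      proof (rule nn_integral_mono)
        fix x
        have "\<bar>w (x + h) - w x\<bar> powr q \<le> a * \<bar>w (x + 2 *\<^sub>R h) - w x\<bar> powr q + b * \<bar>w (x + 2 *\<^sub>R h) - 2 * w (x + h) + w x\<bar> powr q"
          by (rule pt) simp
        then have "ennreal (\<bar>w (x + h) - w x\<bar> powr q) \<le> ennreal a * ennreal (\<bar>w (x + 2 *\<^sub>R h) - w x\<bar> powr q) + ennreal b * ennreal (\<bar>w (x + 2 *\<^sub>R h) - 2 * w (x + h) + w x\<bar> powr q)"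
          using ab by (simp add: ennreal_mult[symmetric] ennreal_plus[symmetric] ennreal_leI del: ennreal_plus)
        then show "ennreal (\<bar>w (x + h) - w x\<bar> powr q) * indicator (ball 0 \<rho>) x \<le> ennreal a * (ennreal (\<bar>w (x + 2 *\<^sub>R h) - w x\<bar> powr q) * indicator (ball 0 \<rho>) x)
         + ennreal b * (ennreal (\<bar>w (x + 2 *\<^sub>R h) - 2 * w (x + h) + w x\<bar> powr q) * indicator (ball 0 \<rho>) x)"
          by (auto simp: indicator_def)
      qed
      also have "\<dots> = ennreal a * F (2 *\<^sub>R h) + ennreal b * F2 h"
        unfolding F_def F2_def by (subst nn_integral_add, measurable, subst nn_integral_cmult, measurable, subst nn_integral_cmult, measurable)
      finally show ?thesis .
    qed
    have base: "F h \<le> ennreal (M * norm h powr (\<theta> * q))" if "h0 / 2 \<le> norm h" "norm h < h0" for h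
    proof -
      have "F h \<le> ennreal K" using 1 that by blast
      also have "K \<le> M * norm h powr (\<theta> * q)" using MK mult_left_mono[OF Bh[OF that] M] by linarith
      finally show ?thesis using ennreal_leI by blast
    qed
    have "\<forall>h. h0 / 2 ^ Suc k \<le> norm h \<and> norm h < h0 \<longrightarrow> F h \<le> ennreal (M * norm h powr (\<theta> * q))" for k
    proof (induction k)
      case 0
      then show ?case using base by simp
    next
      case (Suc k)
      show ?case
      proof (intro allI impI)
        fix h :: 'a assume h: "h0 / 2 ^ Suc (Suc k) \<le> norm h \<and> norm h < h0"
        show "F h \<le> ennreal (M * norm h powr (\<theta> * q))"
        proof (cases "h0 / 2 \<le> norm h")
          case True
          then show ?thesis using base h by blast
        next
          case False
          have "F (2 *\<^sub>R h) \<le> ennreal (M * norm (2 *\<^sub>R h) powr (\<theta> * q))"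
            using h False by (intro Suc.IH[rule_format]) (simp add: field_simps)
          then have "ennreal a * F (2 *\<^sub>R h) + ennreal b * F2 h \<le> ennreal a * ennreal (M * norm (2 *\<^sub>R h) powr (\<theta> * q)) + ennreal b * ennreal (C * norm h powr (\<theta> * q))"
            using 2 h by (intro add_mono mult_left_mono) auto
          with rec[of h] have "F h \<le> ennreal a * ennreal (M * norm (2 *\<^sub>R h) powr (\<theta> * q)) + ennreal b * ennreal (C * norm h powr (\<theta> * q))"
            by (rule order_trans)
          also have "\<dots> = ennreal ((\<mu> * M + b * C) * norm h powr (\<theta> * q))"
            using ab M C by (simp add: ennreal_mult[symmetric] ennreal_plus[symmetric] \<mu>_def powr_mult algebra_simps del: ennreal_plus)
          also have "\<dots> \<le> ennreal (M * norm h powr (\<theta> * q))"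
            using MC by (intro ennreal_leI mult_right_mono) auto
          finally show ?thesis .
        qed
      qed
    qed
    note all = this
    assume h: "norm h < h0"
    show "F h \<le> ennreal (M * norm h powr (\<theta> * q))"
    proof (cases "h = 0")
      case True
      then show ?thesis using q by (simp add: F_def)
    next
      case False
      then obtain k where "h0 / 2 ^ Suc k \<le> norm h" using exists_dyadic_shell[of "norm h" h0] h by auto
      then show ?thesis using all h by blast
    qed
  qed
qed

text \<open>
  In the variable \<open>h = y-x\<close> the energy is \<open>\<integral> |h|\<^bsup>-N-\<sigma>\<^esup> \<integral> |\<tau>\<^sub>hw|\<^sup>q dx dh\<close>, and
  \<open>|h|\<^bsup>\<tau>-\<sigma>-N\<^esup>\<close> is integrable at \<open>0\<close>. Far from the diagonal the bound on \<open>w\<close> suffices.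
\<close>

lemma kernel_energy_le_of_translations:
  fixes \<sigma> \<tau> q h0 \<rho> C :: real
  assumes \<sigma>: "0 < \<sigma>" "\<sigma> < \<tau>" and q: "0 < q" and h0: "0 < h0" and C: "0 \<le> C" and \<rho>: "0 < \<rho>"
  shows "\<exists>M\<ge>0. \<forall>w :: 'a::euclidean_space \<Rightarrow> real. w \<in> borel_measurable borel \<longrightarrow>
     (\<forall>x\<in>ball 0 \<rho>. \<bar>w x\<bar> \<le> 1) \<longrightarrow>
     (\<forall>h. norm h < h0 \<longrightarrow> translation_energy q \<rho> h w \<le> ennreal (C * norm h powr \<tau>)) \<longrightarrow>
     kernel_energy \<sigma> q (ball 0 \<rho>) w \<le> ennreal M"
proof -
  let ?N = "real DIM('a)"
  define I where "I = (\<integral>\<^sup>+h\<in>ball (0::'a) h0. ennreal (norm h powr ((\<tau> - \<sigma>) - ?N)) \<partial>lborel)"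
  define c where "c = 2 powr q * h0 powr (- (?N + \<sigma>))"
  define V where "V = emeasure lborel (ball (0::'a) \<rho>)"
  have I: "I < \<infinity>" unfolding I_def by (rule nn_integral_norm_powr_ball) (use \<sigma> h0 in auto)
  have V: "V < \<infinity>" unfolding V_def using \<rho> by (subst emeasure_ball) auto
  define M where "M = enn2real (ennreal C * I + ennreal c * V * V)"
  have fin: "ennreal C * I + ennreal c * V * V < \<infinity>" using I V by (simp add: ennreal_mult_less_top)
  have M: "ennreal M = ennreal C * I + ennreal c * V * V" unfolding M_def using fin by (simp add: less_top)
  show ?thesis
  proof (intro exI[of _ M] conjI allI impI)
    show "0 \<le> M" by (simp add: M_def)
    fix w :: "'a \<Rightarrow> real"
    assume [measurable]: "w \<in> borel_measurable borel" and b: "\<forall>x\<in>ball 0 \<rho>. \<bar>w x\<bar> \<le> 1"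
      and tr: "\<forall>h. norm h < h0 \<longrightarrow> translation_energy q \<rho> h w \<le> ennreal (C * norm h powr \<tau>)"
    define e where "e = (\<lambda>x z::'a. ennreal (\<bar>w x - w z\<bar> powr q * norm (x - z) powr (- (?N + \<sigma>))))"
    have [measurable]: "(\<lambda>(x, z). e x z) \<in> borel_measurable (borel \<Otimes>\<^sub>M borel)"
      unfolding e_def by measurable
    define g where "g = (\<lambda>x z::'a. e x z * indicator (ball 0 h0) (z - x) * indicator (ball 0 \<rho>) x)"
    have [measurable]: "(\<lambda>(x, z). g x z) \<in> borel_measurable (borel \<Otimes>\<^sub>M borel)"
      unfolding g_def by measurable
    have [measurable]: "(\<lambda>(x, z). g x (x + z)) \<in> borel_measurable (borel \<Otimes>\<^sub>M borel)"
      unfolding g_def e_def by measurable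
    have split: "e x z * indicator (ball 0 \<rho>) z * indicator (ball 0 \<rho>) x \<le> g x z + ennreal c * indicator (ball 0 \<rho>) z * indicator (ball 0 \<rho>) x" for x z
    proof (cases "x \<in> ball 0 \<rho> \<and> z \<in> ball 0 \<rho>")
      case True
      show ?thesis
      proof (cases "z - x \<in> ball 0 h0")
        case False
        have "\<bar>w x - w z\<bar> \<le> 2" using b True by (smt (verit, best))
        then have "\<bar>w x - w z\<bar> powr q \<le> 2 powr q" using q by (intro powr_mono2) auto
        moreover have "norm (x - z) powr (- (?N + \<sigma>)) \<le> h0 powr (- (?N + \<sigma>))"
          using False h0 \<sigma> by (intro powr_mono2') (auto simp: norm_minus_commute)
        ultimately have "e x z \<le> ennreal c" unfolding e_def c_def by (intro ennreal_leI mult_mono) auto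
        then show ?thesis using True by (simp add: add_increasing)
      qed (use True in \<open>simp add: g_def\<close>)
    qed auto
    have "kernel_energy \<sigma> q (ball 0 \<rho>) w = (\<integral>\<^sup>+x. \<integral>\<^sup>+z. e x z * indicator (ball 0 \<rho>) z * indicator (ball 0 \<rho>) x \<partial>lborel \<partial>lborel)"
      unfolding kernel_energy_def
      by (intro nn_integral_cong, subst nn_integral_multc[symmetric], measurable) (simp_all add: e_def mult_ac)
    also have "\<dots> \<le> (\<integral>\<^sup>+x. \<integral>\<^sup>+z. g x z + ennreal c * indicator (ball 0 \<rho>) z * indicator (ball 0 \<rho>) x \<partial>lborel \<partial>lborel)"
      by (intro nn_integral_mono split)
    also have "\<dots> = (\<integral>\<^sup>+x. (\<integral>\<^sup>+z. g x z \<partial>lborel) + ennreal c * V * indicator (ball 0 \<rho>) x \<partial>lborel)"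
      by (intro nn_integral_cong, subst nn_integral_add, measurable, subst nn_integral_multc, measurable,
          subst nn_integral_cmult_indicator, simp, simp add: V_def)
    also have "\<dots> = (\<integral>\<^sup>+x. (\<integral>\<^sup>+z. g x z \<partial>lborel) \<partial>lborel) + ennreal c * V * V"
      by (subst nn_integral_add, measurable, subst nn_integral_cmult_indicator, simp, simp add: V_def)
    also have "(\<integral>\<^sup>+x. (\<integral>\<^sup>+z. g x z \<partial>lborel) \<partial>lborel) = (\<integral>\<^sup>+x. (\<integral>\<^sup>+h. g x (x + h) \<partial>lborel) \<partial>lborel)"
      by (intro nn_integral_cong nn_integral_lborel_translate[symmetric]) measurable
    also have "\<dots> = (\<integral>\<^sup>+h. (\<integral>\<^sup>+x. g x (x + h) \<partial>lborel) \<partial>lborel)"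
      by (rule lborel_pair.Fubini') measurable
    also have "\<dots> \<le> (\<integral>\<^sup>+h. ennreal C * (ennreal (norm h powr ((\<tau> - \<sigma>) - ?N)) * indicator (ball 0 h0) (h::'a)) \<partial>lborel)"
    proof (rule nn_integral_mono)
      fix h :: 'a
      show "(\<integral>\<^sup>+x. g x (x + h) \<partial>lborel) \<le> ennreal C * (ennreal (norm h powr ((\<tau> - \<sigma>) - ?N)) * indicator (ball 0 h0) h)"
      proof (cases "norm h < h0")
        case True
        have "(\<integral>\<^sup>+x. g x (x + h) \<partial>lborel) = (\<integral>\<^sup>+x. ennreal (norm h powr (- (?N + \<sigma>))) * (ennreal (\<bar>w (x + h) - w x\<bar> powr q) * indicator (ball 0 \<rho>) x) \<partial>lborel)"
          using True unfolding g_def e_def by (intro nn_integral_cong) (simp add: ennreal_mult mult_ac abs_minus_commute)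
        also have "\<dots> = ennreal (norm h powr (- (?N + \<sigma>))) * translation_energy q \<rho> h w"
          by (rule nn_integral_cmult) measurable
        also have "\<dots> \<le> ennreal (norm h powr (- (?N + \<sigma>))) * ennreal (C * norm h powr \<tau>)"
          using tr True by (intro mult_left_mono) auto
        also have "\<dots> = ennreal C * ennreal (norm h powr ((\<tau> - \<sigma>) - ?N))"
        proof -
          have "norm h powr (- (?N + \<sigma>)) * norm h powr \<tau> = norm h powr ((\<tau> - \<sigma>) - ?N)"
            by (simp add: powr_add[symmetric] algebra_simps)
          then show ?thesis using C by (simp add: ennreal_mult[symmetric] mult.left_commute)
        qed
        finally show ?thesis using True by simp
      qed (simp add: g_def)
    qed
    also have "\<dots> = ennreal C * I"
      unfolding I_def by (rule nn_integral_cmult) measurable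
    finally show "kernel_energy \<sigma> q (ball 0 \<rho>) w \<le> ennreal M" unfolding M by (simp add: add_right_mono)
  qed
qed

lemma kernel_energy_translate_le:
  fixes w :: "'a::euclidean_space \<Rightarrow> real"
  assumes [measurable]: "w \<in> borel_measurable borel" and R: "norm h + R \<le> R'"
  shows "kernel_energy \<sigma> q (ball 0 R) (\<lambda>x. w (x + h)) \<le> kernel_energy \<sigma> q (ball 0 R') w"
proof -
  define e where "e = (\<lambda>x z::'a. ennreal (\<bar>w x - w z\<bar> powr q * norm (x - z) powr (- (real DIM('a) + \<sigma>))))"
  have [measurable]: "(\<lambda>(x, z). e x z) \<in> borel_measurable (borel \<Otimes>\<^sub>M borel)"
    unfolding e_def by measurable
  have "kernel_energy \<sigma> q (ball 0 R) (\<lambda>x. w (x + h)) = (\<integral>\<^sup>+x\<in>ball 0 R. (\<integral>\<^sup>+y\<in>ball 0 R. e (x + h) (y + h) \<partial>lborel) \<partial>lborel)"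
    unfolding kernel_energy_def e_def by simp
  also have "\<dots> \<le> (\<integral>\<^sup>+x\<in>ball 0 R. (\<integral>\<^sup>+y\<in>ball 0 R'. e (x + h) y \<partial>lborel) \<partial>lborel)"
  proof (rule nn_integral_mono, rule mult_right_mono)
    fix x
    show "(\<integral>\<^sup>+y\<in>ball 0 R. e (x + h) (y + h) \<partial>lborel) \<le> (\<integral>\<^sup>+y\<in>ball 0 R'. e (x + h) y \<partial>lborel)"
      by (rule nn_integral_indicator_translate_le[OF _ R]) measurable
  qed simp
  also have "\<dots> \<le> (\<integral>\<^sup>+x\<in>ball 0 R'. (\<integral>\<^sup>+y\<in>ball 0 R'. e x y \<partial>lborel) \<partial>lborel)"
    by (rule nn_integral_indicator_translate_le[of "\<lambda>x. \<integral>\<^sup>+y\<in>ball 0 R'. e x y \<partial>lborel"]) (measurable, rule R)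
  also have "\<dots> = kernel_energy \<sigma> q (ball 0 R') w"
    unfolding kernel_energy_def e_def ..
  finally show ?thesis .
qed

lemma kernel_energy_UNIV_translate:
  fixes w :: "'a::euclidean_space \<Rightarrow> real"
  assumes [measurable]: "w \<in> borel_measurable borel"
  shows "kernel_energy \<sigma> q UNIV (\<lambda>x. w (h + x)) = kernel_energy \<sigma> q UNIV w"
proof -
  define e where "e = (\<lambda>x z::'a. ennreal (\<bar>w x - w z\<bar> powr q * norm (x - z) powr (- (real DIM('a) + \<sigma>))))"
  have [measurable]: "(\<lambda>(x, z). e x z) \<in> borel_measurable (borel \<Otimes>\<^sub>M borel)"
    unfolding e_def by measurable
  have "kernel_energy \<sigma> q UNIV (\<lambda>x. w (h + x)) = (\<integral>\<^sup>+x. (\<integral>\<^sup>+y. e (h + x) (h + y) \<partial>lborel) \<partial>lborel)"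
    unfolding kernel_energy_def e_def by simp
  also have "\<dots> = (\<integral>\<^sup>+x. (\<integral>\<^sup>+y. e (h + x) y \<partial>lborel) \<partial>lborel)"
    by (intro nn_integral_cong nn_integral_lborel_translate) measurable
  also have "\<dots> = (\<integral>\<^sup>+x. (\<integral>\<^sup>+y. e x y \<partial>lborel) \<partial>lborel)"
    by (rule nn_integral_lborel_translate) measurable
  finally show ?thesis unfolding kernel_energy_def e_def by simp
qed

lemma nn_integral_norm_diff_ball_le:
  fixes x :: "'a::euclidean_space"
  assumes "norm x < R"
  shows "(\<integral>\<^sup>+y\<in>ball 0 R. ennreal (norm (x - y) powr e) \<partial>lborel) \<le> (\<integral>\<^sup>+z\<in>ball (0::'a) (2 * R). ennreal (norm z powr e) \<partial>lborel)"
proof -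
  have "(\<integral>\<^sup>+y\<in>ball 0 R. ennreal (norm (x - y) powr e) \<partial>lborel)
      = (\<integral>\<^sup>+z. ennreal (norm (x - (x + z)) powr e) * indicator (ball 0 R) (x + z) \<partial>lborel)"
    by (rule nn_integral_lborel_translate[symmetric]) measurable
  also have "\<dots> \<le> (\<integral>\<^sup>+z\<in>ball (0::'a) (2 * R). ennreal (norm z powr e) \<partial>lborel)"
  proof (rule nn_integral_mono)
    fix z :: 'a
    have "norm z < 2 * R" if "norm (x + z) < R" using that assms norm_triangle_ineq4[of "x + z" x] by simp
    then show "ennreal (norm (x - (x + z)) powr e) * indicator (ball 0 R) (x + z) \<le> ennreal (norm z powr e) * indicator (ball 0 (2 * R)) z"
      by (auto simp: indicator_def)
  qed
  finally show ?thesis .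
qed

text \<open>
  For a function supported in a smaller ball, pairs with one point outside the larger ball are at
  least \<open>R-r\<close> apart, where the kernel is integrable.
\<close>

lemma kernel_energy_UNIV_finite:
  fixes g :: "'a::euclidean_space \<Rightarrow> real"
  assumes [measurable]: "g \<in> borel_measurable borel" and B: "\<And>x. \<bar>g x\<bar> \<le> B"
    and supp: "\<And>x. r \<le> norm x \<Longrightarrow> g x = 0" and r: "0 < r" "r < R"
    and fin: "kernel_energy \<sigma> q (ball 0 R) g < \<infinity>" and \<sigma>: "0 < \<sigma>" and q: "0 < q"
  shows "kernel_energy \<sigma> q UNIV g < \<infinity>"
proof -
  let ?N = "real DIM('a)"
  define \<delta> where "\<delta> = R - r"
  define e where "e = (\<lambda>x z::'a. ennreal (\<bar>g x - g z\<bar> powr q * norm (x - z) powr (- (?N + \<sigma>))))"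
  define f where "f = (\<lambda>x z::'a. ennreal (B powr q) * (ennreal (norm (z - x) powr (- (?N + \<sigma>))) * indicator (- ball 0 \<delta>) (z - x)) * indicator (ball 0 r) x)"
  define I where "I = (\<integral>\<^sup>+z\<in>- ball (0::'a) \<delta>. ennreal (norm z powr (- (?N + \<sigma>))) \<partial>lborel)"
  have B0: "0 \<le> B" using B[of 0] by linarith
  have ebm: "(\<lambda>(x, z). e x z) \<in> borel_measurable (borel \<Otimes>\<^sub>M borel)"
    unfolding e_def by measurable
  have [measurable]: "(\<lambda>x. indicator (- ball 0 \<delta>) (x :: 'a) :: ennreal) \<in> borel_measurable borel" 
    by (rule borel_measurable_indicator) auto
  have [measurable]: "(\<lambda>(x, z). f x z) \<in> borel_measurable (borel \<Otimes>\<^sub>M borel)"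
    unfolding f_def by measurable
  note [measurable] = ebm
  have I: "I < \<infinity>" unfolding I_def by (rule nn_integral_norm_powr_outside_ball) (use \<sigma> r in \<open>auto simp: \<delta>_def\<close>)
  have half: "e x z \<le> f x z" if "norm x < r" "R \<le> norm z" for x z
  proof -
    have "\<delta> \<le> norm (z - x)" using that norm_triangle_ineq2[of z x] by (simp add: \<delta>_def)
    moreover have "g z = 0" using supp that r by auto
    moreover have "\<bar>g x\<bar> powr q \<le> B powr q" using B q by (intro powr_mono2) auto
    ultimately show ?thesis using that unfolding e_def f_def
      by (simp add: ennreal_mult[symmetric] ennreal_leI mult_right_mono norm_minus_commute)
  qed
  have esym: "e x z = e z x" for x z by (simp add: e_def abs_minus_commute norm_minus_commute)
  have e0: "e x z = 0" if "r \<le> norm x" "r \<le> norm z" for x z using supp that q by (simp add: e_def)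
  have pt: "e x z \<le> e x z * indicator (ball 0 R) z * indicator (ball 0 R) x + (f x z + f z x)" for x z
  proof (cases "norm x < R \<and> norm z < R")
    case False
    then consider "r \<le> norm x" "r \<le> norm z" | "norm x < r" "R \<le> norm z" | "norm z < r" "R \<le> norm x" using r by linarith
    then show ?thesis
    proof cases
      case 1 then show ?thesis using e0 by simp
    next
      case 2 then show ?thesis using half[of x z] by (meson add_increasing add_increasing2 zero_le order_trans)
    next
      case 3 then show ?thesis using half[of z x] esym[of x z] by (metis add_increasing zero_le)
    qed
  qed (simp add: add_increasing2)
  have F: "(\<integral>\<^sup>+x. \<integral>\<^sup>+z. f x z \<partial>lborel \<partial>lborel) = ennreal (B powr q) * I * emeasure lborel (ball (0::'a) r)"
  proof -
    have "(\<integral>\<^sup>+z. f x z \<partial>lborel) = ennreal (B powr q) * I * indicator (ball 0 r) x" for x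
    proof -
      have "(\<integral>\<^sup>+z. f x z \<partial>lborel) = (\<integral>\<^sup>+z. f x (x + z) \<partial>lborel)"
        by (intro nn_integral_lborel_translate[symmetric]) measurable
      also have "\<dots> = (\<integral>\<^sup>+z. ennreal (B powr q) * (ennreal (norm z powr (- (?N + \<sigma>))) * indicator (- ball 0 \<delta>) (z::'a)) * indicator (ball 0 r) x \<partial>lborel)"
        by (simp add: f_def)
      also have "\<dots> = ennreal (B powr q) * I * indicator (ball 0 r) x"
        unfolding I_def by (subst nn_integral_multc, measurable, subst nn_integral_cmult, measurable)
      finally show ?thesis .
    qed
    then show ?thesis by (simp add: nn_integral_cmult_indicator)
  qed
  have "kernel_energy \<sigma> q UNIV g = (\<integral>\<^sup>+x. \<integral>\<^sup>+z. e x z \<partial>lborel \<partial>lborel)"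
    unfolding kernel_energy_def e_def by simp
  also have "\<dots> \<le> (\<integral>\<^sup>+x. \<integral>\<^sup>+z. e x z * indicator (ball 0 R) z * indicator (ball 0 R) x + (f x z + f z x) \<partial>lborel \<partial>lborel)"
    by (intro nn_integral_mono pt)
  also have "\<dots> = (\<integral>\<^sup>+x. (\<integral>\<^sup>+z. e x z * indicator (ball 0 R) z * indicator (ball 0 R) x \<partial>lborel) + ((\<integral>\<^sup>+z. f x z \<partial>lborel) + (\<integral>\<^sup>+z. f z x \<partial>lborel)) \<partial>lborel)"
    by (intro nn_integral_cong, subst nn_integral_add, measurable, subst nn_integral_add, measurable)
  also have "\<dots> = (\<integral>\<^sup>+x. (\<integral>\<^sup>+z. e x z * indicator (ball 0 R) z * indicator (ball 0 R) x \<partial>lborel) \<partial>lborel) + ((\<integral>\<^sup>+x. \<integral>\<^sup>+z. f x z \<partial>lborel \<partial>lborel) + (\<integral>\<^sup>+x. \<integral>\<^sup>+z. f z x \<partial>lborel \<partial>lborel))"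
    by (subst nn_integral_add, measurable, subst nn_integral_add, measurable)
  also have "(\<integral>\<^sup>+x. \<integral>\<^sup>+z. f z x \<partial>lborel \<partial>lborel) = (\<integral>\<^sup>+x. \<integral>\<^sup>+z. f x z \<partial>lborel \<partial>lborel)"
    by (rule lborel_pair.Fubini'[symmetric]) measurable
  also have "(\<integral>\<^sup>+x. (\<integral>\<^sup>+z. e x z * indicator (ball 0 R) z * indicator (ball 0 R) x \<partial>lborel) \<partial>lborel) = kernel_energy \<sigma> q (ball 0 R) g"
    unfolding kernel_energy_def e_def by (intro nn_integral_cong nn_integral_multc) measurable
  also have "kernel_energy \<sigma> q (ball 0 R) g + ((\<integral>\<^sup>+x. \<integral>\<^sup>+z. f x z \<partial>lborel \<partial>lborel) + (\<integral>\<^sup>+x. \<integral>\<^sup>+z. f x z \<partial>lborel \<partial>lborel)) < \<infinity>"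
    unfolding F using fin I r by (simp add: ennreal_mult_less_top emeasure_ball)
  finally show ?thesis .
qed

section \<open>Testing the translated equation\<close>

text \<open>
  Equal to \<open>1\<close> on the ball of radius \<open>a\<close>, to \<open>0\<close> outside that of radius \<open>b\<close>, and linear in the
  norm in between. Lipschitz continuity is all that the estimates need.
\<close>

definition cutoff :: "real \<Rightarrow> real \<Rightarrow> 'a::real_normed_vector \<Rightarrow> real" where
  "cutoff a b x = max 0 (min 1 ((b - norm x) / (b - a)))"

lemma cutoff_bounds: "0 \<le> cutoff a b x" "cutoff a b x \<le> 1"
  by (auto simp: cutoff_def)

lemma cutoff_eq_1: "a < b \<Longrightarrow> norm x \<le> a \<Longrightarrow> cutoff a b x = 1"
  by (simp add: cutoff_def field_simps)

lemma cutoff_eq_0: "a < b \<Longrightarrow> b \<le> norm x \<Longrightarrow> cutoff a b x = 0"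
  by (simp add: cutoff_def divide_nonpos_pos)

lemma cutoff_lipschitz:
  assumes "a < b"
  shows "\<bar>cutoff a b x - cutoff a b y\<bar> \<le> norm (x - y) / (b - a)"
proof -
  have "\<bar>cutoff a b x - cutoff a b y\<bar> \<le> \<bar>(b - norm x) / (b - a) - (b - norm y) / (b - a)\<bar>"
    unfolding cutoff_def by (auto simp: max_def min_def)
  also have "\<dots> = \<bar>norm x - norm y\<bar> / (b - a)"
    using assms by (simp add: diff_divide_distrib[symmetric] abs_minus_commute)
  also have "\<dots> \<le> norm (x - y) / (b - a)"
    using assms by (intro divide_right_mono norm_triangle_ineq3) auto
  finally show ?thesis .
qed

lemma borel_measurable_cutoff [measurable]:
  "cutoff a b \<in> borel_measurable (borel :: 'a::real_normed_vector measure)"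
  unfolding cutoff_def[abs_def] by measurable

lemma borel_measurable_signed_power [measurable]: "signed_power r \<in> borel_measurable borel"
  unfolding signed_power_def[abs_def] by measurable

text \<open>
  A solution at unit scale with all data bounded by \<open>1\<close>. It is Borel measurable and bounded at
  every point of the ball, so that no null sets have to be tracked, and the test functions are bounded
  and vanish near the boundary of the ball. The domain of the original equation does not appear.
\<close>

definition normalized_solution :: "real \<Rightarrow> real \<Rightarrow> ('a::euclidean_space \<Rightarrow> real) \<Rightarrow> bool" where
  "normalized_solution s p u \<longleftrightarrow>
     u \<in> borel_measurable borel \<and> (\<forall>x\<in>ball 0 1. \<bar>u x\<bar> \<le> 1) \<and>
     kernel_energy (s * p) p (ball 0 1) u \<le> 1 \<and>
     (\<integral>\<^sup>+y\<in>- ball 0 1. ennreal (\<bar>u y\<bar> powr (p - 1) * norm y powr (- (real DIM('a) + s * p))) \<partial>lborel) \<le> 1 \<and>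
     (\<forall>\<phi> B r. \<phi> \<in> borel_measurable borel \<and> (\<forall>x. \<bar>\<phi> x\<bar> \<le> B) \<and> 0 < r \<and> r < 1 \<and> (\<forall>x. r \<le> norm x \<longrightarrow> \<phi> x = 0) \<and>
        kernel_energy (s * p) p UNIV \<phi> < \<infinity> \<longrightarrow>
        has_bochner_integral (lborel \<Otimes>\<^sub>M lborel)
          (\<lambda>(x, y). signed_power (p - 2) (u x - u y) * (\<phi> x - \<phi> y) * norm (x - y) powr (- (real DIM('a) + s * p))) 0)"

text \<open>
  The radii \<open>\<rho> < \<rho>+d < \<rho>+2d < \<rho>+3d < \<rho>+4d < 1\<close> separate, in this order, the ball of the
  estimate, the support of \<open>\<eta>\<close>, the region where the second cutoff \<open>\<xi>\<close> is \<open>1\<close>, the support of \<open>\<xi>\<close>, and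
  the translate of that support by \<open>h\<close>. The bound \<open>|h| \<le> d\<^sup>2\<close>, rather than \<open>|h| \<le> d\<close>, keeps \<open>|x+h-y|\<close>
  comparable to \<open>|y|\<close> in the far field.
\<close>

locale translated_test =
  fixes s p q \<rho> d :: real and u :: "'a::euclidean_space \<Rightarrow> real" and h :: 'a
  assumes p: "2 < p" and s: "0 < s" "s < 1" and q: "p \<le> q"
    and \<rho>: "0 < \<rho>" and d: "0 < d" "\<rho> + 5 * d \<le> 1"
    and u: "normalized_solution s p u" and h: "norm h \<le> d\<^sup>2"
begin

abbreviation "K \<equiv> (\<lambda>z::'a. norm z powr (- (real DIM('a) + s * p)))"
abbreviation "\<eta> \<equiv> (cutoff \<rho> (\<rho> + d) :: 'a \<Rightarrow> real)"
abbreviation "\<xi> \<equiv> (cutoff (\<rho> + 2 * d) (\<rho> + 3 * d) :: 'a \<Rightarrow> real)"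
abbreviation "\<tau> \<equiv> (\<lambda>x. u (x + h) - u x)"
abbreviation "J \<equiv> signed_power (p - 2)"

definition test :: "'a \<Rightarrow> real" where
  "test x = (\<eta> x)\<^sup>2 * signed_power (q - p) (\<tau> x)"

lemma u_borel [measurable]: "u \<in> borel_measurable borel"
  using u by (simp add: normalized_solution_def)

lemma test_borel [measurable]: "test \<in> borel_measurable borel"
  unfolding test_def[abs_def] by measurable

lemma u_le_1: "norm x < 1 \<Longrightarrow> \<bar>u x\<bar> \<le> 1"
  using u by (simp add: normalized_solution_def)

lemma d_less_1: "d < 1" and h_le_d: "norm h \<le> d"
proof -
  show "d < 1" using d \<rho> by linarith
  then have "d\<^sup>2 \<le> d" using d by (simp add: power2_eq_square)
  then show "norm h \<le> d" using h by linarith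
qed

lemma norm_add_h: "norm x < \<rho> + 3 * d \<Longrightarrow> norm (x + h) < \<rho> + 4 * d"
  using norm_triangle_ineq[of x h] h_le_d by linarith

lemma abs_\<tau>_le_2: "norm x < \<rho> + 3 * d \<Longrightarrow> \<bar>\<tau> x\<bar> \<le> 2"
  using u_le_1[of x] u_le_1[of "x + h"] norm_add_h[of x] d by auto

lemma abs_test_le: "\<bar>test x\<bar> \<le> \<bar>\<tau> x\<bar> powr (q - p) * \<bar>\<tau> x\<bar>"
proof -
  have "(\<eta> x)\<^sup>2 \<le> 1" using cutoff_bounds[of \<rho> "\<rho> + d" x] by (simp add: power_le_one)
  then have "\<bar>(\<eta> x)\<^sup>2\<bar> * \<bar>signed_power (q - p) (\<tau> x)\<bar> \<le> 1 * \<bar>signed_power (q - p) (\<tau> x)\<bar>"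
    by (intro mult_right_mono) auto
  then show ?thesis unfolding test_def abs_mult by (simp add: abs_signed_power)
qed

lemma test_eq_0: "\<rho> + d \<le> norm x \<Longrightarrow> test x = 0"
  using d by (simp add: test_def cutoff_eq_0)

lemma test_bounded: "\<bar>test x\<bar> \<le> 2 powr (q - p) * 2"
proof (cases "\<rho> + d \<le> norm x")
  case False
  then have "\<bar>\<tau> x\<bar> \<le> 2" using abs_\<tau>_le_2 d by simp
  then have "\<bar>\<tau> x\<bar> powr (q - p) * \<bar>\<tau> x\<bar> \<le> 2 powr (q - p) * 2"
    using q by (intro mult_mono powr_mono2) auto
  then show ?thesis using abs_test_le[of x] by linarith
qed (simp add: test_eq_0)

lemma test_diff_le:
  assumes x: "norm x < \<rho> + 3 * d" and y: "norm y < \<rho> + 3 * d"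
  defines "L \<equiv> max (2 powr (q - p) * 2 * (2 / d)) ((q - p + 2) * 4 powr (q - p))"
  shows "\<bar>test x - test y\<bar> \<le> L * (norm (x - y) + (\<bar>u (x + h) - u (y + h)\<bar> + \<bar>u x - u y\<bar>))"
proof -
  let ?\<psi> = "signed_power (q - p)"
  have "test x - test y = ((\<eta> x)\<^sup>2 - (\<eta> y)\<^sup>2) * ?\<psi> (\<tau> x) + (\<eta> y)\<^sup>2 * (?\<psi> (\<tau> x) - ?\<psi> (\<tau> y))"
    by (simp add: test_def algebra_simps)
  then have "\<bar>test x - test y\<bar> \<le> \<bar>(\<eta> x)\<^sup>2 - (\<eta> y)\<^sup>2\<bar> * \<bar>?\<psi> (\<tau> x)\<bar> + (\<eta> y)\<^sup>2 * \<bar>?\<psi> (\<tau> x) - ?\<psi> (\<tau> y)\<bar>"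
    by (simp only:) (intro order_trans[OF abs_triangle_ineq], simp add: abs_mult)
  also have "\<dots> \<le> (2 / d * norm (x - y)) * (2 powr (q - p) * 2) + 1 * ((q - p + 2) * (4 powr (q - p) * (\<bar>u (x + h) - u (y + h)\<bar> + \<bar>u x - u y\<bar>)))"
  proof (intro add_mono mult_mono)
    have "(\<eta> x)\<^sup>2 - (\<eta> y)\<^sup>2 = (\<eta> x - \<eta> y) * (\<eta> x + \<eta> y)" by (simp add: power2_eq_square algebra_simps)
    then have "\<bar>(\<eta> x)\<^sup>2 - (\<eta> y)\<^sup>2\<bar> = \<bar>\<eta> x - \<eta> y\<bar> * \<bar>\<eta> x + \<eta> y\<bar>" by (simp add: abs_mult)
    also have "\<dots> \<le> (norm (x - y) / d) * 2"
      using cutoff_lipschitz[of \<rho> "\<rho> + d" x y] d cutoff_bounds[of \<rho> "\<rho> + d" x] cutoff_bounds[of \<rho> "\<rho> + d" y]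
      by (intro mult_mono) auto
    finally show "\<bar>(\<eta> x)\<^sup>2 - (\<eta> y)\<^sup>2\<bar> \<le> 2 / d * norm (x - y)" by (simp add: mult.commute)
    show "\<bar>?\<psi> (\<tau> x)\<bar> \<le> 2 powr (q - p) * 2"
      unfolding abs_signed_power using abs_\<tau>_le_2[OF x] q by (intro mult_mono powr_mono2) auto
    show "(\<eta> y)\<^sup>2 \<le> 1" using cutoff_bounds[of \<rho> "\<rho> + d" y] by (simp add: power_le_one)
    have "\<bar>?\<psi> (\<tau> x) - ?\<psi> (\<tau> y)\<bar> \<le> (q - p + 2) * ((\<bar>\<tau> x\<bar> + \<bar>\<tau> y\<bar>) powr (q - p) * \<bar>\<tau> x - \<tau> y\<bar>)"
      using q by (intro signed_power_diff_le) auto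
    also have "\<dots> \<le> (q - p + 2) * (4 powr (q - p) * (\<bar>u (x + h) - u (y + h)\<bar> + \<bar>u x - u y\<bar>))"
      using q abs_\<tau>_le_2[OF x] abs_\<tau>_le_2[OF y] by (intro mult_left_mono mult_mono powr_mono2) auto
    finally show "\<bar>?\<psi> (\<tau> x) - ?\<psi> (\<tau> y)\<bar> \<le> (q - p + 2) * (4 powr (q - p) * (\<bar>u (x + h) - u (y + h)\<bar> + \<bar>u x - u y\<bar>))" .
  qed (use d in auto)
  also have "\<dots> = (2 powr (q - p) * 2 * (2 / d)) * norm (x - y) + ((q - p + 2) * 4 powr (q - p)) * (\<bar>u (x + h) - u (y + h)\<bar> + \<bar>u x - u y\<bar>)"
    by (simp add: algebra_simps)
  also have "\<dots> \<le> L * norm (x - y) + L * (\<bar>u (x + h) - u (y + h)\<bar> + \<bar>u x - u y\<bar>)"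
    unfolding L_def by (intro add_mono mult_right_mono) auto
  finally show ?thesis by (simp add: distrib_left)
qed

lemma kernel_energy_u: "kernel_energy (s * p) p (ball 0 1) u \<le> 1"
  using u by (simp add: normalized_solution_def)

text \<open>
  The test function is a Lipschitz function of \<open>u\<close> and of the translate of \<open>u\<close>, times a Lipschitz cutoff.
  Hence it inherits finite energy from \<open>u\<close>. The power \<open>|t|\<^bsup>q-p\<^esup>t\<close> is Lipschitz here because \<open>\<tau>\<^sub>h u\<close> is
  bounded.
\<close>

lemma kernel_energy_test: "kernel_energy (s * p) p UNIV test < \<infinity>"
proof (rule kernel_energy_UNIV_finite[where R = "\<rho> + 3 * d" and r = "\<rho> + d" and B = "2 powr (q - p) * 2"])
  let ?N = "real DIM('a)" let ?R = "\<rho> + 3 * d"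
  define L where "L = max (2 powr (q - p) * 2 * (2 / d)) ((q - p + 2) * 4 powr (q - p))"
  define c where "c = L powr p * (2 powr p * 2 powr p)"
  define e where "e = (\<lambda>(w :: 'a \<Rightarrow> real) x y. ennreal (\<bar>w x - w y\<bar> powr p * K (x - y)))"
  define k where "k = (\<lambda>x y::'a. ennreal (norm (x - y) powr ((p - s * p) - ?N)))"
  have L: "0 \<le> L" using d by (simp add: L_def le_max_iff_disj)
  have c: "0 \<le> c" by (simp add: c_def)
  have em: "(\<lambda>(x, y). e w x y) \<in> borel_measurable (borel \<Otimes>\<^sub>M borel)" if [measurable]: "w \<in> borel_measurable borel" for w
    unfolding e_def by measurable
  have [measurable]: "(\<lambda>(x, y). k x y) \<in> borel_measurable (borel \<Otimes>\<^sub>M borel)"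
    unfolding k_def by measurable
  note em[OF u_borel, measurable]
  have [measurable]: "(\<lambda>x. u (x + h)) \<in> borel_measurable borel" by measurable
  note em[OF this, measurable]
  have pt: "e test x y \<le> ennreal c * (k x y + (e (\<lambda>x. u (x + h)) x y + e u x y))"
    if x: "x \<in> ball 0 ?R" and y: "y \<in> ball 0 ?R" for x y
  proof -
    let ?n = "norm (x - y)" let ?a = "\<bar>u (x + h) - u (y + h)\<bar>" let ?b = "\<bar>u x - u y\<bar>"
    have "(?n + (?a + ?b)) powr p \<le> 2 powr p * (?n powr p + (?a + ?b) powr p)"
      using p by (intro add_powr_le) auto
    also have "\<dots> \<le> 2 powr p * (2 powr p * ?n powr p + 2 powr p * (?a powr p + ?b powr p))"
    proof (intro mult_left_mono add_mono)
      show "?n powr p \<le> 2 powr p * ?n powr p" using p by (simp add: ge_one_powr_ge_zero mult_le_cancel_right1)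
      show "(?a + ?b) powr p \<le> 2 powr p * (?a powr p + ?b powr p)" using p by (intro add_powr_le) auto
    qed auto
    finally have sum: "(?n + (?a + ?b)) powr p \<le> 2 powr p * 2 powr p * (?n powr p + (?a powr p + ?b powr p))"
      by (simp add: distrib_left mult.assoc)
    have "\<bar>test x - test y\<bar> powr p \<le> (L * (?n + (?a + ?b))) powr p"
      using test_diff_le[of x y] x y p unfolding L_def by (intro powr_mono2) auto
    also have "\<dots> = L powr p * (?n + (?a + ?b)) powr p"
      using L by (intro powr_mult)
    also have "\<dots> \<le> L powr p * (2 powr p * 2 powr p * (?n powr p + (?a powr p + ?b powr p)))"
      by (rule mult_left_mono[OF sum]) simp
    finally have "\<bar>test x - test y\<bar> powr p \<le> c * (?n powr p + (?a powr p + ?b powr p))"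
      by (simp only: c_def mult.assoc)
    then have "\<bar>test x - test y\<bar> powr p * K (x - y) \<le> c * (?n powr p + (?a powr p + ?b powr p)) * K (x - y)"
      by (rule mult_right_mono) auto
    also have "\<dots> = c * (?n powr p * K (x - y) + (?a powr p * K (x - y) + ?b powr p * K (x - y)))"
      by (simp add: algebra_simps)
    also have "?n powr p * K (x - y) = norm (x - y) powr ((p - s * p) - ?N)"
      by (simp add: powr_add[symmetric] algebra_simps)
    finally show ?thesis using c unfolding e_def k_def
      by (simp add: ennreal_mult[symmetric] ennreal_plus[symmetric] ennreal_leI del: ennreal_plus)
  qed
  have KE: "kernel_energy (s * p) p (ball 0 ?R) w = (\<integral>\<^sup>+x\<in>ball 0 ?R. (\<integral>\<^sup>+y\<in>ball 0 ?R. e w x y \<partial>lborel) \<partial>lborel)" for w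
    unfolding kernel_energy_def e_def ..
  define Q where "Q = (\<integral>\<^sup>+z\<in>ball (0::'a) (2 * ?R). ennreal (norm z powr ((p - s * p) - ?N)) \<partial>lborel)"
  have Q: "Q < \<infinity>" unfolding Q_def by (rule nn_integral_norm_powr_ball) (use p s \<rho> d in auto)
  have "kernel_energy (s * p) p (ball 0 ?R) test = (\<integral>\<^sup>+x. \<integral>\<^sup>+y. e test x y * indicator (ball 0 ?R) y * indicator (ball 0 ?R) x \<partial>lborel \<partial>lborel)"
    unfolding kernel_energy_def e_def by (intro nn_integral_cong nn_integral_multc[symmetric]) measurable
  also have "\<dots> \<le> (\<integral>\<^sup>+x. \<integral>\<^sup>+y. ennreal c * ((k x y * indicator (ball 0 ?R) y + (e (\<lambda>x. u (x + h)) x y * indicator (ball 0 ?R) y + e u x y * indicator (ball 0 ?R) y)) * indicator (ball 0 ?R) x) \<partial>lborel \<partial>lborel)"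
    using pt by (intro nn_integral_mono) (auto simp: indicator_def)
  also have "\<dots> = (\<integral>\<^sup>+x. ennreal c * (((\<integral>\<^sup>+y. k x y * indicator (ball 0 ?R) y \<partial>lborel) + ((\<integral>\<^sup>+y. e (\<lambda>x. u (x + h)) x y * indicator (ball 0 ?R) y \<partial>lborel) + (\<integral>\<^sup>+y. e u x y * indicator (ball 0 ?R) y \<partial>lborel))) * indicator (ball 0 ?R) x) \<partial>lborel)"
    by (intro nn_integral_cong) (simp add: nn_integral_cmult nn_integral_multc nn_integral_add)
  also have "\<dots> \<le> (\<integral>\<^sup>+x. ennreal c * ((Q + ((\<integral>\<^sup>+y. e (\<lambda>x. u (x + h)) x y * indicator (ball 0 ?R) y \<partial>lborel) + (\<integral>\<^sup>+y. e u x y * indicator (ball 0 ?R) y \<partial>lborel))) * indicator (ball 0 ?R) x) \<partial>lborel)"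
  proof (rule nn_integral_mono)
    fix x :: 'a
    show "ennreal c * (((\<integral>\<^sup>+y. k x y * indicator (ball 0 ?R) y \<partial>lborel) + ((\<integral>\<^sup>+y. e (\<lambda>x. u (x + h)) x y * indicator (ball 0 ?R) y \<partial>lborel) + (\<integral>\<^sup>+y. e u x y * indicator (ball 0 ?R) y \<partial>lborel))) * indicator (ball 0 ?R) x)
      \<le> ennreal c * ((Q + ((\<integral>\<^sup>+y. e (\<lambda>x. u (x + h)) x y * indicator (ball 0 ?R) y \<partial>lborel) + (\<integral>\<^sup>+y. e u x y * indicator (ball 0 ?R) y \<partial>lborel))) * indicator (ball 0 ?R) x)"
      using nn_integral_norm_diff_ball_le[of x ?R "(p - s * p) - ?N"] unfolding k_def Q_def
      by (cases "x \<in> ball 0 ?R") (auto intro!: mult_left_mono add_right_mono)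
  qed
  also have "\<dots> = ennreal c * (Q * emeasure lborel (ball (0::'a) ?R) + (kernel_energy (s * p) p (ball 0 ?R) (\<lambda>x. u (x + h)) + kernel_energy (s * p) p (ball 0 ?R) u))"
    unfolding KE by (simp add: nn_integral_cmult distrib_right nn_integral_add nn_integral_cmult_indicator)
  also have "\<dots> \<le> ennreal c * (Q * emeasure lborel (ball (0::'a) ?R) + (1 + 1))"
  proof (intro mult_left_mono add_mono order_refl)
    have "kernel_energy (s * p) p (ball 0 ?R) (\<lambda>x. u (x + h)) \<le> kernel_energy (s * p) p (ball 0 1) u"
      using h_le_d d by (intro kernel_energy_translate_le) auto
    then show "kernel_energy (s * p) p (ball 0 ?R) (\<lambda>x. u (x + h)) \<le> 1" using kernel_energy_u by (rule order_trans)
    show "kernel_energy (s * p) p (ball 0 ?R) u \<le> 1"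
      by (rule order_trans[OF kernel_energy_mono_set kernel_energy_u]) (use d \<rho> in auto)
  qed auto
  also have "\<dots> < \<infinity>" using Q \<rho> d by (simp add: ennreal_mult_less_top emeasure_ball)
  finally show "kernel_energy (s * p) p (ball 0 ?R) test < \<infinity>" .
qed (use d p s \<rho> test_bounded test_eq_0 in auto)

definition "diff_integrand = (\<lambda>(x, y). (J (u (x + h) - u (y + h)) - J (u x - u y)) * (test x - test y) * K (x - y))"

lemma tested_equation:
  assumes "\<phi> \<in> borel_measurable borel" "\<And>x. \<bar>\<phi> x\<bar> \<le> B" "0 < r" "r < 1" "\<And>x. r \<le> norm x \<Longrightarrow> \<phi> x = 0"
    "kernel_energy (s * p) p UNIV \<phi> < \<infinity>"
  shows "has_bochner_integral (lborel \<Otimes>\<^sub>M lborel)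
          (\<lambda>(x, y). J (u x - u y) * (\<phi> x - \<phi> y) * K (x - y)) 0"
  using u assms unfolding normalized_solution_def by blast

text \<open>
  Both the test function and its translate by \<open>-h\<close> are admissible. Moving the translation in the second
  equation onto \<open>u\<close> and subtracting gives the equation for \<open>\<tau>\<^sub>h u\<close>.
\<close>

lemma difference_equation: "has_bochner_integral (lborel \<Otimes>\<^sub>M lborel) diff_integrand 0"
proof -
  define F where "F = (\<lambda>z::'a \<times> 'a. J (u (fst z) - u (snd z)) * (test (fst z - h) - test (snd z - h)) * K (fst z - snd z))"
  have 1: "has_bochner_integral (lborel \<Otimes>\<^sub>M lborel) (\<lambda>(x, y). J (u x - u y) * (test x - test y) * K (x - y)) 0"
    by (rule tested_equation[where B = "2 powr (q - p) * 2" and r = "\<rho> + d"])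
      (use d \<rho> test_bounded test_eq_0 kernel_energy_test in auto)
  have "has_bochner_integral (lborel \<Otimes>\<^sub>M lborel) (\<lambda>(x, y). J (u x - u y) * (test (x - h) - test (y - h)) * K (x - y)) 0"
  proof (rule tested_equation[where \<phi> = "\<lambda>x. test (x - h)" and B = "2 powr (q - p) * 2" and r = "\<rho> + 2 * d"])
    show "kernel_energy (s * p) p UNIV (\<lambda>x. test (x - h)) < \<infinity>"
      using kernel_energy_UNIV_translate[OF test_borel, of "s * p" p "- h"] kernel_energy_test by simp
    show "test (x - h) = 0" if "\<rho> + 2 * d \<le> norm x" for x
      using that h_le_d norm_triangle_ineq2[of x h] by (intro test_eq_0) linarith
  qed (use d \<rho> test_bounded in auto)
  then have F: "has_bochner_integral lborel F 0"
    unfolding lborel_prod F_def by (simp add: case_prod_beta')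
  have [measurable]: "F \<in> borel_measurable borel"
    using borel_measurable_has_bochner_integral[OF F] by simp
  have "has_bochner_integral (distr lborel borel ((+) (h, h))) F 0"
    unfolding lborel_distr_plus by (rule F)
  then have "has_bochner_integral lborel (\<lambda>z. F ((h, h) + z)) 0"
    by (simp add: has_bochner_integral_iff integrable_distr_eq integral_distr)
  then have 2: "has_bochner_integral (lborel \<Otimes>\<^sub>M lborel) (\<lambda>(x, y). J (u (x + h) - u (y + h)) * (test x - test y) * K (x - y)) 0"
    unfolding lborel_prod F_def by (simp add: case_prod_beta' add.commute)
  show ?thesis
    using has_bochner_integral_diff[OF 2 1] unfolding diff_integrand_def
    by (simp add: case_prod_beta' algebra_simps)
qed

end

section \<open>The far field\<close>

text \<open>
  Constants of the far-field estimates, kept explicit because they must not depend on \<open>u\<close> or \<open>h\<close>.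
\<close>

abbreviation comparison_const :: "real \<Rightarrow> real \<Rightarrow> real" where
  "comparison_const d \<beta> \<equiv> (d / 2) powr (- \<beta>)"

abbreviation shift_const :: "real \<Rightarrow> real \<Rightarrow> real" where
  "shift_const d \<beta> \<equiv> comparison_const d \<beta> * (1 / d + \<beta> / d\<^sup>2)"

abbreviation far_const :: "real \<Rightarrow> real \<Rightarrow> real \<Rightarrow> real \<Rightarrow> real" where
  "far_const d \<beta> p I \<equiv> (shift_const d \<beta> + comparison_const d \<beta> * p * 2 powr (p - 2)) * (2 powr p * (I + 1))"

context translated_test begin

lemma norm_diff_far:
  assumes x: "norm x < \<rho> + d" and y: "\<rho> + 2 * d \<le> norm y"
  shows "d * norm y \<le> norm (x - y)"
proof -
  have "(\<rho> + 2 * d) * (1 - d) \<le> norm y * (1 - d)"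
    using y d_less_1 by (intro mult_right_mono) auto
  moreover have "\<rho> + d \<le> (\<rho> + 2 * d) * (1 - d)"
  proof -
    have "d * (\<rho> + 2 * d) \<le> d * 1" using d by (intro mult_left_mono) auto
    then show ?thesis by (simp add: algebra_simps)
  qed
  ultimately have "\<rho> + d \<le> norm y - d * norm y" by (simp add: algebra_simps)
  then show ?thesis using x norm_triangle_ineq2[of y x] by (simp add: norm_minus_commute)
qed

lemma norm_diff_far_shift:
  assumes x: "norm x < \<rho> + d" and y: "\<rho> + 2 * d \<le> norm y \<or> \<rho> + 2 * d \<le> norm (y - h)"
  shows "d / 2 * norm y \<le> norm (x + h - y)"
  using y
proof
  assume y: "\<rho> + 2 * d \<le> norm y"
  have "d * norm y \<le> norm (x + h - y) + norm h"
    using norm_diff_far[OF x y] norm_triangle_ineq4[of "x + h - y" h] by (simp add: algebra_simps)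
  moreover have "norm h \<le> d / 2 * norm y"
  proof -
    have "d / 2 * (2 * d) \<le> d / 2 * norm y" using y \<rho> d by (intro mult_left_mono) auto
    then show ?thesis using h by (simp add: power2_eq_square)
  qed
  ultimately show ?thesis by (simp add: algebra_simps)
next
  assume y: "\<rho> + 2 * d \<le> norm (y - h)"
  have "norm y \<le> norm (y - h) + norm h" using norm_triangle_ineq[of "y - h" h] by simp
  then have "norm y \<le> 2 * norm (y - h)" using y h_le_d \<rho> d by linarith
  then have "d / 2 * norm y \<le> d / 2 * (2 * norm (y - h))" using d by (intro mult_left_mono) auto
  also have "\<dots> \<le> norm (x - (y - h))" using norm_diff_far[OF x y] by simp
  finally show ?thesis by (simp add: algebra_simps)
qed

text \<open>
  Here \<open>D1\<close> is the kernel centred at the origin and cut off there, \<open>U\<close> dominates \<open>|J(u(x) - u(y))|\<close> when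
  \<open>|u(x)| \<le> 1\<close>, and \<open>k0\<close> and \<open>k1\<close> are the far-field kernel before and after the shift by \<open>h\<close>.
\<close>

abbreviation "D1 \<equiv> (\<lambda>y::'a. indicator (- ball 0 (\<rho> + d)) y * norm y powr (- (real DIM('a) + s * p)) :: real)"
abbreviation "U \<equiv> (\<lambda>y. (1 + \<bar>u y\<bar>) powr (p - 1))"
abbreviation "k0 \<equiv> (\<lambda>x y. (1 - \<xi> y) * K (x - y))"
abbreviation "k1 \<equiv> (\<lambda>x y. (1 - \<xi> (y - h)) * K (x + h - y))"

lemma exponent_pos: "0 < (real DIM('a) + s * p)" using s p by (simp add: add_nonneg_pos)

lemma \<xi>_eq_1: "norm y < \<rho> + 2 * d \<Longrightarrow> \<xi> y = 1"
  using d by (intro cutoff_eq_1) auto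

lemma K_le:
  assumes "d / 2 * norm y \<le> norm z" "\<rho> + d \<le> norm y"
  shows "K z \<le> comparison_const d (real DIM('a) + s * p) * D1 y"
proof -
  have y: "0 < norm y" using assms \<rho> d by linarith
  have "K z \<le> (d / 2 * norm y) powr (- (real DIM('a) + s * p))"
    using assms y d exponent_pos by (intro powr_mono2') auto
  also have "\<dots> = comparison_const d (real DIM('a) + s * p) * norm y powr (- (real DIM('a) + s * p))"
    by (rule powr_mult)
  also have "\<dots> = comparison_const d (real DIM('a) + s * p) * D1 y" using assms by simp
  finally show ?thesis .
qed

lemma norm_y_ge: "\<rho> + 2 * d \<le> norm (y - h) \<Longrightarrow> \<rho> + d \<le> norm y"
  using norm_triangle_ineq4[of y h] h_le_d by linarith

lemma k0_le: assumes x: "norm x < \<rho> + d" shows "0 \<le> k0 x y" "k0 x y \<le> comparison_const d (real DIM('a) + s * p) * D1 y"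
proof -
  let ?b = "real DIM('a) + s * p"
  let ?C0 = "comparison_const d ?b"
  have b: "0 \<le> 1 - \<xi> y" "1 - \<xi> y \<le> 1" using cutoff_bounds[of "\<rho> + 2 * d" "\<rho> + 3 * d" y] by auto
  then show "0 \<le> k0 x y" by simp
  show "k0 x y \<le> ?C0 * D1 y"
  proof (cases "norm y < \<rho> + 2 * d")
    case False
    have "d * norm y \<le> norm (x - y)" using norm_diff_far[OF x] False by simp
    moreover have "0 \<le> d * norm y" using d by simp
    ultimately have "K (x - y) \<le> ?C0 * D1 y" using False d by (intro K_le) (linarith, simp)
    moreover have "(1 - \<xi> y) * K (x - y) \<le> 1 * K (x - y)" using b by (intro mult_right_mono) auto
    ultimately show ?thesis by simp
  qed (simp add: \<xi>_eq_1)
qed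

lemma k1_le: assumes x: "norm x < \<rho> + d" shows "0 \<le> k1 x y" "k1 x y \<le> comparison_const d (real DIM('a) + s * p) * D1 y"
proof -
  let ?b = "real DIM('a) + s * p"
  let ?C0 = "comparison_const d ?b"
  have b: "0 \<le> 1 - \<xi> (y - h)" "1 - \<xi> (y - h) \<le> 1" using cutoff_bounds[of "\<rho> + 2 * d" "\<rho> + 3 * d" "y - h"] by auto
  then show "0 \<le> k1 x y" by simp
  show "k1 x y \<le> ?C0 * D1 y"
  proof (cases "norm (y - h) < \<rho> + 2 * d")
    case False
    then have "K (x + h - y) \<le> ?C0 * D1 y" using norm_y_ge[of y] norm_diff_far_shift[OF x, of y] by (intro K_le) auto
    moreover have "(1 - \<xi> (y - h)) * K (x + h - y) \<le> 1 * K (x + h - y)" using b by (intro mult_right_mono) auto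
    ultimately show ?thesis by simp
  qed (simp add: \<xi>_eq_1)
qed

text \<open>
  The shifted kernel, cutoff included, is Lipschitz in \<open>h\<close> and loses nothing at infinity. This is
  why the cutoff \<open>\<xi>\<close> is continuous: for an indicator function the difference would live on a thin annulus
  instead.
\<close>

lemma k_diff_le:
  assumes x: "norm x < \<rho> + d"
  shows "\<bar>k1 x y - k0 x y\<bar> \<le> shift_const d (real DIM('a) + s * p) * norm h * D1 y"
proof (cases "\<rho> + 2 * d \<le> norm y \<or> \<rho> + 2 * d \<le> norm (y - h)")
  case False
  then show ?thesis using d exponent_pos by (simp add: \<xi>_eq_1)
next
  case True
  let ?b = "real DIM('a) + s * p"
  let ?C0 = "comparison_const d ?b" and ?C2 = "shift_const d ?b"
  from True have far: "d / 2 * norm y \<le> norm (x + h - y)" by (rule norm_diff_far_shift[OF x])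
  have yd: "\<rho> + d \<le> norm y" using True norm_y_ge[of y] d by auto
  have "k1 x y - k0 x y = (\<xi> y - \<xi> (y - h)) * K (x + h - y) + (1 - \<xi> y) * (K (x + h - y) - K (x - y))"
    by (simp add: algebra_simps)
  also have "\<bar>\<dots>\<bar> \<le> \<bar>\<xi> y - \<xi> (y - h)\<bar> * K (x + h - y) + (1 - \<xi> y) * \<bar>K (x + h - y) - K (x - y)\<bar>"
    using cutoff_bounds[of "\<rho> + 2 * d" "\<rho> + 3 * d" y]
    by (intro order_trans[OF abs_triangle_ineq]) (simp add: abs_mult)
  also have "\<dots> \<le> norm h / d * (?C0 * D1 y) + ?C0 * ?b / d\<^sup>2 * norm h * D1 y"
  proof (rule add_mono, rule mult_mono)
    show "\<bar>\<xi> y - \<xi> (y - h)\<bar> \<le> norm h / d"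
      using cutoff_lipschitz[of "\<rho> + 2 * d" "\<rho> + 3 * d" y "y - h"] d by simp
    show "K (x + h - y) \<le> ?C0 * D1 y" using far yd by (rule K_le)
    show "(1 - \<xi> y) * \<bar>K (x + h - y) - K (x - y)\<bar> \<le> ?C0 * ?b / d\<^sup>2 * norm h * D1 y"
    proof (cases "norm y < \<rho> + 2 * d")
      case True
      then show ?thesis using exponent_pos d by (simp add: \<xi>_eq_1)
    next
      case False
      define m where "m = d / 2 * norm y"
      have y2: "2 * d \<le> norm y" using False \<rho> by linarith
      have y0: "0 < norm y" using y2 d by linarith
      have m0: "0 < m" using y0 d by (simp add: m_def)
      have "d * norm y \<le> norm (x - y)" using norm_diff_far[OF x] False by simp
      then have "m \<le> norm (x - y)" using m0 by (simp add: m_def)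
      moreover have "m \<le> norm (x + h - y)" using far by (simp add: m_def)
      ultimately have "\<bar>K (x + h - y) - K (x - y)\<bar> \<le> ?b * m powr (- ?b - 1) * \<bar>norm (x + h - y) - norm (x - y)\<bar>"
        using m0 exponent_pos by (intro powr_neg_diff_le) auto
      also have "\<dots> \<le> ?b * (?C0 * D1 y / d\<^sup>2) * norm h"
      proof (rule mult_mono, rule mult_left_mono)
        have "m powr (- ?b - 1) = m powr (- ?b) / m"
          using m0 by (simp add: powr_diff)
        also have "\<dots> = (?C0 * norm y powr (- ?b)) / m"
          unfolding m_def by (simp only: powr_mult)
        also have "\<dots> \<le> (?C0 * norm y powr (- ?b)) / d\<^sup>2"
        proof (rule divide_left_mono)
          have "d / 2 * (2 * d) \<le> m" unfolding m_def using y2 d by (intro mult_left_mono) auto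
          then show "d\<^sup>2 \<le> m" by (simp add: power2_eq_square)
        qed (use d m0 in auto)
        also have "norm y powr (- ?b) = D1 y" using yd by (simp add: indicator_def)
        finally show "m powr (- ?b - 1) \<le> ?C0 * D1 y / d\<^sup>2" .
        show "\<bar>norm (x + h - y) - norm (x - y)\<bar> \<le> norm h"
          using norm_triangle_ineq3[of "x + h - y" "x - y"] by simp
      qed (use exponent_pos in auto)
      finally have *: "\<bar>K (x + h - y) - K (x - y)\<bar> \<le> ?C0 * ?b / d\<^sup>2 * norm h * D1 y"
        by (simp add: mult_ac)
      have "(1 - \<xi> y) * \<bar>K (x + h - y) - K (x - y)\<bar> \<le> 1 * \<bar>K (x + h - y) - K (x - y)\<bar>"
        using cutoff_bounds[of "\<rho> + 2 * d" "\<rho> + 3 * d" y] by (intro mult_right_mono) auto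
      then show ?thesis using * by simp
    qed
  qed (use d in auto)
  also have "\<dots> = ?C2 * norm h * D1 y" by (simp add: algebra_simps)
  finally show ?thesis .
qed

lemma abs_J_le_U:
  assumes "norm x < 1"
  shows "\<bar>J (u x - u y)\<bar> \<le> U y"
proof -
  have "\<bar>J (u x - u y)\<bar> = \<bar>u x - u y\<bar> powr (p - 2) * \<bar>u x - u y\<bar>" by (rule abs_signed_power)
  also have "\<dots> \<le> (1 + \<bar>u y\<bar>) powr (p - 2) * (1 + \<bar>u y\<bar>)"
    using u_le_1[OF assms] p by (intro mult_mono powr_mono2) auto
  also have "\<dots> = U y" by (simp add: powr_add[symmetric] powr_mult_base mult.commute)
  finally show ?thesis .
qed

lemma abs_J_diff_le_U:
  assumes x: "norm x < \<rho> + d"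
  shows "\<bar>J (u (x + h) - u y) - J (u x - u y)\<bar> \<le> p * 2 powr (p - 2) * \<bar>\<tau> x\<bar> * U y"
proof -
  have b: "\<bar>u x\<bar> \<le> 1" "\<bar>u (x + h)\<bar> \<le> 1"
    using u_le_1[of x] u_le_1[of "x + h"] norm_add_h[of x] x d by auto
  have "\<bar>J (u (x + h) - u y) - J (u x - u y)\<bar>
     \<le> (p - 2 + 2) * ((\<bar>u (x + h) - u y\<bar> + \<bar>u x - u y\<bar>) powr (p - 2) * \<bar>(u (x + h) - u y) - (u x - u y)\<bar>)"
    using p by (intro signed_power_diff_le) auto
  also have "\<dots> \<le> p * ((2 * (1 + \<bar>u y\<bar>)) powr (p - 2) * \<bar>\<tau> x\<bar>)"
    using b p by (intro mult_mono powr_mono2) auto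
  also have "(2 * (1 + \<bar>u y\<bar>)) powr (p - 2) = 2 powr (p - 2) * (1 + \<bar>u y\<bar>) powr (p - 2)" by (rule powr_mult)
  also have "p * (2 powr (p - 2) * (1 + \<bar>u y\<bar>) powr (p - 2) * \<bar>\<tau> x\<bar>) \<le> p * (2 powr (p - 2) * U y * \<bar>\<tau> x\<bar>)"
    using p by (intro mult_left_mono mult_right_mono powr_mono) auto
  finally show ?thesis by (simp add: mult_ac)
qed

text \<open>
  Outside the unit ball this is the tail, inside it \<open>u\<close> is bounded by \<open>1\<close>.
\<close>

lemma tail_integral:
  assumes I: "(\<integral>\<^sup>+z\<in>- ball (0::'a) (\<rho> + d). ennreal (norm z powr (- (real DIM('a) + s * p))) \<partial>lborel) \<le> ennreal I" and I0: "0 \<le> I"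
  shows "integrable lborel (\<lambda>y. U y * D1 y)" "(\<integral>y. U y * D1 y \<partial>lborel) \<le> 2 powr p * (I + 1)"
proof -
  let ?b = "real DIM('a) + s * p"
  have [measurable]: "(\<lambda>x. indicator (- ball 0 r) (x :: 'a) :: ennreal) \<in> borel_measurable borel" for r
    by (rule borel_measurable_indicator) auto
  have [measurable]: "(\<lambda>x. indicator (- ball 0 r) (x :: 'a) :: real) \<in> borel_measurable borel" for r
    by (rule borel_measurable_indicator) auto
  define T where "T = (\<lambda>y. ennreal (\<bar>u y\<bar> powr (p - 1) * norm y powr (- ?b)) * indicator (- ball 0 1) y)"
  define E where "E = (\<lambda>y::'a. ennreal (norm y powr (- ?b)) * indicator (- ball 0 (\<rho> + d)) y)"
  have [measurable]: "T \<in> borel_measurable borel" "E \<in> borel_measurable borel" unfolding T_def E_def by measurable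
  have T: "(\<integral>\<^sup>+y. T y \<partial>lborel) \<le> 1" using u unfolding normalized_solution_def T_def by blast
  have E: "(\<integral>\<^sup>+y. E y \<partial>lborel) \<le> ennreal I" using I unfolding E_def .
  have pt: "ennreal (U y * D1 y) \<le> ennreal (2 powr p) * (E y + T y)" for y
  proof (cases "y \<in> ball 0 (\<rho> + d)")
    case False
    have "U y \<le> 2 powr (p - 1) * (1 powr (p - 1) + \<bar>u y\<bar> powr (p - 1))" using p by (intro add_powr_le) auto
    also have "\<dots> \<le> 2 powr p * (1 + indicator (- ball 0 1) y * \<bar>u y\<bar> powr (p - 1))"
    proof (cases "norm y < 1")
      case True
      then have "\<bar>u y\<bar> powr (p - 1) \<le> 1" using u_le_1[OF True] p by (intro powr_le1) auto
      then have "2 powr (p - 1) * (1 powr (p - 1) + \<bar>u y\<bar> powr (p - 1)) \<le> 2 powr (p - 1) * 2" by (intro mult_left_mono) auto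
      also have "\<dots> = 2 powr p" by (simp add: powr_diff)
      finally show ?thesis using True by simp
    next
      case False
      have "2 powr (p - 1) * (1 + \<bar>u y\<bar> powr (p - 1)) \<le> 2 powr p * (1 + \<bar>u y\<bar> powr (p - 1))"
        by (intro mult_right_mono powr_mono) auto
      then show ?thesis using False by simp
    qed
    finally have "U y * norm y powr (- ?b) \<le> 2 powr p * (1 + indicator (- ball 0 1) y * \<bar>u y\<bar> powr (p - 1)) * norm y powr (- ?b)"
      by (rule mult_right_mono) simp
    also have "\<dots> = 2 powr p * (norm y powr (- ?b) + \<bar>u y\<bar> powr (p - 1) * norm y powr (- ?b) * indicator (- ball 0 1) y)"
      by (simp add: algebra_simps)
    finally have "ennreal (U y * norm y powr (- ?b)) \<le> ennreal (2 powr p) * (ennreal (norm y powr (- ?b)) + T y)"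
      unfolding T_def by (simp add: ennreal_mult[symmetric] ennreal_plus[symmetric] ennreal_indicator[symmetric] ennreal_leI del: ennreal_plus)
    then show ?thesis using False by (simp add: E_def)
  qed simp
  have le: "(\<integral>\<^sup>+y. ennreal (U y * D1 y) \<partial>lborel) \<le> ennreal (2 powr p * (I + 1))"
  proof -
    have "(\<integral>\<^sup>+y. ennreal (U y * D1 y) \<partial>lborel) \<le> (\<integral>\<^sup>+y. ennreal (2 powr p) * (E y + T y) \<partial>lborel)"
      by (intro nn_integral_mono pt)
    also have "\<dots> = ennreal (2 powr p) * ((\<integral>\<^sup>+y. E y \<partial>lborel) + (\<integral>\<^sup>+y. T y \<partial>lborel))"
      by (simp add: nn_integral_cmult nn_integral_add)
    also have "\<dots> \<le> ennreal (2 powr p) * (ennreal I + 1)"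
      by (intro mult_left_mono add_mono E T) auto
    also have "\<dots> = ennreal (2 powr p * (I + 1))"
      using I0 by (simp add: ennreal_mult ennreal_plus)
    finally show ?thesis .
  qed
  show int: "integrable lborel (\<lambda>y. U y * D1 y)"
    by (rule integrableI_bounded, measurable, rule le_less_trans[of _ "ennreal (2 powr p * (I + 1))"]) (use le in auto)
  have "ennreal (\<integral>y. U y * D1 y \<partial>lborel) \<le> ennreal (2 powr p * (I + 1))"
    using le by (subst nn_integral_eq_integral[symmetric, OF int]) auto
  then show "(\<integral>y. U y * D1 y \<partial>lborel) \<le> 2 powr p * (I + 1)" using I0 by (simp add: ennreal_le_iff)
qed


text \<open>
  Substituting \<open>y - h\<close> for \<open>y\<close> in the translated half turns \<open>u(y+h)\<close> into \<open>u(y)\<close> and shifts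
  only the kernel. The two halves then differ by the Lipschitz change of the kernel, of size \<open>|h|\<close>, and
  by the change of \<open>u(x)\<close>, of size \<open>|\<tau>\<^sub>h u(x)|\<close>. Estimating the halves separately would lose this
  factor and stop the iteration at \<open>sp/(p-1)\<close>.
\<close>

lemma far_integral_le:
  assumes I: "(\<integral>\<^sup>+z\<in>- ball (0::'a) (\<rho> + d). ennreal (norm z powr (- (real DIM('a) + s * p))) \<partial>lborel) \<le> ennreal I" and I0: "0 \<le> I"
    and x: "norm x < \<rho> + d"
  shows "\<bar>\<integral>y. (J (u (x + h) - u (y + h)) - J (u x - u y)) * k0 x y \<partial>lborel\<bar> \<le> far_const d (real DIM('a) + s * p) p I * (norm h + \<bar>\<tau> x\<bar>)"
proof -
  let ?b = "real DIM('a) + s * p"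
  let ?C0 = "comparison_const d ?b"
  let ?C2 = "shift_const d ?b"
  have [measurable]: "(\<lambda>x. indicator (- ball 0 r) (x :: 'a) :: real) \<in> borel_measurable borel" for r
    by (rule borel_measurable_indicator) auto
  \<comment> \<open>The translated half after the substitution, and the untranslated half.\<close>
  define f1 where "f1 = (\<lambda>y. J (u (x + h) - u y) * k1 x y)"
  define f0 where "f0 = (\<lambda>y. J (u x - u y) * k0 x y)"
  have [measurable]: "f1 \<in> borel_measurable borel" "f0 \<in> borel_measurable borel" unfolding f1_def f0_def by measurable
  note T = tail_integral[OF I I0]
  have x1: "norm x < 1" "norm (x + h) < 1" using x d norm_add_h[of x] by auto
  have C0: "0 \<le> ?C0" by simp
  have b1: "\<bar>f1 y\<bar> \<le> ?C0 * (U y * D1 y)" for y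
  proof -
    have "\<bar>f1 y\<bar> = \<bar>J (u (x + h) - u y)\<bar> * k1 x y"
      unfolding f1_def abs_mult[of "J (u (x + h) - u y)"] using k1_le(1)[OF x, of y] by (simp only: abs_of_nonneg)
    also have "\<dots> \<le> U y * (?C0 * D1 y)"
      by (intro mult_mono abs_J_le_U[OF x1(2)] k1_le[OF x]) auto
    finally show ?thesis by (simp add: mult_ac)
  qed
  have b0: "\<bar>f0 y\<bar> \<le> ?C0 * (U y * D1 y)" for y
  proof -
    have "\<bar>f0 y\<bar> = \<bar>J (u x - u y)\<bar> * k0 x y"
      unfolding f0_def abs_mult[of "J (u x - u y)"] using k0_le(1)[OF x, of y] by (simp only: abs_of_nonneg)
    also have "\<dots> \<le> U y * (?C0 * D1 y)"
      by (intro mult_mono abs_J_le_U[OF x1(1)] k0_le[OF x]) auto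
    finally show ?thesis by (simp add: mult_ac)
  qed
  have i1: "integrable lborel f1" 
    by (rule Bochner_Integration.integrable_bound[OF integrable_mult_right[OF T(1), of "?C0"]]) (use b1 order_trans[OF b1 abs_ge_self] in auto)
  have i0: "integrable lborel f0" 
    by (rule Bochner_Integration.integrable_bound[OF integrable_mult_right[OF T(1), of "?C0"]]) (use order_trans[OF b0 abs_ge_self] in auto)
  have "integrable (distr lborel borel ((+) h)) f1" unfolding lborel_distr_plus by (rule i1)
  then have i1': "integrable lborel (\<lambda>y. f1 (h + y))" by (simp add: integrable_distr_eq)
  have "(\<integral>y. f1 y \<partial>distr lborel borel ((+) h)) = (\<integral>y. f1 y \<partial>lborel)" unfolding lborel_distr_plus ..
  then have e1: "(\<integral>y. f1 (h + y) \<partial>lborel) = (\<integral>y. f1 y \<partial>lborel)" by (simp add: integral_distr)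
  have "(\<integral>y. (J (u (x + h) - u (y + h)) - J (u x - u y)) * k0 x y \<partial>lborel) = (\<integral>y. f1 (h + y) - f0 y \<partial>lborel)"
    by (intro Bochner_Integration.integral_cong) (auto simp: f1_def f0_def algebra_simps)
  also have "\<dots> = (\<integral>y. f1 y - f0 y \<partial>lborel)"
    using i1 i0 i1' e1 by simp
  also have "\<bar>\<dots>\<bar> \<le> (\<integral>y. \<bar>f1 y - f0 y\<bar> \<partial>lborel)" by (rule integral_abs_bound)
  also have "\<dots> \<le> (\<integral>y. (?C2 * norm h + ?C0 * p * 2 powr (p - 2) * \<bar>\<tau> x\<bar>) * (U y * D1 y) \<partial>lborel)"
  proof (rule integral_mono)
    show "integrable lborel (\<lambda>y. \<bar>f1 y - f0 y\<bar>)" using i1 i0 by auto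
    show "integrable lborel (\<lambda>y. (?C2 * norm h + ?C0 * p * 2 powr (p - 2) * \<bar>\<tau> x\<bar>) * (U y * D1 y))" using T(1) by auto
    have tri: "\<bar>a * b + c * k\<bar> \<le> \<bar>a\<bar> * \<bar>b\<bar> + \<bar>c\<bar> * k" if "0 \<le> k" for a b c k :: real
      using that abs_triangle_ineq[of "a * b" "c * k"] by (simp add: abs_mult)
    fix y
    have "f1 y - f0 y = J (u (x + h) - u y) * (k1 x y - k0 x y) + (J (u (x + h) - u y) - J (u x - u y)) * k0 x y"
      unfolding f1_def f0_def by (simp add: algebra_simps)
    then have "\<bar>f1 y - f0 y\<bar> \<le> \<bar>J (u (x + h) - u y)\<bar> * \<bar>k1 x y - k0 x y\<bar> + \<bar>J (u (x + h) - u y) - J (u x - u y)\<bar> * k0 x y"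
      using tri[of "k0 x y" "J (u (x + h) - u y)" "k1 x y - k0 x y" "J (u (x + h) - u y) - J (u x - u y)"] k0_le(1)[OF x, of y]
      by (simp only:)
    also have "\<dots> \<le> U y * (?C2 * norm h * D1 y) + (p * 2 powr (p - 2) * \<bar>\<tau> x\<bar> * U y) * (?C0 * D1 y)"
      using p by (intro add_mono mult_mono abs_J_le_U[OF x1(2)] k_diff_le[OF x] abs_J_diff_le_U[OF x] k0_le[OF x]) auto
    finally show "\<bar>f1 y - f0 y\<bar> \<le> (?C2 * norm h + ?C0 * p * 2 powr (p - 2) * \<bar>\<tau> x\<bar>) * (U y * D1 y)"
      by (simp add: algebra_simps)
  qed
  also have "\<dots> = (?C2 * norm h + ?C0 * p * 2 powr (p - 2) * \<bar>\<tau> x\<bar>) * (\<integral>y. U y * D1 y \<partial>lborel)"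
    by (rule integral_mult_right_zero)
  also have "\<dots> \<le> ((?C2 + ?C0 * p * 2 powr (p - 2)) * (norm h + \<bar>\<tau> x\<bar>)) * (2 powr p * (I + 1))"
  proof (intro mult_mono T(2))
    have "0 \<le> ?C2 * \<bar>\<tau> x\<bar>" "0 \<le> ?C0 * p * 2 powr (p - 2) * norm h" using d exponent_pos p by auto
    then show "?C2 * norm h + ?C0 * p * 2 powr (p - 2) * \<bar>\<tau> x\<bar> \<le> (?C2 + ?C0 * p * 2 powr (p - 2)) * (norm h + \<bar>\<tau> x\<bar>)"
      unfolding distrib_left distrib_right by linarith
    show "0 \<le> (?C2 + ?C0 * p * 2 powr (p - 2)) * (norm h + \<bar>\<tau> x\<bar>)" using d exponent_pos p by (intro mult_nonneg_nonneg add_nonneg_nonneg) auto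
  qed (auto intro!: Bochner_Integration.integral_nonneg)
  finally show ?thesis by (simp add: mult_ac)
qed

abbreviation "W \<equiv> (\<lambda>(x, y). \<xi> x * \<xi> y)"

lemma W_bounds: "0 \<le> W z" "W z \<le> 1"
  using cutoff_bounds[of "\<rho> + 2 * d" "\<rho> + 3 * d" "fst z"] cutoff_bounds[of "\<rho> + 2 * d" "\<rho> + 3 * d" "snd z"]
  by (auto simp: case_prod_beta' intro: mult_le_one)

lemma integrable_diff_integrand: "integrable (lborel \<Otimes>\<^sub>M lborel) diff_integrand"
  using difference_equation by (simp add: has_bochner_integral_iff)

lemma integrable_diff_integrand_W: "integrable (lborel \<Otimes>\<^sub>M lborel) (\<lambda>z. diff_integrand z * W z)"
proof (rule Bochner_Integration.integrable_bound[OF integrable_diff_integrand])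
  have [measurable]: "diff_integrand \<in> borel_measurable (lborel \<Otimes>\<^sub>M lborel)"
    using integrable_diff_integrand by (rule borel_measurable_integrable)
  show "(\<lambda>z. diff_integrand z * W z) \<in> borel_measurable (lborel \<Otimes>\<^sub>M lborel)" by measurable
  show "AE z in lborel \<Otimes>\<^sub>M lborel. norm (diff_integrand z * W z) \<le> norm (diff_integrand z)"
  proof (rule AE_I2)
    fix z
    have "\<bar>diff_integrand z\<bar> * \<bar>W z\<bar> \<le> \<bar>diff_integrand z\<bar> * 1"
      using W_bounds[of z] by (intro mult_left_mono) auto
    then show "norm (diff_integrand z * W z) \<le> norm (diff_integrand z)" by (simp add: abs_mult)
  qed
qed

text \<open>
  The integral of \<open>diff_integrand\<close> vanishes, so its part weighted by \<open>W\<close> is minus the part weighted by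
  \<open>1-W\<close>. Since \<open>\<xi> = 1\<close> on the support of the test function, the latter splits into two parts that are mirror images
  of each other, and each is the integral of the test function times the integral in \<open>far_integral_le\<close>. The parameter \<open>\<delta>\<close> will be \<open>|h|\<^sup>\<theta>\<close>.
\<close>

lemma far_part_le:
  fixes A2 :: ennreal and \<delta> :: real
  assumes I: "(\<integral>\<^sup>+z\<in>- ball (0::'a) (\<rho> + d). ennreal (norm z powr (- (real DIM('a) + s * p))) \<partial>lborel) \<le> ennreal I" and I0: "0 \<le> I"
    and \<delta>: "0 < \<delta>" "norm h \<le> \<delta>"
    and A2: "translation_energy q (\<rho> + 3 * d) h u \<le> ennreal (\<delta> powr q) * A2"
  shows "ennreal \<bar>\<integral>z. diff_integrand z * W z \<partial>(lborel \<Otimes>\<^sub>M lborel)\<bar>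
    \<le> ennreal (4 * far_const d (real DIM('a) + s * p) p I * \<delta> powr (q - p + 2)) * (emeasure lborel (ball (0::'a) (\<rho> + 3 * d)) + A2)"
proof -
  let ?b = "real DIM('a) + s * p"
  let ?Cf = "far_const d ?b p I"
  let ?M = "lborel \<Otimes>\<^sub>M lborel :: ('a \<times> 'a) measure"
  have H: "integrable ?M diff_integrand" "(\<integral>z. diff_integrand z \<partial>?M) = 0"
    using difference_equation by (auto simp: has_bochner_integral_iff)
  have Hm [measurable]: "diff_integrand \<in> borel_measurable ?M" using H(1) by (rule borel_measurable_integrable)
  have Wm [measurable]: "W \<in> borel_measurable ?M" by measurable
  note HW = integrable_diff_integrand_W
  define Hf where "Hf = (\<lambda>z. diff_integrand z * (1 - W z))"
  have Hf: "integrable ?M Hf" "(\<integral>z. Hf z \<partial>?M) = - (\<integral>z. diff_integrand z * W z \<partial>?M)"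
    unfolding Hf_def using H HW by (simp_all add: right_diff_distrib)
  define G where "G = (\<lambda>(x, y). test x * ((J (u (x + h) - u (y + h)) - J (u x - u y)) * k0 x y))"
  have \<xi>1: "\<xi> x = 1" if "test x \<noteq> 0" for x
  proof -
    have "\<not> \<rho> + d \<le> norm x" using that test_eq_0[of x] by blast
    then show ?thesis using d by (intro \<xi>_eq_1) linarith
  qed
  have Gm [measurable]: "G \<in> borel_measurable ?M" unfolding G_def by measurable
  have GH: "G z = Hf z * indicator {z. test (fst z) \<noteq> 0} z" if "test (snd z) = 0 \<or> \<xi> (snd z) = 1" for z
    using that \<xi>1[of "fst z"] by (cases z) (auto simp: G_def Hf_def diff_integrand_def indicator_def)
  have GH: "G z = Hf z * indicator {z. test (fst z) \<noteq> 0} z" for z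
    by (rule GH) (use \<xi>1 in blast)
  have G: "integrable ?M G"
    by (rule Bochner_Integration.integrable_bound[OF Hf(1)]) (auto simp: GH indicator_def)
  have Jodd: "J (- t) = - J t" for t by (simp add: signed_power_def)
  have sym: "Hf (x, y) = G (x, y) + G (y, x)" for x y
  proof -
    have j: "J (u (y + h) - u (x + h)) = - J (u (x + h) - u (y + h))" "J (u y - u x) = - J (u x - u y)"
      using Jodd[of "u (x + h) - u (y + h)"] Jodd[of "u x - u y"] by simp_all
    define a where "a = J (u (x + h) - u (y + h)) - J (u x - u y)"
    have a: "J (u (y + h) - u (x + h)) - J (u y - u x) = - a" by (simp add: a_def j)
    have "Hf (x, y) = a * (test x - test y) * K (x - y) * (1 - \<xi> x * \<xi> y)"
      by (simp add: Hf_def diff_integrand_def a_def)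
    moreover have "G (x, y) = test x * (a * ((1 - \<xi> y) * K (x - y)))" by (simp add: G_def a_def)
    moreover have "G (y, x) = test y * (- a * ((1 - \<xi> x) * K (x - y)))"
      unfolding G_def by (simp add: a norm_minus_commute)
    ultimately show ?thesis using \<xi>1[of x] \<xi>1[of y]
      by (cases "test x = 0"; cases "test y = 0") (simp_all add: algebra_simps)
  qed
  have Gsw: "integrable ?M (\<lambda>(x, y). G (y, x))" using lborel_pair.integrable_product_swap[OF G] .
  have "(\<integral>z. Hf z \<partial>?M) = (\<integral>z. G z + (case z of (x, y) \<Rightarrow> G (y, x)) \<partial>?M)"
    by (intro Bochner_Integration.integral_cong) (auto simp: sym)
  also have "\<dots> = (\<integral>z. G z \<partial>?M) + (\<integral>z. (case z of (x, y) \<Rightarrow> G (y, x)) \<partial>?M)"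
    using G Gsw by (intro Bochner_Integration.integral_add)
  also have "(\<integral>z. (case z of (x, y) \<Rightarrow> G (y, x)) \<partial>?M) = (\<integral>z. G z \<partial>?M)"
    by (rule lborel_pair.integral_product_swap) simp
  finally have HG: "(\<integral>z. Hf z \<partial>?M) = 2 * (\<integral>z. G z \<partial>?M)" by simp
  have fub: "(\<integral>z. G z \<partial>?M) = (\<integral>x. test x * (\<integral>y. (J (u (x + h) - u (y + h)) - J (u x - u y)) * k0 x y \<partial>lborel) \<partial>lborel)"
    using lborel_pair.integral_fst'[OF G] by (simp add: G_def)
  have Cf: "0 \<le> ?Cf" using d exponent_pos p I0 by (intro mult_nonneg_nonneg add_nonneg_nonneg) auto
  have "ennreal \<bar>\<integral>z. G z \<partial>?M\<bar> \<le> (\<integral>\<^sup>+x. ennreal (\<bar>test x * (\<integral>y. (J (u (x + h) - u (y + h)) - J (u x - u y)) * k0 x y \<partial>lborel)\<bar>) \<partial>lborel)"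
    unfolding fub real_norm_def[symmetric] by (rule integral_norm_bound_ennreal) (use lborel_pair.integrable_fst'[OF G] in \<open>simp add: G_def\<close>)
  also have "\<dots> \<le> (\<integral>\<^sup>+x. ennreal (2 * ?Cf * \<delta> powr (q - p + 2)) * (indicator (ball 0 (\<rho> + 3 * d)) x + ennreal (\<delta> powr (- q)) * (ennreal (\<bar>\<tau> x\<bar> powr q) * indicator (ball 0 (\<rho> + 3 * d)) x)) \<partial>lborel)"
  proof (rule nn_integral_mono)
    fix x :: 'a
    let ?F = "\<integral>y. (J (u (x + h) - u (y + h)) - J (u x - u y)) * k0 x y \<partial>lborel"
    show "ennreal \<bar>test x * ?F\<bar> \<le> ennreal (2 * ?Cf * \<delta> powr (q - p + 2)) * (indicator (ball 0 (\<rho> + 3 * d)) x + ennreal (\<delta> powr (- q)) * (ennreal (\<bar>\<tau> x\<bar> powr q) * indicator (ball 0 (\<rho> + 3 * d)) x))"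
    proof (cases "norm x < \<rho> + d")
      case True
      define z where "z = \<bar>\<tau> x\<bar> / \<delta>"
      have z: "\<bar>\<tau> x\<bar> = \<delta> * z" "0 \<le> z" using \<delta> by (auto simp: z_def)
      have "\<bar>test x * ?F\<bar> \<le> (\<bar>\<tau> x\<bar> powr (q - p) * \<bar>\<tau> x\<bar>) * (?Cf * (norm h + \<bar>\<tau> x\<bar>))"
        unfolding abs_mult by (intro mult_mono abs_test_le far_integral_le[OF I I0 True]) auto
      also have "\<dots> \<le> (\<bar>\<tau> x\<bar> powr (q - p) * \<bar>\<tau> x\<bar>) * (?Cf * (\<delta> + \<bar>\<tau> x\<bar>))"
        using \<delta> Cf by (intro mult_left_mono) auto
      also have "\<dots> = ?Cf * (\<delta> powr (q - p) * \<delta> * \<delta>) * ((z powr (q - p) * z) * (1 + z))"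
        unfolding z(1) using \<delta> z(2) by (simp add: powr_mult algebra_simps)
      also have "\<delta> powr (q - p) * \<delta> * \<delta> = \<delta> powr (q - p + 2)"
        using \<delta> by (simp add: powr_add power2_eq_square)
      also have "(z powr (q - p) * z) * (1 + z) = z powr (q - p + 1) + z powr (q - p + 2)"
        using z(2) by (cases "z = 0") (simp_all add: powr_add distrib_left power2_eq_square)
      also have "?Cf * \<delta> powr (q - p + 2) * (z powr (q - p + 1) + z powr (q - p + 2)) \<le> ?Cf * \<delta> powr (q - p + 2) * ((1 + z powr q) + (1 + z powr q))"
        using Cf q p z by (intro mult_left_mono add_mono powr_le_one_add) auto
      also have "\<dots> = 2 * ?Cf * \<delta> powr (q - p + 2) * (1 + z powr q)" by simp
      also have "z powr q = \<delta> powr (- q) * \<bar>\<tau> x\<bar> powr q"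
        using \<delta> by (simp add: z_def powr_divide powr_minus field_simps)
      finally have "ennreal \<bar>test x * ?F\<bar> \<le> ennreal (2 * ?Cf * \<delta> powr (q - p + 2)) * (1 + ennreal (\<delta> powr (- q)) * ennreal (\<bar>\<tau> x\<bar> powr q))"
        using Cf by (subst ennreal_1[symmetric]) (simp add: ennreal_mult[symmetric] ennreal_plus[symmetric] ennreal_leI del: ennreal_plus ennreal_1)
      then show ?thesis using True d by simp
    qed (simp add: test_eq_0)
  qed
  also have "\<dots> = ennreal (2 * ?Cf * \<delta> powr (q - p + 2)) * (emeasure lborel (ball (0::'a) (\<rho> + 3 * d)) + ennreal (\<delta> powr (- q)) * translation_energy q (\<rho> + 3 * d) h u)"
    by (simp add: nn_integral_cmult nn_integral_add)
  also have "\<dots> \<le> ennreal (2 * ?Cf * \<delta> powr (q - p + 2)) * (emeasure lborel (ball (0::'a) (\<rho> + 3 * d)) + ennreal (\<delta> powr (- q)) * (ennreal (\<delta> powr q) * A2))"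
    by (intro mult_left_mono add_left_mono A2) auto
  also have "ennreal (\<delta> powr (- q)) * (ennreal (\<delta> powr q) * A2) = A2"
    using \<delta> by (simp add: mult.assoc[symmetric] ennreal_mult[symmetric] powr_add[symmetric])
  finally have "ennreal 2 * ennreal \<bar>\<integral>z. G z \<partial>?M\<bar> \<le> ennreal 2 * (ennreal (2 * ?Cf * \<delta> powr (q - p + 2)) * (emeasure lborel (ball (0::'a) (\<rho> + 3 * d)) + A2))"
    by (rule mult_left_mono) auto
  also have "ennreal 2 * ennreal \<bar>\<integral>z. G z \<partial>?M\<bar> = ennreal \<bar>\<integral>z. diff_integrand z * W z \<partial>?M\<bar>"
  proof -
    have "\<bar>\<integral>z. diff_integrand z * W z \<partial>?M\<bar> = 2 * \<bar>\<integral>z. G z \<partial>?M\<bar>" using HG Hf(2) by linarith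
    then show ?thesis by (subst ennreal_mult[symmetric]) auto
  qed
  also have "ennreal 2 * (ennreal (2 * ?Cf * \<delta> powr (q - p + 2)) * (emeasure lborel (ball (0::'a) (\<rho> + 3 * d)) + A2))
     = ennreal (4 * ?Cf * \<delta> powr (q - p + 2)) * (emeasure lborel (ball (0::'a) (\<rho> + 3 * d)) + A2)"
  proof -
    have "ennreal 2 * (ennreal (2 * c * l) * Y) = ennreal (4 * c * l) * Y" if "0 \<le> c" "0 \<le> l" for c l and Y :: ennreal
    proof -
      have "ennreal 2 * ennreal (2 * c * l) = ennreal (4 * c * l)"
        using that by (subst ennreal_mult[symmetric]) auto
      then show ?thesis by (simp only: mult.assoc[symmetric])
    qed
    then show ?thesis using Cf by (simp only: powr_ge_zero)
  qed
  finally show ?thesis .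
qed


section \<open>The near field and the energy estimate\<close>

text \<open>
  Young's inequality with exponents \<open>q/(p-2)\<close> and \<open>q/(q-p+2)\<close>, after scaling \<open>m\<close> by \<open>\<delta>\<close>. The relation
  for \<open>\<alpha>\<close> balances the powers of \<open>n = |x-y|\<close>: the first term carries the kernel of an energy of order
  \<open>\<sigma>\<close>, and the second is integrable on the diagonal when \<open>\<alpha> > 0\<close>.
\<close>

lemma near_error_young:
  fixes S m n \<delta> \<sigma> \<alpha> N :: real
  assumes nn: "0 \<le> S" "0 \<le> m" "0 \<le> n" and \<delta>: "0 < \<delta>"
    and \<alpha>: "\<alpha> * (q - p + 2) = q * (2 - s * p) + (p - 2) * \<sigma>"
  shows "S powr (p - 2) * m powr (q - p) * m\<^sup>2 * (n\<^sup>2 * n powr (- (N + s * p)))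
    \<le> \<delta> powr (q - p + 2) * (S powr q * n powr (- (N + \<sigma>)) + \<delta> powr (- q) * (m powr q * n powr (\<alpha> - N)))"
proof (cases "n = 0")
  case False
  then have n: "0 < n" using nn by simp
  have q0: "0 < q" using p q by linarith
  define X where "X = S * n powr (- (N + \<sigma>) / q)"
  define Y where "Y = m / \<delta> * n powr ((\<alpha> - N) / q)"
  have XY: "0 \<le> X" "0 \<le> Y" using nn \<delta> by (auto simp: X_def Y_def)
  have e: "- (N + \<sigma>) / q * (p - 2) + (\<alpha> - N) / q * (q - p + 2) = 2 + - (N + s * p)"
  proof -
    have "- (N + \<sigma>) * (p - 2) + (\<alpha> - N) * (q - p + 2) = q * (2 - N - s * p)"
      using \<alpha> by (simp add: algebra_simps)
    then have "(- (N + \<sigma>) * (p - 2) + (\<alpha> - N) * (q - p + 2)) / q = 2 - N - s * p" using q0 by simp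
    then show ?thesis by (simp add: add_divide_distrib)
  qed
  have mm: "m powr (q - p) * m\<^sup>2 = \<delta> powr (q - p + 2) * (m / \<delta>) powr (q - p + 2)"
  proof (cases "m = 0")
    case False
    then have "m powr (q - p) * m\<^sup>2 = m powr (q - p + 2)" using nn by (simp add: powr_add)
    also have "\<dots> = (\<delta> * (m / \<delta>)) powr (q - p + 2)" using \<delta> by simp
    also have "\<dots> = \<delta> powr (q - p + 2) * (m / \<delta>) powr (q - p + 2)" by (rule powr_mult)
    finally show ?thesis .
  qed simp
  have nn2: "n\<^sup>2 * n powr (- (N + s * p)) = n powr (- (N + \<sigma>) / q * (p - 2)) * n powr ((\<alpha> - N) / q * (q - p + 2))"
  proof -
    have "n\<^sup>2 = n powr 2" using n by (simp add: powr_numeral)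
    then show ?thesis unfolding powr_add[symmetric] e by (simp only: powr_add)
  qed
  have "S powr (p - 2) * m powr (q - p) * m\<^sup>2 * (n\<^sup>2 * n powr (- (N + s * p)))
     = S powr (p - 2) * (m powr (q - p) * m\<^sup>2) * (n\<^sup>2 * n powr (- (N + s * p)))" by (simp only: mult.assoc)
  also have "\<dots> = \<delta> powr (q - p + 2) * (X powr (p - 2) * Y powr (q - p + 2))"
    unfolding mm nn2 X_def Y_def powr_mult powr_powr by (simp only: mult_ac)
  also have "\<dots> \<le> \<delta> powr (q - p + 2) * (X powr (p - 2 + (q - p + 2)) + Y powr (p - 2 + (q - p + 2)))"
    using p q XY by (intro mult_left_mono powr_mult_le_add) auto
  also have "X powr (p - 2 + (q - p + 2)) = S powr q * n powr (- (N + \<sigma>))"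
    unfolding X_def powr_mult powr_powr using q0 by simp
  also have "Y powr (p - 2 + (q - p + 2)) = \<delta> powr (- q) * (m powr q * n powr (\<alpha> - N))"
  proof -
    have e: "(\<alpha> - N) / q * q = \<alpha> - N" "p - 2 + (q - p + 2) = q" using q0 by simp_all
    have md: "(m / \<delta>) powr q = \<delta> powr (- q) * m powr q"
      using nn \<delta> by (simp add: powr_divide powr_minus_divide)
    show ?thesis unfolding Y_def powr_mult powr_powr by (simp only: e md mult.assoc)
  qed
  finally show ?thesis .
qed simp

text \<open>
  The negative term of \<open>tested_monotonicity\<close>, weighted by the kernel and restricted to the support of \<open>W\<close>.
\<close>

definition near_error :: "'a \<Rightarrow> 'a \<Rightarrow> real" where
  "near_error x y = (\<bar>u (x + h) - u (y + h)\<bar> + \<bar>u x - u y\<bar>) powr (p - 2) * (\<bar>\<tau> x\<bar> + \<bar>\<tau> y\<bar>) powr (q - p)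
     * (\<bar>\<tau> x\<bar> + \<bar>\<tau> y\<bar>)\<^sup>2 * (\<eta> x - \<eta> y)\<^sup>2 * K (x - y) * indicator (ball 0 (\<rho> + 3 * d)) y * indicator (ball 0 (\<rho> + 3 * d)) x"

lemma near_error_nonneg: "0 \<le> near_error x y"
  unfolding near_error_def by (intro mult_nonneg_nonneg) auto

lemma near_error_borel [measurable]: "(\<lambda>(x, y). near_error x y) \<in> borel_measurable (borel \<Otimes>\<^sub>M borel)"
  unfolding near_error_def by measurable

text \<open>
  Integrates \<open>near_error_young\<close>. In the second term \<open>|x-y|\<^bsup>\<alpha>-N\<^esup>\<close> is integrated in one variable first,
  which leaves \<open>\<integral> |\<tau>\<^sub>h u|\<^sup>q\<close>.
\<close>

lemma near_part_le:
  fixes A1 A2 Q :: ennreal and \<delta> \<sigma> \<alpha> :: real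
  assumes \<delta>: "0 < \<delta>" and \<alpha>: "\<alpha> * (q - p + 2) = q * (2 - s * p) + (p - 2) * \<sigma>"
    and A1: "kernel_energy \<sigma> q (ball 0 (\<rho> + 4 * d)) u \<le> A1"
    and A2: "translation_energy q (\<rho> + 3 * d) h u \<le> ennreal (\<delta> powr q) * A2"
    and Q: "(\<integral>\<^sup>+z\<in>ball (0::'a) (2 * (\<rho> + 3 * d)). ennreal (norm z powr (\<alpha> - real DIM('a))) \<partial>lborel) \<le> Q"
  shows "(\<integral>\<^sup>+x. \<integral>\<^sup>+y. ennreal (near_error x y) \<partial>lborel \<partial>lborel) \<le> ennreal (2 powr (q + 1) / d\<^sup>2 * \<delta> powr (q - p + 2)) * (A1 + Q * A2)"
proof -
  let ?N = "real DIM('a)" let ?R = "\<rho> + 3 * d"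
  define c where "c = 2 powr q / d\<^sup>2 * \<delta> powr (q - p + 2)"
  define e where "e = (\<lambda>(w :: 'a \<Rightarrow> real) x y. ennreal (\<bar>w x - w y\<bar> powr q * norm (x - y) powr (- (?N + \<sigma>))))"
  define f where "f = (\<lambda>x y::'a. ennreal (\<bar>\<tau> x\<bar> powr q) * ennreal (norm (x - y) powr (\<alpha> - ?N)))"
  define ev where "ev = e u"
  define eh where "eh = e (\<lambda>x. u (x + h))"
  define I where "I = (\<lambda>x::'a. indicator (ball 0 ?R) x :: ennreal)"
  have c: "0 \<le> c" by (simp add: c_def)
  have [measurable]: "(\<lambda>(x, y). ev x y) \<in> borel_measurable (borel \<Otimes>\<^sub>M borel)"
    "(\<lambda>(x, y). eh x y) \<in> borel_measurable (borel \<Otimes>\<^sub>M borel)"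
    "(\<lambda>(x, y). f x y) \<in> borel_measurable (borel \<Otimes>\<^sub>M borel)" "I \<in> borel_measurable borel"
    unfolding ev_def eh_def e_def f_def I_def by measurable
  have pt: "ennreal (near_error x y) \<le> ennreal c * ((eh x y + ev x y + ennreal (\<delta> powr (- q)) * (f x y + f y x)) * I y * I x)" for x y
  proof (cases "x \<in> ball 0 ?R \<and> y \<in> ball 0 ?R")
    case True
    define n where "n = norm (x - y)"
    define A B where "A = \<bar>u (x + h) - u (y + h)\<bar>" and "B = \<bar>u x - u y\<bar>"
    define a b where "a = \<bar>\<tau> x\<bar>" and "b = \<bar>\<tau> y\<bar>"
    have nn: "0 \<le> A" "0 \<le> B" "0 \<le> a" "0 \<le> b" "0 \<le> n" by (auto simp: A_def B_def a_def b_def n_def)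
    have q0: "0 \<le> q" using p q by linarith
    have "\<bar>\<eta> x - \<eta> y\<bar> \<le> n / d" using cutoff_lipschitz[of \<rho> "\<rho> + d" x y] d by (simp add: n_def)
    then have "\<bar>\<eta> x - \<eta> y\<bar>\<^sup>2 \<le> (n / d)\<^sup>2" by (intro power_mono) auto
    then have \<eta>2: "(\<eta> x - \<eta> y)\<^sup>2 \<le> n\<^sup>2 / d\<^sup>2" by (simp add: power_divide)
    have "near_error x y = ((A + B) powr (p - 2) * (a + b) powr (q - p) * (a + b)\<^sup>2) * ((\<eta> x - \<eta> y)\<^sup>2 * n powr (- (?N + s * p)))"
      using True unfolding near_error_def A_def B_def a_def b_def n_def by simp
    also have "\<dots> \<le> ((A + B) powr (p - 2) * (a + b) powr (q - p) * (a + b)\<^sup>2) * (n\<^sup>2 / d\<^sup>2 * n powr (- (?N + s * p)))"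
      by (intro mult_left_mono mult_right_mono \<eta>2) auto
    also have "\<dots> = ((A + B) powr (p - 2) * (a + b) powr (q - p) * (a + b)\<^sup>2 * (n\<^sup>2 * n powr (- (?N + s * p)))) / d\<^sup>2"
      by simp
    also have "\<dots> \<le> (\<delta> powr (q - p + 2) * ((A + B) powr q * n powr (- (?N + \<sigma>)) + \<delta> powr (- q) * ((a + b) powr q * n powr (\<alpha> - ?N)))) / d\<^sup>2"
      using nn by (intro divide_right_mono near_error_young \<delta> \<alpha>) auto
    also have "\<dots> \<le> (\<delta> powr (q - p + 2) * ((2 powr q * (A powr q + B powr q)) * n powr (- (?N + \<sigma>)) + \<delta> powr (- q) * ((2 powr q * (a powr q + b powr q)) * n powr (\<alpha> - ?N)))) / d\<^sup>2"
      using nn q0 by (intro divide_right_mono mult_left_mono add_mono mult_right_mono add_powr_le) auto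
    also have "\<dots> = c * ((A powr q * n powr (- (?N + \<sigma>)) + B powr q * n powr (- (?N + \<sigma>))) + \<delta> powr (- q) * (a powr q * n powr (\<alpha> - ?N) + b powr q * n powr (\<alpha> - ?N)))"
      unfolding c_def by (simp add: algebra_simps add_divide_distrib)
    finally have "ennreal (near_error x y) \<le> ennreal \<dots>" by (rule ennreal_leI)
    also have "\<dots> = ennreal c * (ennreal (A powr q * n powr (- (?N + \<sigma>))) + ennreal (B powr q * n powr (- (?N + \<sigma>))) + ennreal (\<delta> powr (- q)) * (ennreal (a powr q * n powr (\<alpha> - ?N)) + ennreal (b powr q * n powr (\<alpha> - ?N))))"
      using c by (simp add: ennreal_mult ennreal_plus)
    also have "\<dots> = ennreal c * (eh x y + ev x y + ennreal (\<delta> powr (- q)) * (f x y + f y x))"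
      unfolding eh_def ev_def e_def f_def A_def B_def a_def b_def n_def by (simp add: ennreal_mult norm_minus_commute[of y x])
    finally show ?thesis using True by (simp add: I_def)
  qed (auto simp: near_error_def)
  have F: "(\<integral>\<^sup>+x. \<integral>\<^sup>+y. f x y * I y * I x \<partial>lborel \<partial>lborel) \<le> Q * (ennreal (\<delta> powr q) * A2)"
  proof -
    have "(\<integral>\<^sup>+x. \<integral>\<^sup>+y. f x y * I y * I x \<partial>lborel \<partial>lborel) \<le> (\<integral>\<^sup>+x. Q * (ennreal (\<bar>\<tau> x\<bar> powr q) * I x) \<partial>lborel)"
    proof (rule nn_integral_mono)
      fix x :: 'a
      have "(\<integral>\<^sup>+y. f x y * I y * I x \<partial>lborel) = (\<integral>\<^sup>+y. (ennreal (\<bar>\<tau> x\<bar> powr q) * I x) * (ennreal (norm (x - y) powr (\<alpha> - ?N)) * I y) \<partial>lborel)"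
        by (simp add: f_def mult_ac)
      also have "\<dots> = (ennreal (\<bar>\<tau> x\<bar> powr q) * I x) * (\<integral>\<^sup>+y. ennreal (norm (x - y) powr (\<alpha> - ?N)) * I y \<partial>lborel)"
        by (rule nn_integral_cmult) measurable
      also have "\<dots> \<le> Q * (ennreal (\<bar>\<tau> x\<bar> powr q) * I x)"
      proof (cases "norm x < ?R")
        case True
        have "(\<integral>\<^sup>+y. ennreal (norm (x - y) powr (\<alpha> - ?N)) * I y \<partial>lborel) \<le> Q"
          using nn_integral_norm_diff_ball_le[OF True, of "\<alpha> - ?N"] Q unfolding I_def by (rule order_trans)
        then show ?thesis by (subst mult.commute[of Q]) (rule mult_left_mono, auto)
      qed (simp add: I_def)
      finally show "(\<integral>\<^sup>+y. f x y * I y * I x \<partial>lborel) \<le> Q * (ennreal (\<bar>\<tau> x\<bar> powr q) * I x)" .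
    qed
    also have "\<dots> = Q * (\<integral>\<^sup>+x. ennreal (\<bar>\<tau> x\<bar> powr q) * I x \<partial>lborel)"
      by (rule nn_integral_cmult) measurable
    also have "\<dots> \<le> Q * (ennreal (\<delta> powr q) * A2)"
      using A2 unfolding I_def by (intro mult_left_mono) auto
    finally show ?thesis .
  qed
  have F': "(\<integral>\<^sup>+x. \<integral>\<^sup>+y. f y x * I y * I x \<partial>lborel \<partial>lborel) = (\<integral>\<^sup>+x. \<integral>\<^sup>+y. f x y * I y * I x \<partial>lborel \<partial>lborel)"
    by (subst lborel_pair.Fubini') (measurable, simp add: mult_ac)
  have KE: "(\<integral>\<^sup>+x. \<integral>\<^sup>+y. e w x y * I y * I x \<partial>lborel \<partial>lborel) = kernel_energy \<sigma> q (ball 0 ?R) w" if [measurable]: "w \<in> borel_measurable borel" for w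
    unfolding kernel_energy_def e_def I_def by (intro nn_integral_cong nn_integral_multc) measurable
  have eh: "(\<integral>\<^sup>+x. \<integral>\<^sup>+y. eh x y * I y * I x \<partial>lborel \<partial>lborel) \<le> A1"
  proof -
    have "kernel_energy \<sigma> q (ball 0 ?R) (\<lambda>x. u (x + h)) \<le> kernel_energy \<sigma> q (ball 0 (\<rho> + 4 * d)) u"
      using h_le_d by (intro kernel_energy_translate_le) auto
    then show ?thesis unfolding eh_def by (subst KE) (use A1 in auto)
  qed
  have ev: "(\<integral>\<^sup>+x. \<integral>\<^sup>+y. ev x y * I y * I x \<partial>lborel \<partial>lborel) \<le> A1"
  proof -
    have "kernel_energy \<sigma> q (ball 0 ?R) u \<le> kernel_energy \<sigma> q (ball 0 (\<rho> + 4 * d)) u"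
      using d by (intro kernel_energy_mono_set) auto
    then show ?thesis unfolding ev_def by (subst KE) (use A1 in auto)
  qed
  have "(\<integral>\<^sup>+x. \<integral>\<^sup>+y. ennreal (near_error x y) \<partial>lborel \<partial>lborel)
     \<le> (\<integral>\<^sup>+x. \<integral>\<^sup>+y. ennreal c * ((eh x y + ev x y + ennreal (\<delta> powr (- q)) * (f x y + f y x)) * I y * I x) \<partial>lborel \<partial>lborel)"
    by (intro nn_integral_mono pt)
  also have "\<dots> = (\<integral>\<^sup>+x. \<integral>\<^sup>+y. ennreal c * (eh x y * I y * I x + ev x y * I y * I x + ennreal (\<delta> powr (- q)) * (f x y * I y * I x + f y x * I y * I x)) \<partial>lborel \<partial>lborel)"
    by (simp add: algebra_simps)
  also have "\<dots> = ennreal c * ((\<integral>\<^sup>+x. \<integral>\<^sup>+y. eh x y * I y * I x \<partial>lborel \<partial>lborel) + (\<integral>\<^sup>+x. \<integral>\<^sup>+y. ev x y * I y * I x \<partial>lborel \<partial>lborel)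
      + ennreal (\<delta> powr (- q)) * ((\<integral>\<^sup>+x. \<integral>\<^sup>+y. f x y * I y * I x \<partial>lborel \<partial>lborel) + (\<integral>\<^sup>+x. \<integral>\<^sup>+y. f y x * I y * I x \<partial>lborel \<partial>lborel)))"
    by (simp add: nn_integral_cmult nn_integral_add)
  also have "\<dots> \<le> ennreal c * (A1 + A1 + ennreal (\<delta> powr (- q)) * (Q * (ennreal (\<delta> powr q) * A2) + Q * (ennreal (\<delta> powr q) * A2)))"
    unfolding F' by (intro mult_left_mono add_mono eh ev F) auto
  also have "ennreal (\<delta> powr (- q)) * (Q * (ennreal (\<delta> powr q) * A2) + Q * (ennreal (\<delta> powr q) * A2)) = (ennreal (\<delta> powr (- q)) * ennreal (\<delta> powr q)) * (Q * A2 + Q * A2)"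
    by (simp add: algebra_simps)
  also have "ennreal (\<delta> powr (- q)) * ennreal (\<delta> powr q) = 1"
    using \<delta> by (simp add: ennreal_mult[symmetric] powr_add[symmetric])
  also have "ennreal c * (A1 + A1 + 1 * (Q * A2 + Q * A2)) = (ennreal c * 2) * (A1 + Q * A2)"
    by (simp add: mult_2[symmetric] distrib_left mult_ac)
  also have "ennreal c * 2 = ennreal (2 powr (q + 1) / d\<^sup>2 * \<delta> powr (q - p + 2))"
    using c by (subst ennreal_numeral[symmetric], subst ennreal_mult[symmetric]) (auto simp: c_def powr_add mult_ac)
  finally show ?thesis .
qed

lemma pointwise_energy_bound:
  "2 powr (- q) / 2 * (\<bar>\<tau> x - \<tau> y\<bar> powr q * K (x - y)) * indicator (ball 0 \<rho>) y * indicator (ball 0 \<rho>) x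
    \<le> diff_integrand (x, y) * W (x, y) + p\<^sup>2 * 2 powr q / 2 * near_error x y"
proof -
  let ?c = "2 powr (- ((p - 2) + (q - p) + 2)) :: real"
  define A B where "A = u (x + h) - u (y + h)" and "B = u x - u y"
  define a b where "a = \<tau> x" and "b = \<tau> y"
  define X where "X = (\<bar>A\<bar> + \<bar>B\<bar>) powr (p - 2) * (\<bar>a\<bar> + \<bar>b\<bar>) powr (q - p)"
  define w where "w = \<xi> x * \<xi> y"
  define I :: real where "I = indicator (ball 0 (\<rho> + 3 * d)) y * indicator (ball 0 (\<rho> + 3 * d)) x"
  have ceq: "?c = 2 powr (- q)" by simp
  have d1: "a - b = A - B" by (simp add: a_def b_def A_def B_def)
  have w: "0 \<le> w" "w \<le> I"
  proof -
    show "0 \<le> w" using W_bounds[of "(x, y)"] by (simp add: w_def)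
    have "w = 0" if "\<rho> + 3 * d \<le> norm x \<or> \<rho> + 3 * d \<le> norm y"
      using that cutoff_eq_0[of "\<rho> + 2 * d" "\<rho> + 3 * d" x] cutoff_eq_0[of "\<rho> + 2 * d" "\<rho> + 3 * d" y] d by (auto simp: w_def)
    then show "w \<le> I" using W_bounds[of "(x, y)"] by (cases "\<rho> + 3 * d \<le> norm x \<or> \<rho> + 3 * d \<le> norm y") (auto simp: I_def w_def not_le)
  qed
  define E where "E = X * (\<bar>a\<bar> + \<bar>b\<bar>)\<^sup>2 * (\<eta> x - \<eta> y)\<^sup>2"
  define G where "G = X * (a - b)\<^sup>2 * ((\<eta> x)\<^sup>2 + (\<eta> y)\<^sup>2)"
  have EG: "0 \<le> E" "0 \<le> G" "0 \<le> X" by (auto simp: E_def G_def X_def)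
  have key: "2 powr (- q) / 4 * G - p\<^sup>2 * 2 powr q / 2 * E \<le> (J A - J B) * (test x - test y)"
  proof -
    have "?c / 4 * G - (p - 2 + 2)\<^sup>2 / (2 * ?c) * E \<le> (J A - J B) * (signed_power (q - p) a * (\<eta> x)\<^sup>2 - signed_power (q - p) b * (\<eta> y)\<^sup>2)"
      unfolding G_def E_def X_def using p q d1 by (intro tested_monotonicity) auto
    moreover have "(p - 2 + 2)\<^sup>2 / (2 * ?c) = p\<^sup>2 * 2 powr q / 2" unfolding ceq by (simp add: powr_minus field_simps)
    moreover have "signed_power (q - p) a * (\<eta> x)\<^sup>2 - signed_power (q - p) b * (\<eta> y)\<^sup>2 = test x - test y"
      by (simp add: test_def a_def b_def mult.commute)
    ultimately show ?thesis unfolding ceq by (simp only:)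
  qed
  have Kn: "0 \<le> K (x - y)" by simp
  have "2 powr (- q) / 2 * (\<bar>\<tau> x - \<tau> y\<bar> powr q * K (x - y)) * indicator (ball 0 \<rho>) y * indicator (ball 0 \<rho>) x \<le> w * K (x - y) * (2 powr (- q) / 4 * G)"
  proof (cases "norm x < \<rho> \<and> norm y < \<rho>")
    case True
    then have 1: "\<eta> x = 1" "\<eta> y = 1" "w = 1" using d by (auto simp: w_def cutoff_eq_1)
    have "\<bar>a - b\<bar> powr q \<le> X * (a - b)\<^sup>2"
      unfolding X_def using p q by (intro powr_diff_le_product d1) auto
    then have "2 powr (- q) / 2 * K (x - y) * \<bar>a - b\<bar> powr q \<le> 2 powr (- q) / 2 * K (x - y) * (X * (a - b)\<^sup>2)"
      by (intro mult_left_mono) auto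
    then show ?thesis using True by (simp add: G_def 1 a_def b_def mult_ac)
  next
    case False
    then show ?thesis using w EG by auto
  qed
  also have "\<dots> \<le> w * K (x - y) * ((J A - J B) * (test x - test y) + p\<^sup>2 * 2 powr q / 2 * E)"
  proof (rule mult_left_mono)
    show "2 powr (- q) / 4 * G \<le> (J A - J B) * (test x - test y) + p\<^sup>2 * 2 powr q / 2 * E" using key by linarith
  qed (use w Kn in simp)
  also have "\<dots> = diff_integrand (x, y) * W (x, y) + w * (K (x - y) * (p\<^sup>2 * 2 powr q / 2 * E))"
    by (simp add: diff_integrand_def A_def B_def w_def algebra_simps)
  also have "\<dots> \<le> diff_integrand (x, y) * W (x, y) + I * (K (x - y) * (p\<^sup>2 * 2 powr q / 2 * E))"
    using w EG Kn by (intro add_left_mono mult_right_mono) auto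
  also have "I * (K (x - y) * (p\<^sup>2 * 2 powr q / 2 * E)) = p\<^sup>2 * 2 powr q / 2 * near_error x y"
    unfolding near_error_def E_def X_def A_def B_def a_def b_def I_def by (simp add: mult_ac)
  finally show ?thesis .
qed

text \<open>
  Integrating \<open>pointwise_energy_bound\<close>: the weighted integral of the equation is a far-field term
  by \<open>far_part_le\<close>, and the near error is controlled by \<open>near_part_le\<close>. The bound is explicit so that it
  visibly depends on \<open>u\<close> only through \<open>A1\<close> and \<open>A2\<close>, and on \<open>h\<close> only through \<open>\<delta>\<close>.
\<close>

lemma translated_energy_bound:
  fixes A1 A2 Q :: ennreal and \<delta> \<sigma> \<alpha> I :: real
  assumes I: "(\<integral>\<^sup>+z\<in>- ball (0::'a) (\<rho> + d). ennreal (norm z powr (- (real DIM('a) + s * p))) \<partial>lborel) \<le> ennreal I" and I0: "0 \<le> I"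
    and \<delta>: "0 < \<delta>" "norm h \<le> \<delta>" and \<alpha>: "\<alpha> * (q - p + 2) = q * (2 - s * p) + (p - 2) * \<sigma>"
    and A1: "kernel_energy \<sigma> q (ball 0 (\<rho> + 4 * d)) u \<le> A1"
    and A2: "translation_energy q (\<rho> + 3 * d) h u \<le> ennreal (\<delta> powr q) * A2"
    and Q: "(\<integral>\<^sup>+z\<in>ball (0::'a) (2 * (\<rho> + 3 * d)). ennreal (norm z powr (\<alpha> - real DIM('a))) \<partial>lborel) \<le> Q"
    and fin: "A1 < \<infinity>" "A2 < \<infinity>" "Q < \<infinity>"
  shows "kernel_energy (s * p) q (ball 0 \<rho>) \<tau> \<le> ennreal (\<delta> powr (q - p + 2)) *
     (ennreal (2 powr (q + 1)) * (ennreal (4 * far_const d (real DIM('a) + s * p) p I) * (emeasure lborel (ball (0::'a) (\<rho> + 3 * d)) + A2)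
       + ennreal (p\<^sup>2 * 2 powr q / 2 * (2 powr (q + 1) / d\<^sup>2)) * (A1 + Q * A2)))"
proof -
  let ?M = "lborel \<Otimes>\<^sub>M lborel :: ('a \<times> 'a) measure"
  define C1 where "C1 = p\<^sup>2 * 2 powr q / 2"
  define c where "c = 2 powr (- q) / 2"
  define C3 where "C3 = far_const d (real DIM('a) + s * p) p I"
  define Z where "Z = \<delta> powr (q - p + 2)"
  have C3: "0 \<le> C3" unfolding C3_def using d exponent_pos p I0 by (intro mult_nonneg_nonneg add_nonneg_nonneg) auto
  have C: "0 \<le> C1" "0 \<le> c" "0 \<le> Z" by (auto simp: C1_def c_def Z_def)
  define E where "E = (\<lambda>z. near_error (fst z) (snd z))"
  define L where "L = (\<lambda>x y. c * (\<bar>\<tau> x - \<tau> y\<bar> powr q * K (x - y)) * indicator (ball 0 \<rho>) y * indicator (ball 0 \<rho>) x)"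
  have Lm [measurable]: "(\<lambda>(x, y). L x y) \<in> borel_measurable (borel \<Otimes>\<^sub>M borel)" unfolding L_def by measurable
  have Lm2 [measurable]: "(\<lambda>z. L (fst z) (snd z)) \<in> borel_measurable ?M" unfolding L_def by measurable
  have Em [measurable]: "E \<in> borel_measurable ?M" unfolding E_def near_error_def by measurable
  have E0: "0 \<le> E z" for z by (simp add: E_def near_error_nonneg)
  have L0: "0 \<le> L x y" for x y using C by (simp add: L_def)
  have EN: "(\<integral>\<^sup>+z. ennreal (E z) \<partial>?M) \<le> ennreal (2 powr (q + 1) / d\<^sup>2 * Z) * (A1 + Q * A2)"
    using near_part_le[OF \<delta>(1) \<alpha> A1 A2 Q]
    by (subst lborel.nn_integral_fst[symmetric]) (auto simp: E_def Z_def)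
  also have "\<dots> < \<infinity>" using fin by (simp add: ennreal_mult_less_top)
  finally have Ei: "integrable ?M E" using E0 by (intro integrableI_bounded) auto
  have H: "integrable ?M diff_integrand"
    using difference_equation by (auto simp: has_bochner_integral_iff)
  have Hm [measurable]: "diff_integrand \<in> borel_measurable ?M" using H by (rule borel_measurable_integrable)
  note HW = integrable_diff_integrand_W
  have pt: "L (fst z) (snd z) \<le> diff_integrand z * W z + C1 * E z" for z
    using pointwise_energy_bound[of "fst z" "snd z"] unfolding L_def E_def C1_def c_def by simp
  have "ennreal c * kernel_energy (s * p) q (ball 0 \<rho>) \<tau> = (\<integral>\<^sup>+x. \<integral>\<^sup>+y. ennreal (L x y) \<partial>lborel \<partial>lborel)"
  proof -
    define e where "e = (\<lambda>x y. ennreal (\<bar>\<tau> x - \<tau> y\<bar> powr q * K (x - y)))"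
    have [measurable]: "(\<lambda>(x, y). e x y) \<in> borel_measurable (borel \<Otimes>\<^sub>M borel)" unfolding e_def by measurable
    have KE: "kernel_energy (s * p) q (ball 0 \<rho>) \<tau> = (\<integral>\<^sup>+x\<in>ball 0 \<rho>. (\<integral>\<^sup>+y\<in>ball 0 \<rho>. e x y \<partial>lborel) \<partial>lborel)"
      unfolding kernel_energy_def e_def ..
    have "ennreal (L x y) = ennreal c * (e x y * indicator (ball 0 \<rho>) y * indicator (ball 0 \<rho>) x)" for x y
      using C unfolding L_def e_def by (auto simp: ennreal_mult indicator_def)
    then show ?thesis unfolding KE by (simp add: nn_integral_cmult nn_integral_multc)
  qed
  also have "\<dots> = (\<integral>\<^sup>+z. ennreal (L (fst z) (snd z)) \<partial>?M)"
    by (subst lborel.nn_integral_fst[symmetric]) auto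
  also have "\<dots> \<le> (\<integral>\<^sup>+z. ennreal (diff_integrand z * W z + C1 * E z) \<partial>?M)"
    by (intro nn_integral_mono ennreal_leI pt)
  also have "\<dots> = ennreal (\<integral>z. diff_integrand z * W z + C1 * E z \<partial>?M)"
    using HW Ei by (intro nn_integral_eq_integral AE_I2 order_trans[OF L0 pt]) auto
  also have "(\<integral>z. diff_integrand z * W z + C1 * E z \<partial>?M) = (\<integral>z. diff_integrand z * W z \<partial>?M) + C1 * (\<integral>z. E z \<partial>?M)"
    using HW Ei by simp
  also have "ennreal \<dots> \<le> ennreal (\<bar>\<integral>z. diff_integrand z * W z \<partial>?M\<bar> + C1 * (\<integral>z. E z \<partial>?M))"
    by (intro ennreal_leI) auto
  also have "\<dots> = ennreal \<bar>\<integral>z. diff_integrand z * W z \<partial>?M\<bar> + ennreal C1 * (\<integral>\<^sup>+z. ennreal (E z) \<partial>?M)"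
    using C E0 Ei by (subst nn_integral_eq_integral) (auto simp: ennreal_mult ennreal_plus Bochner_Integration.integral_nonneg)
  also have "\<dots> \<le> ennreal (4 * C3 * Z) * (emeasure lborel (ball (0::'a) (\<rho> + 3 * d)) + A2) + ennreal C1 * (ennreal (2 powr (q + 1) / d\<^sup>2 * Z) * (A1 + Q * A2))"
    unfolding C3_def Z_def using EN unfolding Z_def
    by (intro add_mono mult_left_mono far_part_le[OF I I0 \<delta> A2]) auto
  also have "\<dots> = ennreal Z * (ennreal (4 * C3) * (emeasure lborel (ball (0::'a) (\<rho> + 3 * d)) + A2) + ennreal (C1 * (2 powr (q + 1) / d\<^sup>2)) * (A1 + Q * A2))"
  proof -
    have 1: "ennreal (4 * C3 * Z) = ennreal Z * ennreal (4 * C3)"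
      using C C3 by (simp add: ennreal_mult[symmetric] mult_ac)
    have 2: "ennreal C1 * ennreal (2 powr (q + 1) / d\<^sup>2 * Z) = ennreal Z * ennreal (C1 * (2 powr (q + 1) / d\<^sup>2))"
      using C by (simp add: ennreal_mult[symmetric] mult_ac)
    show ?thesis unfolding mult.assoc[symmetric, of "ennreal C1"] unfolding 1 2 by (simp only: distrib_left mult.assoc)
  qed
  finally have "ennreal (2 powr (q + 1)) * (ennreal c * kernel_energy (s * p) q (ball 0 \<rho>) \<tau>) \<le> ennreal (2 powr (q + 1)) *
     (ennreal Z * (ennreal (4 * C3) * (emeasure lborel (ball (0::'a) (\<rho> + 3 * d)) + A2) + ennreal (C1 * (2 powr (q + 1) / d\<^sup>2)) * (A1 + Q * A2)))"
    by (rule mult_left_mono) auto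
  also have "ennreal (2 powr (q + 1)) * (ennreal c * kernel_energy (s * p) q (ball 0 \<rho>) \<tau>) = kernel_energy (s * p) q (ball 0 \<rho>) \<tau>"
    unfolding mult.assoc[symmetric] c_def by (simp add: ennreal_mult[symmetric] powr_add powr_minus)
  finally show ?thesis unfolding C3_def C1_def Z_def by (simp add: mult_ac)
qed

end

section \<open>Improving the order of decay\<close>

text \<open>
  A uniform Besov--Nikolskii bound of order \<open>\<theta>\<close> in \<open>L\<^sup>q\<close>, on every ball inside the unit ball. The constant and the
  range of \<open>h\<close> may depend on the ball but not on the function in the family \<open>S\<close>.
\<close>

definition nikolskii :: "('a::euclidean_space \<Rightarrow> real) set \<Rightarrow> real \<Rightarrow> real \<Rightarrow> bool" where
  "nikolskii S \<theta> q \<longleftrightarrow> (\<forall>\<rho>. 0 < \<rho> \<and> \<rho> < 1 \<longrightarrow> (\<exists>C\<ge>0. \<exists>h0>0. \<forall>u\<in>S. \<forall>h. norm h < h0 \<longrightarrow>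
     translation_energy q \<rho> h u \<le> ennreal (C * norm h powr (\<theta> * q))))"

lemma nikolskiiE:
  assumes "nikolskii S \<theta> q" "0 < \<rho>" "\<rho> < 1"
  obtains C h0 where "0 \<le> C" "0 < h0"
    "\<And>u h. u \<in> S \<Longrightarrow> norm h < h0 \<Longrightarrow> translation_energy q \<rho> h u \<le> ennreal (C * norm h powr (\<theta> * q))"
proof -
  from assms(1)[unfolded nikolskii_def, THEN spec, THEN mp, OF conjI[OF assms(2,3)]]
  obtain C h0 where "0 \<le> C" "0 < h0" and *: "\<forall>u\<in>S. \<forall>h. norm h < h0 \<longrightarrow>
     translation_energy q \<rho> h u \<le> ennreal (C * norm h powr (\<theta> * q))"
    by (elim exE conjE)
  then show thesis by (intro that[OF _ _ *[THEN bspec, THEN spec, THEN mp]])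
qed

abbreviation normalized_solutions :: "real \<Rightarrow> real \<Rightarrow> ('a::euclidean_space \<Rightarrow> real) set" where
  "normalized_solutions s p \<equiv> {u. normalized_solution s p u}"

lemma normalized_solution_borel: "normalized_solution s p u \<Longrightarrow> u \<in> borel_measurable borel"
  unfolding normalized_solution_def by (elim conjE)

lemma normalized_solution_le_1: "normalized_solution s p u \<Longrightarrow> norm x < 1 \<Longrightarrow> \<bar>u x\<bar> \<le> 1"
  unfolding normalized_solution_def by (elim conjE) (drule bspec[of _ _ x], simp_all only: mem_ball dist_0_norm)

lemma nikolskii_antimono:
  assumes "nikolskii S \<theta> q" "\<theta>' \<le> \<theta>" "0 < q"
  shows "nikolskii S \<theta>' q"
  unfolding nikolskii_def
proof (intro allI impI)
  fix \<rho> :: real assume "0 < \<rho> \<and> \<rho> < 1"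
  then obtain C h0 where *: "0 \<le> C" "0 < h0"
    "\<And>u h. u \<in> S \<Longrightarrow> norm h < h0 \<Longrightarrow> translation_energy q \<rho> h u \<le> ennreal (C * norm h powr (\<theta> * q))"
    by (elim conjE) (rule nikolskiiE[OF assms(1)], assumption, assumption, rule that)
  show "\<exists>C\<ge>0. \<exists>h0>0. \<forall>u\<in>S. \<forall>h. norm h < h0 \<longrightarrow>
     translation_energy q \<rho> h u \<le> ennreal (C * norm h powr (\<theta>' * q))"
  proof (rule exI[of _ C], intro conjI exI[of _ "min h0 1"] ballI allI impI)
    fix u h assume u: "u \<in> S" and h: "norm (h::'a) < min h0 1"
    have "C * norm h powr (\<theta> * q) \<le> C * norm h powr (\<theta>' * q)"
      using h assms *(1) by (intro mult_left_mono powr_mono') auto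
    then show "translation_energy q \<rho> h u \<le> ennreal (C * norm h powr (\<theta>' * q))"
      using h by (intro order_trans[OF *(3)[OF u] ennreal_leI]) auto
  qed (use *(1,2) in auto)
qed

lemma nikolskii_start:
  assumes "2 < p" "0 < s"
  shows "nikolskii (normalized_solutions s p :: ('a::euclidean_space \<Rightarrow> real) set) s p"
  unfolding nikolskii_def
proof (intro allI impI)
  fix \<rho> :: real assume \<rho>: "0 < \<rho> \<and> \<rho> < 1"
  define C where "C = 2 powr (p + 1 + real DIM('a) + s * p) / unit_ball_vol (real DIM('a))"
  have C: "0 \<le> C" by (simp add: C_def)
  show "\<exists>C\<ge>0. \<exists>h0>0. \<forall>u\<in>normalized_solutions s p. \<forall>h::'a. norm h < h0 \<longrightarrow>
     translation_energy p \<rho> h u \<le> ennreal (C * norm h powr (s * p))"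
  proof (rule exI[of _ C], intro conjI exI[of _ "1 - \<rho>"] ballI allI impI)
    fix u :: "'a \<Rightarrow> real" and h :: 'a assume u: "u \<in> normalized_solutions s p" and h: "norm h < 1 - \<rho>"
    have "translation_energy p \<rho> h u \<le> ennreal (C * norm h powr (s * p)) * kernel_energy (s * p) p (ball 0 1) u"
      unfolding C_def using u h assms by (intro translation_difference_le_kernel_energy) (auto intro: normalized_solution_borel)
    also have "\<dots> \<le> ennreal (C * norm h powr (s * p)) * 1"
      using u by (intro mult_left_mono) (auto simp: normalized_solution_def)
    finally show "translation_energy p \<rho> h u \<le> ennreal (C * norm h powr (s * p))" by simp
  qed (use \<rho> C in auto)
qed

text \<open>
  Since \<open>|\<tau>\<^sub>h u| \<le> 2\<close>, its \<open>q1\<close>-th power is at most a constant times its \<open>q0\<close>-th power. The decay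
  \<open>|h|\<^bsup>\<theta> q0\<^esup>\<close> is kept, so the order in \<open>L\<^bsup>q1\<^esup>\<close> drops by the factor \<open>q0/q1\<close>.
\<close>

lemma nikolskii_raise_exponent:
  assumes N: "nikolskii (normalized_solutions s p :: ('a::euclidean_space \<Rightarrow> real) set) \<theta> q0" and q: "0 < q0" "q0 \<le> q1"
  shows "nikolskii (normalized_solutions s p :: ('a \<Rightarrow> real) set) (\<theta> * q0 / q1) q1"
  unfolding nikolskii_def
proof (intro allI impI)
  fix \<rho> :: real assume \<rho>: "0 < \<rho> \<and> \<rho> < 1"
  then obtain C h0 where *: "0 \<le> C" "0 < h0"
    "\<And>u h. u \<in> (normalized_solutions s p :: ('a \<Rightarrow> real) set) \<Longrightarrow> norm h < h0 \<Longrightarrow> translation_energy q0 \<rho> h u \<le> ennreal (C * norm h powr (\<theta> * q0))"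
    by (elim conjE) (rule nikolskiiE[OF N], assumption, assumption, rule that)
  show "\<exists>C\<ge>0. \<exists>h0>0. \<forall>u\<in>normalized_solutions s p. \<forall>h::'a. norm h < h0 \<longrightarrow>
     translation_energy q1 \<rho> h u \<le> ennreal (C * norm h powr (\<theta> * q0 / q1 * q1))"
  proof (rule exI[of _ "2 powr (q1 - q0) * C"], intro conjI exI[of _ "min h0 (1 - \<rho>)"] ballI allI impI)
    fix u :: "'a \<Rightarrow> real" and h :: 'a assume u: "u \<in> normalized_solutions s p" and h: "norm h < min h0 (1 - \<rho>)"
    have [measurable]: "u \<in> borel_measurable borel" using u by (auto intro: normalized_solution_borel)
    have "translation_energy q1 \<rho> h u
       \<le> (\<integral>\<^sup>+x. ennreal (2 powr (q1 - q0)) * (ennreal (\<bar>u (x + h) - u x\<bar> powr q0) * indicator (ball 0 \<rho>) x) \<partial>lborel)"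
    proof (rule nn_integral_mono)
      fix x :: 'a
      show "ennreal (\<bar>u (x + h) - u x\<bar> powr q1) * indicator (ball 0 \<rho>) x \<le> ennreal (2 powr (q1 - q0)) * (ennreal (\<bar>u (x + h) - u x\<bar> powr q0) * indicator (ball 0 \<rho>) x)"
      proof (cases "norm x < \<rho>")
        case True
        have "norm (x + h) < 1" using True h norm_triangle_ineq[of x h] by auto
        then have "\<bar>u (x + h)\<bar> \<le> 1" "\<bar>u x\<bar> \<le> 1" using normalized_solution_le_1[of s p u] u True \<rho> by auto
        then have 2: "\<bar>u (x + h) - u x\<bar> \<le> 2" by linarith
        have "\<bar>u (x + h) - u x\<bar> powr q1 = \<bar>u (x + h) - u x\<bar> powr (q1 - q0) * \<bar>u (x + h) - u x\<bar> powr q0"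
          by (simp add: powr_add[symmetric])
        also have "\<dots> \<le> 2 powr (q1 - q0) * \<bar>u (x + h) - u x\<bar> powr q0"
          using 2 q by (intro mult_right_mono powr_mono2) auto
        finally show ?thesis using True by (simp add: ennreal_mult[symmetric] ennreal_leI)
      qed simp
    qed
    also have "\<dots> = ennreal (2 powr (q1 - q0)) * translation_energy q0 \<rho> h u"
      by (rule nn_integral_cmult) measurable
    also have "\<dots> \<le> ennreal (2 powr (q1 - q0)) * ennreal (C * norm h powr (\<theta> * q0))"
      using h by (intro mult_left_mono *(3)[OF u]) auto
    also have "\<dots> = ennreal (2 powr (q1 - q0) * C * norm h powr (\<theta> * q0 / q1 * q1))"
      using *(1) q by (simp add: ennreal_mult[symmetric] mult.assoc)
    finally show "translation_energy q1 \<rho> h u \<le> ennreal (2 powr (q1 - q0) * C * norm h powr (\<theta> * q0 / q1 * q1))" .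
  qed (use *(1,2) \<rho> in auto)
qed

text \<open>
  One turn of the iteration. The energy estimate makes \<open>\<tau>\<^sub>h u\<close> small in an energy of order \<open>sp\<close>; this
  bounds second differences, and these bound first differences.
\<close>

lemma nikolskii_step:
  fixes s p q \<theta> :: real
  defines "\<theta>' \<equiv> (s * p + \<theta> * (q - p + 2)) / q"
  assumes p: "2 < p" and s: "0 < s" "s < 1" and q: "p \<le> q" and \<theta>: "0 < \<theta>" "\<theta> \<le> 1" "s * p - 2 < \<theta> * (p - 2)"
    and \<theta>': "\<theta>' < 1"
    and N: "nikolskii (normalized_solutions s p :: ('a::euclidean_space \<Rightarrow> real) set) \<theta> q"
  shows "nikolskii (normalized_solutions s p :: ('a \<Rightarrow> real) set) \<theta>' q"
  unfolding nikolskii_def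
proof (intro allI impI)
  fix \<rho>0 :: real assume \<rho>0: "0 < \<rho>0 \<and> \<rho>0 < 1"
  let ?N = "real DIM('a)" let ?S = "normalized_solutions s p :: ('a \<Rightarrow> real) set"
  \<comment> \<open>Six layers: one for the step from the energy to second differences, five for \<open>translated_test\<close>.\<close>
  define d where "d = (1 - \<rho>0) / 6"
  define \<rho> where "\<rho> = \<rho>0 + d"
  have d: "0 < d" "\<rho> + 5 * d = 1" "0 < \<rho>" using \<rho>0 by (auto simp: d_def \<rho>_def field_simps)
  have q0: "0 < q" using p q by linarith
  \<comment> \<open>A positive order strictly between \<open>(sp-2)/(p-2)\<close> and \<open>\<theta>\<close>: below \<open>\<theta>\<close>, the energy of \<open>u\<close> is finite, and above the other bound, \<open>\<alpha>\<close> is positive.\<close>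
  define \<theta>2 where "\<theta>2 = max (\<theta> / 2) ((\<theta> + (s * p - 2) / (p - 2)) / 2)"
  have sp: "(s * p - 2) / (p - 2) < \<theta>" using \<theta> p by (simp add: field_simps)
  have \<theta>2: "0 < \<theta>2" "\<theta>2 < \<theta>" using sp \<theta> by (auto simp: \<theta>2_def)
  have \<theta>2': "s * p - 2 < \<theta>2 * (p - 2)"
  proof -
    have "x < (\<theta> + x) / 2" if "x < \<theta>" for x :: real using that by simp
    from this[OF sp] have "(s * p - 2) / (p - 2) < \<theta>2" unfolding \<theta>2_def by (rule order.strict_trans2) simp
    then show ?thesis using p by (simp add: field_simps)
  qed
  define \<sigma> where "\<sigma> = \<theta>2 * q"
  define \<alpha> where "\<alpha> = (q * (2 - s * p) + (p - 2) * \<sigma>) / (q - p + 2)"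
  have qp: "0 < q - p + 2" using q by simp
  have \<alpha>: "\<alpha> * (q - p + 2) = q * (2 - s * p) + (p - 2) * \<sigma>" using qp by (simp add: \<alpha>_def)
  have \<alpha>0: "0 < \<alpha>"
  proof -
    have "0 < q * (\<theta>2 * (p - 2) - (s * p - 2))" using \<theta>2' q0 by (intro mult_pos_pos) auto
    then show ?thesis unfolding \<alpha>_def \<sigma>_def using qp by (intro divide_pos_pos) (auto simp: algebra_simps)
  qed
  have R4: "0 < \<rho> + 4 * d" "\<rho> + 4 * d < 1" and R3: "0 < \<rho> + 3 * d" "\<rho> + 3 * d < 1" using d by auto
  obtain Ca ha where a: "0 \<le> Ca" "0 < ha" "\<And>u h. u \<in> ?S \<Longrightarrow> norm h < ha \<Longrightarrow> translation_energy q (\<rho> + 4 * d) h u \<le> ennreal (Ca * norm h powr (\<theta> * q))"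
    by (rule nikolskiiE[OF N R4], rule that)
  obtain Cb hb where b: "0 \<le> Cb" "0 < hb" "\<And>u h. u \<in> ?S \<Longrightarrow> norm h < hb \<Longrightarrow> translation_energy q (\<rho> + 3 * d) h u \<le> ennreal (Cb * norm h powr (\<theta> * q))"
    by (rule nikolskiiE[OF N R3], rule that)
  have "\<exists>M\<ge>0. \<forall>w :: 'a \<Rightarrow> real. w \<in> borel_measurable borel \<longrightarrow>
     (\<forall>x\<in>ball 0 (\<rho> + 4 * d). \<bar>w x\<bar> \<le> 1) \<longrightarrow>
     (\<forall>h. norm h < ha \<longrightarrow> translation_energy q (\<rho> + 4 * d) h w \<le> ennreal (Ca * norm h powr (\<theta> * q))) \<longrightarrow>
     kernel_energy \<sigma> q (ball 0 (\<rho> + 4 * d)) w \<le> ennreal M"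
    using \<theta>2 q0 R4 a(1,2) by (intro kernel_energy_le_of_translations) (auto simp: \<sigma>_def)
  then obtain A1 where A1: "0 \<le> A1" "\<forall>w :: 'a \<Rightarrow> real. w \<in> borel_measurable borel \<longrightarrow>
     (\<forall>x\<in>ball 0 (\<rho> + 4 * d). \<bar>w x\<bar> \<le> 1) \<longrightarrow>
     (\<forall>h. norm h < ha \<longrightarrow> translation_energy q (\<rho> + 4 * d) h w \<le> ennreal (Ca * norm h powr (\<theta> * q))) \<longrightarrow>
     kernel_energy \<sigma> q (ball 0 (\<rho> + 4 * d)) w \<le> ennreal A1" by (elim exE conjE) (rule that)
  define Q where "Q = (\<integral>\<^sup>+z\<in>ball (0::'a) (2 * (\<rho> + 3 * d)). ennreal (norm z powr (\<alpha> - ?N)) \<partial>lborel)"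
  have Q: "Q < \<infinity>" unfolding Q_def by (rule nn_integral_norm_powr_ball) (use \<alpha>0 R3 in auto)
  define I where "I = enn2real (\<integral>\<^sup>+z\<in>- ball (0::'a) (\<rho> + d). ennreal (norm z powr (- (?N + s * p))) \<partial>lborel)"
  have "(\<integral>\<^sup>+z\<in>- ball (0::'a) (\<rho> + d). ennreal (norm z powr (- (?N + s * p))) \<partial>lborel) < \<infinity>"
    by (rule nn_integral_norm_powr_outside_ball) (use s p d in auto)
  then have I: "(\<integral>\<^sup>+z\<in>- ball (0::'a) (\<rho> + d). ennreal (norm z powr (- (?N + s * p))) \<partial>lborel) \<le> ennreal I"
    unfolding I_def by (simp add: less_top)
  have I0: "0 \<le> I" by (simp add: I_def)
  define B where "B = ennreal (2 powr (q + 1)) * (ennreal (4 * far_const d (?N + s * p) p I) * (emeasure lborel (ball (0::'a) (\<rho> + 3 * d)) + ennreal Cb)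
       + ennreal (p\<^sup>2 * 2 powr q / 2 * (2 powr (q + 1) / d\<^sup>2)) * (ennreal A1 + Q * ennreal Cb))"
  have B: "B < \<infinity>" unfolding B_def using Q R3 by (simp add: ennreal_mult_less_top emeasure_ball)
  define Br where "Br = enn2real B"
  have Br: "0 \<le> Br" "B = ennreal Br" using B by (auto simp: Br_def less_top)
  define C' where "C' = 2 powr (q + 1 + ?N + s * p) / unit_ball_vol ?N"
  have C': "0 \<le> C'" by (simp add: C'_def)
  define h0 where "h0 = min (min (d\<^sup>2) 1) (min ha hb)"
  have h0: "0 < h0" using d a(2) b(2) by (simp add: h0_def)
  have d1: "d < 1" using d by linarith
  have dd: "d\<^sup>2 \<le> d" using d d1 by (simp add: power2_eq_square)
  have second: "(\<integral>\<^sup>+x\<in>ball 0 \<rho>0. ennreal (\<bar>u (x + 2 *\<^sub>R h) - 2 * u (x + h) + u x\<bar> powr q) \<partial>lborel) \<le> ennreal (C' * Br * norm h powr (\<theta>' * q))"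
    if uS: "u \<in> ?S" and hh: "norm h < h0" for u h
  proof (cases "h = 0")
    case False
    have ub [measurable]: "u \<in> borel_measurable borel" using uS by (auto intro: normalized_solution_borel)
    interpret translated_test s p q \<rho> d u h
      by unfold_locales (use p s q d uS hh in \<open>auto simp: h0_def\<close>)
    let ?\<tau> = "\<lambda>x. u (x + h) - u x"
    define \<delta> where "\<delta> = norm h powr \<theta>"
    have \<delta>: "0 < \<delta>" using False by (simp add: \<delta>_def)
    have \<delta>h: "norm h \<le> \<delta>"
    proof -
      have "norm h powr 1 \<le> norm h powr \<theta>" using hh \<theta> by (intro powr_mono') (auto simp: h0_def)
      then show ?thesis using False by (simp add: \<delta>_def)
    qed
    have \<delta>q: "\<delta> powr q = norm h powr (\<theta> * q)" by (simp add: \<delta>_def powr_powr)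
    have KE: "kernel_energy (s * p) q (ball 0 \<rho>) ?\<tau> \<le> ennreal (\<delta> powr (q - p + 2)) * B"
      unfolding B_def
    proof (rule translated_energy_bound[OF I I0 \<delta> \<delta>h \<alpha>])
      show "kernel_energy \<sigma> q (ball 0 (\<rho> + 4 * d)) u \<le> ennreal A1"
      proof (rule A1(2)[THEN spec, THEN mp, THEN mp, THEN mp])
        show "\<forall>x\<in>ball 0 (\<rho> + 4 * d). \<bar>u x\<bar> \<le> 1"
          using uS R4 normalized_solution_le_1[of s p u] by auto
      qed (use ub a(3)[OF uS] in auto)
      show "translation_energy q (\<rho> + 3 * d) h u \<le> ennreal (\<delta> powr q) * ennreal Cb"
        using b(3)[OF uS, of h] b(1) hh unfolding \<delta>q by (simp add: ennreal_mult[symmetric] mult.commute h0_def)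
    qed (use Q in \<open>auto simp: Q_def\<close>)
    have "(\<integral>\<^sup>+x\<in>ball 0 \<rho>0. ennreal (\<bar>u (x + 2 *\<^sub>R h) - 2 * u (x + h) + u x\<bar> powr q) \<partial>lborel)
       = (\<integral>\<^sup>+x\<in>ball 0 \<rho>0. ennreal (\<bar>?\<tau> (x + h) - ?\<tau> x\<bar> powr q) \<partial>lborel)"
      by (intro nn_integral_cong) (simp add: scaleR_2 add.assoc algebra_simps)
    also have "\<dots> \<le> ennreal (C' * norm h powr (s * p)) * kernel_energy (s * p) q (ball 0 \<rho>) ?\<tau>"
      unfolding C'_def using q0 s p hh dd
      by (intro translation_difference_le_kernel_energy) (auto simp: \<rho>_def h0_def)
    also have "\<dots> \<le> ennreal (C' * norm h powr (s * p)) * (ennreal (\<delta> powr (q - p + 2)) * B)"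
      by (intro mult_left_mono KE) auto
    also have "\<dots> = ennreal (C' * Br * (norm h powr (s * p) * norm h powr (\<theta> * (q - p + 2))))"
      unfolding Br(2) using C' Br(1) by (simp add: ennreal_mult[symmetric] \<delta>_def powr_powr mult_ac)
    also have "norm h powr (s * p) * norm h powr (\<theta> * (q - p + 2)) = norm h powr (\<theta>' * q)"
      using q0 by (simp add: \<theta>'_def powr_add[symmetric])
    finally show ?thesis .
  qed (use q0 in simp)
  define K where "K = enn2real (ennreal (2 powr q) * emeasure lborel (ball (0::'a) \<rho>0))"
  have K: "ennreal K = ennreal (2 powr q) * emeasure lborel (ball (0::'a) \<rho>0)"
  proof -
    have "ennreal (2 powr q) * emeasure lborel (ball (0::'a) \<rho>0) < \<infinity>"
      using \<rho>0 by (simp add: ennreal_mult_less_top emeasure_ball)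
    then show ?thesis by (simp add: K_def less_top)
  qed
  have first: "translation_energy q \<rho>0 h u \<le> ennreal K"
    if u: "u \<in> ?S" and h: "norm h < h0" for u h
  proof -
    have "translation_energy q \<rho>0 h u \<le> (\<integral>\<^sup>+x. ennreal (2 powr q) * indicator (ball 0 \<rho>0) (x::'a) \<partial>lborel)"
    proof (rule nn_integral_mono)
      fix x :: 'a
      show "ennreal (\<bar>u (x + h) - u x\<bar> powr q) * indicator (ball 0 \<rho>0) x \<le> ennreal (2 powr q) * indicator (ball 0 \<rho>0) x"
      proof (cases "norm x < \<rho>0")
        case True
        have hd: "norm h < d" using h dd unfolding h0_def by simp
        have "norm (x + h) < 1" using True hd d \<rho>0 norm_triangle_ineq[of x h] unfolding \<rho>_def by linarith
        then have "\<bar>u (x + h)\<bar> \<le> 1" "\<bar>u x\<bar> \<le> 1" using normalized_solution_le_1[of s p u] u True \<rho>0 by auto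
        then have "\<bar>u (x + h) - u x\<bar> powr q \<le> 2 powr q" using q0 by (intro powr_mono2) auto
        then show ?thesis using True by (simp add: ennreal_leI)
      qed simp
    qed
    then show ?thesis unfolding K by (simp add: nn_integral_cmult_indicator)
  qed
  have "\<exists>M\<ge>0. \<forall>w :: 'a \<Rightarrow> real. w \<in> borel_measurable borel \<longrightarrow>
     (\<forall>h. norm h < h0 \<longrightarrow> (\<integral>\<^sup>+x\<in>ball 0 \<rho>0. ennreal (\<bar>w (x + 2 *\<^sub>R h) - 2 * w (x + h) + w x\<bar> powr q) \<partial>lborel) \<le> ennreal (C' * Br * norm h powr (\<theta>' * q))) \<longrightarrow>
     (\<forall>h. norm h < h0 \<longrightarrow> translation_energy q \<rho>0 h w \<le> ennreal K) \<longrightarrow>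
     (\<forall>h. norm h < h0 \<longrightarrow> translation_energy q \<rho>0 h w \<le> ennreal (M * norm h powr (\<theta>' * q)))"
    using \<theta>' q0 h0 C' Br by (intro first_difference_le_of_second) (auto simp: K_def)
  then obtain M where M: "0 \<le> M" "\<forall>w :: 'a \<Rightarrow> real. w \<in> borel_measurable borel \<longrightarrow>
     (\<forall>h. norm h < h0 \<longrightarrow> (\<integral>\<^sup>+x\<in>ball 0 \<rho>0. ennreal (\<bar>w (x + 2 *\<^sub>R h) - 2 * w (x + h) + w x\<bar> powr q) \<partial>lborel) \<le> ennreal (C' * Br * norm h powr (\<theta>' * q))) \<longrightarrow>
     (\<forall>h. norm h < h0 \<longrightarrow> translation_energy q \<rho>0 h w \<le> ennreal K) \<longrightarrow>
     (\<forall>h. norm h < h0 \<longrightarrow> translation_energy q \<rho>0 h w \<le> ennreal (M * norm h powr (\<theta>' * q)))"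
    by (elim exE conjE) (rule that)
  show "\<exists>C\<ge>0. \<exists>h0>0. \<forall>u\<in>?S. \<forall>h. norm h < h0 \<longrightarrow>
     translation_energy q \<rho>0 h u \<le> ennreal (C * norm h powr (\<theta>' * q))"
  proof (rule exI[of _ M], intro conjI exI[of _ h0] ballI M(1) h0)
    fix u assume u: "u \<in> ?S"
    show "\<forall>h. norm h < h0 \<longrightarrow> translation_energy q \<rho>0 h u \<le> ennreal (M * norm h powr (\<theta>' * q))"
      by (rule M(2)[THEN spec, THEN mp, THEN mp, THEN mp])
        (use u second[OF u] first[OF u] in \<open>auto intro: normalized_solution_borel\<close>)
  qed
qed

text \<open>
  The distance to \<open>\<Theta>\<close> shrinks by the factor \<open>r = (q-p+2)/q < 1\<close> in each step, and the orders increase,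
  so the side condition of \<open>nikolskii_step\<close> persists.
\<close>

lemma nikolskii_iterate:
  fixes s p q \<mu> \<theta> :: real
  defines "\<Theta> \<equiv> s * p / (p - 2)"
  assumes p: "2 < p" and s: "0 < s" "s < 1" and q: "p \<le> q" and \<Theta>: "\<Theta> \<le> 1"
    and \<mu>: "0 < \<mu>" "\<mu> < \<Theta>" "s * p - 2 < \<mu> * (p - 2)" and \<theta>: "\<theta> < \<Theta>"
    and N: "nikolskii (normalized_solutions s p :: ('a::euclidean_space \<Rightarrow> real) set) \<mu> q"
  shows "nikolskii (normalized_solutions s p :: ('a \<Rightarrow> real) set) \<theta> q"
proof -
  define r where "r = (q - p + 2) / q"
  have q0: "0 < q" using p q by linarith
  have r: "0 < r" "r < 1" using p q q0 by (auto simp: r_def)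
  define t where "t = (\<lambda>k::nat. \<Theta> - r ^ k * (\<Theta> - \<mu>))"
  have t: "\<mu> \<le> t k" "t k < \<Theta>" for k
  proof -
    have "r ^ k * (\<Theta> - \<mu>) \<le> 1 * (\<Theta> - \<mu>)" using r \<mu> by (intro mult_right_mono) (auto simp: power_le_one)
    then show "\<mu> \<le> t k" by (simp add: t_def)
    show "t k < \<Theta>" using r \<mu> by (simp add: t_def)
  qed
  have "nikolskii (normalized_solutions s p :: ('a \<Rightarrow> real) set) (t k) q" for k
  proof (induction k)
    case 0
    then show ?case using N by (simp add: t_def)
  next
    case (Suc k)
    have sp: "s * p = \<Theta> * (p - 2)" using p by (simp add: \<Theta>_def)
    have eq: "(s * p + t k * (q - p + 2)) / q = t (Suc k)"
    proof -
      have rq: "q - p + 2 = r * q" using q0 by (simp add: r_def)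
      then have "p - 2 = q - r * q" by simp
      then have "s * p + t k * (q - p + 2) = \<Theta> * (q - r * q) + t k * (r * q)" unfolding sp rq by simp
      also have "\<dots> = t (Suc k) * q" by (simp add: t_def algebra_simps)
      finally show ?thesis using q0 by simp
    qed
    have "\<mu> * (p - 2) \<le> t k * (p - 2)" using t(1)[of k] p by (intro mult_right_mono) auto
    then have "nikolskii (normalized_solutions s p :: ('a \<Rightarrow> real) set) ((s * p + t k * (q - p + 2)) / q) q"
      using t[of k] t[of "Suc k"] \<mu> \<Theta> by (intro nikolskii_step p s q Suc.IH) (auto simp: eq)
    then show ?case by (simp add: eq)
  qed
  moreover obtain k where "\<theta> \<le> t k"
  proof -
    have "(\<lambda>k. r ^ k * (\<Theta> - \<mu>)) \<longlonglongrightarrow> 0 * (\<Theta> - \<mu>)"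
      using r by (intro tendsto_mult LIMSEQ_realpow_zero tendsto_const) auto
    then have "eventually (\<lambda>k. r ^ k * (\<Theta> - \<mu>) < \<Theta> - \<theta>) sequentially"
      using \<theta> by (intro order_tendstoD) auto
    then obtain k where "r ^ k * (\<Theta> - \<mu>) < \<Theta> - \<theta>" by (auto simp: eventually_sequentially)
    then show ?thesis by (intro that[of k]) (simp add: t_def)
  qed
  ultimately show ?thesis using nikolskii_antimono q0 by blast
qed

text \<open>
  Induction on the number of factors \<open>\<kappa> = 1 + 1/(sp)\<close> needed to get from \<open>p\<close> to \<open>q\<close>. Raising the exponent by
  the factor \<open>\<kappa>\<close> lowers the order to nearly \<open>\<Theta>/\<kappa>\<close>, and \<open>(p-2)\<Theta>/\<kappa> = sp/\<kappa> > sp-2\<close> is what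
  \<open>nikolskii_iterate\<close> needs in order to recover all orders below \<open>\<Theta>\<close>.
\<close>

lemma nikolskii_all_exponents:
  fixes s p q \<theta> :: real
  defines "\<Theta> \<equiv> s * p / (p - 2)"
  assumes p: "2 < p" and s: "0 < s" "s < 1" and \<Theta>: "\<Theta> \<le> 1"
    and q: "p \<le> q" and \<theta>: "\<theta> < \<Theta>"
  shows "nikolskii (normalized_solutions s p :: ('a::euclidean_space \<Rightarrow> real) set) \<theta> q"
proof -
  let ?S = "normalized_solutions s p :: ('a \<Rightarrow> real) set"
  define \<kappa> where "\<kappa> = 1 + 1 / (s * p)"
  have sp0: "0 < s * p" using s p by simp
  have \<kappa>: "1 < \<kappa>" using sp0 by (simp add: \<kappa>_def)
  have spT: "s * p = \<Theta> * (p - 2)" using p by (simp add: \<Theta>_def)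
  have \<Theta>0: "0 < \<Theta>" using s p by (simp add: \<Theta>_def)
  have claim: "\<forall>q \<theta>. p \<le> q \<and> q \<le> p * \<kappa> ^ k \<and> \<theta> < \<Theta> \<longrightarrow> nikolskii ?S \<theta> q" for k
  proof (induction k)
    case 0
    have "nikolskii ?S \<theta> p" if "\<theta> < \<Theta>" for \<theta>
    proof (rule nikolskii_iterate[where \<mu> = s])
      show "nikolskii ?S s p" by (rule nikolskii_start[OF p s(1)])
      show "s < s * p / (p - 2)" using s p by (simp add: field_simps)
      show "s * p - 2 < s * (p - 2)" using s by (simp add: algebra_simps)
    qed (use that p s \<Theta> in \<open>auto simp: \<Theta>_def\<close>)
    then show ?case by auto
  next
    case (Suc k)
    show ?case
    proof (intro allI impI)
      fix q \<theta> assume A: "p \<le> q \<and> q \<le> p * \<kappa> ^ Suc k \<and> \<theta> < \<Theta>"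
      define q0 where "q0 = max p (q / \<kappa>)"
      have q0: "p \<le> q0" "q0 \<le> q" "q0 \<le> p * \<kappa> ^ k" "q \<le> \<kappa> * q0"
      proof -
        show "p \<le> q0" by (simp add: q0_def)
        have "q / \<kappa> \<le> q / 1" using \<kappa> A p by (intro divide_left_mono) auto
        then show "q0 \<le> q" using A by (simp add: q0_def)
        have "p * 1 \<le> p * \<kappa> ^ k" using \<kappa> p by (intro mult_left_mono one_le_power) auto
        moreover have "q / \<kappa> \<le> p * \<kappa> ^ k" using A \<kappa> by (simp add: field_simps)
        ultimately show "q0 \<le> p * \<kappa> ^ k" by (simp add: q0_def)
        have "\<kappa> * (q / \<kappa>) \<le> \<kappa> * q0" using \<kappa> by (intro mult_left_mono) (auto simp: q0_def)
        then show "q \<le> \<kappa> * q0" using \<kappa> by simp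
      qed
      have pos: "0 < q0" "0 < q" using q0 p by linarith+
      define t where "t = q0 / q"
      have t: "0 < t" "t \<le> 1" "1 / \<kappa> \<le> t" using q0 pos \<kappa> by (auto simp: t_def field_simps)
      have "s * p - 2 < s * p * t"
      proof -
        have "(s * p - 2) * \<kappa> < s * p"
          using sp0 unfolding \<kappa>_def by (simp add: field_simps)
        then have "s * p - 2 < s * p * (1 / \<kappa>)" using \<kappa> by (simp add: field_simps)
        also have "\<dots> \<le> s * p * t" using t sp0 by (intro mult_left_mono) auto
        finally show ?thesis .
      qed
      then have "(s * p - 2) / ((p - 2) * t) < \<Theta>" using p t unfolding spT by (simp add: field_simps)
      then obtain \<theta>1 where \<theta>1: "max 0 ((s * p - 2) / ((p - 2) * t)) < \<theta>1" "\<theta>1 < \<Theta>"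
        using dense[of "max 0 ((s * p - 2) / ((p - 2) * t))" \<Theta>] \<Theta>0 by auto
      have "nikolskii ?S \<theta>1 q0" using Suc.IH q0 \<theta>1 by blast
      then have "nikolskii ?S (\<theta>1 * q0 / q) q" using pos q0 by (intro nikolskii_raise_exponent)
      then have N: "nikolskii ?S (\<theta>1 * t) q" by (simp add: t_def)
      show "nikolskii ?S \<theta> q"
      proof (rule nikolskii_iterate[OF p s _ _ _ _ _ _ N])
        show "0 < \<theta>1 * t" using \<theta>1 t by simp
        have "\<theta>1 * t \<le> \<theta>1 * 1" using \<theta>1 t by (intro mult_left_mono) auto
        then show "\<theta>1 * t < s * p / (p - 2)" using \<theta>1 unfolding \<Theta>_def by linarith
        have "(s * p - 2) / ((p - 2) * t) < \<theta>1" using \<theta>1 by simp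
        then show "s * p - 2 < \<theta>1 * t * (p - 2)" using p t by (simp add: field_simps)
      qed (use A \<Theta> in \<open>auto simp: \<Theta>_def\<close>)
    qed
  qed
  obtain k where "q / p < \<kappa> ^ k" using real_arch_pow[OF \<kappa>] by blast
  then have "q \<le> p * \<kappa> ^ k" using p by (simp add: field_simps)
  then show ?thesis using claim q \<theta> by blast
qed

lemma normalized_energy_bound:
  fixes s p q \<gamma> \<rho> :: real
  assumes p: "2 < p" and s: "0 < s" "s \<le> (p - 2) / p"
    and q: "p \<le> q" and \<gamma>: "0 < \<gamma>" "\<gamma> < s * p / (p - 2)" and \<rho>: "0 < \<rho>" "\<rho> < 1"
  shows "\<exists>M\<ge>0. \<forall>u :: 'a::euclidean_space \<Rightarrow> real. normalized_solution s p u \<longrightarrow> kernel_energy (\<gamma> * q) q (ball 0 \<rho>) u \<le> ennreal M"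
proof -
  have q0: "0 < q" using p q by linarith
  have "(p - 2) / p < 1" using p by simp
  then have s1: "s < 1" using s by linarith
  have \<Theta>: "s * p / (p - 2) \<le> 1" using p s by (simp add: field_simps)
  obtain \<theta> where \<theta>: "\<gamma> < \<theta>" "\<theta> < s * p / (p - 2)" using dense \<gamma> by blast
  have N: "nikolskii (normalized_solutions s p :: ('a \<Rightarrow> real) set) \<theta> q"
    by (rule nikolskii_all_exponents[OF p s(1) s1 \<Theta> q \<theta>(2)])
  obtain C h0 where C: "0 \<le> C" "0 < h0" "\<And>u h. u \<in> (normalized_solutions s p :: ('a \<Rightarrow> real) set) \<Longrightarrow> norm h < h0 \<Longrightarrow> translation_energy q \<rho> h u \<le> ennreal (C * norm h powr (\<theta> * q))"
    by (rule nikolskiiE[OF N \<rho>], rule that)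
  have "\<exists>M\<ge>0. \<forall>w :: 'a \<Rightarrow> real. w \<in> borel_measurable borel \<longrightarrow>
     (\<forall>x\<in>ball 0 \<rho>. \<bar>w x\<bar> \<le> 1) \<longrightarrow>
     (\<forall>h. norm h < h0 \<longrightarrow> translation_energy q \<rho> h w \<le> ennreal (C * norm h powr (\<theta> * q))) \<longrightarrow>
     kernel_energy (\<gamma> * q) q (ball 0 \<rho>) w \<le> ennreal M"
    using \<gamma> \<theta> q0 C(1,2) \<rho> by (intro kernel_energy_le_of_translations) auto
  then obtain M where M: "0 \<le> M" "\<forall>w :: 'a \<Rightarrow> real. w \<in> borel_measurable borel \<longrightarrow>
     (\<forall>x\<in>ball 0 \<rho>. \<bar>w x\<bar> \<le> 1) \<longrightarrow>
     (\<forall>h. norm h < h0 \<longrightarrow> translation_energy q \<rho> h w \<le> ennreal (C * norm h powr (\<theta> * q))) \<longrightarrow>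
     kernel_energy (\<gamma> * q) q (ball 0 \<rho>) w \<le> ennreal M" by (elim exE conjE) (rule that)
  show ?thesis
  proof (rule exI[of _ M], intro conjI M(1) allI impI)
    fix u :: "'a \<Rightarrow> real" assume u: "normalized_solution s p u"
    show "kernel_energy (\<gamma> * q) q (ball 0 \<rho>) u \<le> ennreal M"
    proof (rule M(2)[THEN spec, THEN mp, THEN mp, THEN mp])
      show "\<forall>x\<in>ball 0 \<rho>. \<bar>u x\<bar> \<le> 1" using normalized_solution_le_1[OF u] \<rho> by auto
    qed (use normalized_solution_borel[OF u] C(3)[of u] u in auto)
  qed
qed

section \<open>Scaling to the unit ball\<close>

lemma enn_powr_le_iff:
  assumes "0 < q" "0 \<le> c"
  shows "enn_powr x (1 / q) \<le> ennreal c \<longleftrightarrow> x \<le> ennreal (c powr q)"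
proof (cases x)
  case (real r)
  have "r powr (1 / q) \<le> c \<longleftrightarrow> r \<le> c powr q"
  proof
    assume "r powr (1 / q) \<le> c"
    then have "(r powr (1 / q)) powr q \<le> c powr q" using assms by (intro powr_mono2) auto
    then show "r \<le> c powr q" using assms real by (simp add: powr_powr)
  next
    assume "r \<le> c powr q"
    then have "r powr (1 / q) \<le> (c powr q) powr (1 / q)" using assms real by (intro powr_mono2) auto
    then show "r powr (1 / q) \<le> c" using assms by (simp add: powr_powr)
  qed
  then show ?thesis using real assms by (simp add: enn_powr_def ennreal_le_iff)
qed (simp add: enn_powr_def top_unique)

lemma enn_powr_less_top_iff: "enn_powr x a < \<infinity> \<longleftrightarrow> x < \<infinity>"
  by (simp add: enn_powr_def less_top)

lemma lborel_eq_distr_lebesgue: "distr lebesgue borel (\<lambda>x. x) = (lborel :: 'a::euclidean_space measure)"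
  by (simp add: distr_completion distr_id2)

lemma sigma_finite_lebesgue: "sigma_finite_measure (lebesgue :: 'a::euclidean_space measure)"
proof (rule sigma_finite_measure_distr)
  show "sigma_finite_measure (distr lebesgue borel (\<lambda>x. x :: 'a))"
    unfolding lborel_eq_distr_lebesgue by (rule sigma_finite_lborel)
  show "(\<lambda>x. x :: 'a) \<in> lebesgue \<rightarrow>\<^sub>M borel" by (intro measurable_completion) simp
qed

text \<open>
  Lebesgue measure on pairs is here the product of two completed measures, for which the map
  \<open>(x, y) \<mapsto> x - y\<close> fails to be measurable. Pushing forward to Borel sets makes changes of variables
  available.
\<close>

lemma lborel_pair_eq_distr_lebesgue:
  "distr (lebesgue \<Otimes>\<^sub>M lebesgue) (borel \<Otimes>\<^sub>M borel) (\<lambda>z. z) = (lborel \<Otimes>\<^sub>M lborel :: ('a::euclidean_space \<times> 'a) measure)"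
proof -
  have m: "(\<lambda>x. x :: 'a) \<in> lebesgue \<rightarrow>\<^sub>M borel" by (intro measurable_completion) simp
  have "distr lebesgue borel (\<lambda>x. x :: 'a) \<Otimes>\<^sub>M distr lebesgue borel (\<lambda>x. x :: 'a)
      = distr (lebesgue \<Otimes>\<^sub>M lebesgue) (borel \<Otimes>\<^sub>M borel) (\<lambda>(x, y). (x, y))"
    by (rule pair_measure_distr[OF m m]) (simp add: lborel_eq_distr_lebesgue sigma_finite_lborel)
  then show ?thesis unfolding lborel_eq_distr_lebesgue by (simp add: case_prod_beta')
qed

lemma measurable_lebesgue_pair_borel: "(\<lambda>z. z :: 'a::euclidean_space \<times> 'a) \<in> lebesgue \<Otimes>\<^sub>M lebesgue \<rightarrow>\<^sub>M borel \<Otimes>\<^sub>M borel"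
proof -
  have m: "(\<lambda>x. x :: 'a) \<in> lebesgue \<rightarrow>\<^sub>M borel" by (intro measurable_completion) simp
  have f: "(fst :: 'a \<times> 'a \<Rightarrow> 'a) \<in> lebesgue \<Otimes>\<^sub>M lebesgue \<rightarrow>\<^sub>M borel"
    by (rule measurable_compose[OF measurable_fst m])
  have g: "(snd :: 'a \<times> 'a \<Rightarrow> 'a) \<in> lebesgue \<Otimes>\<^sub>M lebesgue \<rightarrow>\<^sub>M borel"
    by (rule measurable_compose[OF measurable_snd m])
  have "(\<lambda>z :: 'a \<times> 'a. (fst z, snd z)) \<in> lebesgue \<Otimes>\<^sub>M lebesgue \<rightarrow>\<^sub>M borel \<Otimes>\<^sub>M (borel :: 'a measure)"
    by (rule measurable_Pair[OF f g])
  then show ?thesis by simp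
qed

text \<open>
  Nonnegative integrals do not change under completion of the measure, even for integrands that are
  not Borel measurable. So the seminorm over Lebesgue measure can be computed with Borel measure throughout.
\<close>

lemma gagliardo_eq_kernel_energy:
  fixes w :: "'a::euclidean_space \<Rightarrow> real"
  assumes w: "w \<in> borel_measurable (lebesgue_on E)" and E: "E \<in> sets lebesgue"
  shows "gagliardo \<gamma> q E w = enn_powr (kernel_energy (\<gamma> * q) q E w) (1 / q)"
proof -
  let ?M = "lebesgue_on E :: 'a measure"
  interpret sigma_finite_measure ?M
    by (rule sigma_finite_measure_restrict_space[OF sigma_finite_lebesgue E])
  have id: "(\<lambda>x. x :: 'a) \<in> ?M \<rightarrow>\<^sub>M borel"
    by (intro measurable_restrict_space1 measurable_completion) simp
  have [measurable]: "fst \<in> ?M \<Otimes>\<^sub>M ?M \<rightarrow>\<^sub>M borel" "snd \<in> ?M \<Otimes>\<^sub>M ?M \<rightarrow>\<^sub>M borel"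
    using measurable_compose[OF measurable_fst id] measurable_compose[OF measurable_snd id] by (auto simp: o_def)
  have [measurable]: "(\<lambda>z. w (fst z)) \<in> borel_measurable (?M \<Otimes>\<^sub>M ?M)" "(\<lambda>z. w (snd z)) \<in> borel_measurable (?M \<Otimes>\<^sub>M ?M)"
    using measurable_compose[OF measurable_fst w] measurable_compose[OF measurable_snd w] by auto
  define f where "f = (\<lambda>z. ennreal (\<bar>w (fst z) - w (snd z)\<bar> powr q / norm (fst z - snd z) powr (real DIM('a) + \<gamma> * q)))"
  have [measurable]: "f \<in> borel_measurable (?M \<Otimes>\<^sub>M ?M)" unfolding f_def by measurable
  have "(\<integral>\<^sup>+z. f z \<partial>(?M \<Otimes>\<^sub>M ?M)) = (\<integral>\<^sup>+x. \<integral>\<^sup>+y. f (x, y) \<partial>?M \<partial>?M)"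
    by (rule nn_integral_fst[symmetric]) measurable
  also have "\<dots> = (\<integral>\<^sup>+x. (\<integral>\<^sup>+y. f (x, y) * indicator E y \<partial>lborel) * indicator E x \<partial>lborel)"
    using E by (simp add: nn_integral_restrict_space nn_integral_completion)
  also have "\<dots> = kernel_energy (\<gamma> * q) q E w"
    unfolding kernel_energy_def f_def by (simp add: powr_minus_divide minus_add_distrib[symmetric] del: minus_add_distrib)
  finally show ?thesis unfolding gagliardo_def f_def by (simp add: case_prod_beta')
qed

lemma kernel_energy_cong_AE:
  fixes w w' :: "'a::euclidean_space \<Rightarrow> real"
  assumes "AE x in lborel. x \<in> E \<longrightarrow> w x = w' x"
  shows "kernel_energy \<sigma> q E w = kernel_energy \<sigma> q E w'"
  unfolding kernel_energy_def
proof (rule nn_integral_cong_AE, rule eventually_mono[OF assms])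
  fix x assume x: "x \<in> E \<longrightarrow> w x = w' x"
  have "(\<integral>\<^sup>+y\<in>E. ennreal (\<bar>w x - w y\<bar> powr q * norm (x - y) powr (- (real DIM('a) + \<sigma>))) \<partial>lborel)
      = (\<integral>\<^sup>+y\<in>E. ennreal (\<bar>w' x - w' y\<bar> powr q * norm (x - y) powr (- (real DIM('a) + \<sigma>))) \<partial>lborel)" if "x \<in> E"
    by (rule nn_integral_cong_AE, rule eventually_mono[OF assms]) (use x that in \<open>auto simp: indicator_def\<close>)
  then show "(\<integral>\<^sup>+y\<in>E. ennreal (\<bar>w x - w y\<bar> powr q * norm (x - y) powr (- (real DIM('a) + \<sigma>))) \<partial>lborel) * indicator E x
      = (\<integral>\<^sup>+y\<in>E. ennreal (\<bar>w' x - w' y\<bar> powr q * norm (x - y) powr (- (real DIM('a) + \<sigma>))) \<partial>lborel) * indicator E x"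
    by (auto simp: indicator_def)
qed

lemma nn_integral_lborel_affine:
  fixes f :: "'a::euclidean_space \<Rightarrow> ennreal"
  assumes [measurable]: "f \<in> borel_measurable borel" and R: "0 < R"
  shows "(\<integral>\<^sup>+x. f x \<partial>lborel) = ennreal (R powr real DIM('a)) * (\<integral>\<^sup>+y. f (x0 + R *\<^sub>R y) \<partial>lborel)"
proof -
  have "(\<integral>\<^sup>+x. f x \<partial>lborel) = (\<integral>\<^sup>+x. f x \<partial>density (distr lborel borel (\<lambda>y. x0 + R *\<^sub>R y)) (\<lambda>_. ennreal (\<bar>R\<bar> ^ DIM('a))))"
    using R by (subst lborel_affine[of R x0]) auto
  also have "\<dots> = ennreal (R ^ DIM('a)) * (\<integral>\<^sup>+y. f (x0 + R *\<^sub>R y) \<partial>lborel)"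
    using R by (simp add: nn_integral_density nn_integral_distr nn_integral_cmult)
  finally show ?thesis using R by (simp add: powr_realpow)
qed

lemma kernel_energy_affine:
  fixes w v :: "'a::euclidean_space \<Rightarrow> real"
  assumes [measurable]: "w \<in> borel_measurable borel" "E' \<in> sets borel" "E \<in> sets borel" and R: "0 < R" and c: "0 \<le> c"
    and v: "\<And>y. w (x0 + R *\<^sub>R y) = c * v y" and vm [measurable]: "v \<in> borel_measurable borel"
    and E: "\<And>y. x0 + R *\<^sub>R y \<in> E' \<longleftrightarrow> y \<in> E"
  shows "kernel_energy \<sigma> q E' w = ennreal (R powr (real DIM('a) - \<sigma>) * c powr q) * kernel_energy \<sigma> q E v"
proof -
  let ?N = "real DIM('a)"
  define e where "e = (\<lambda>x z::'a. ennreal (\<bar>w x - w z\<bar> powr q * norm (x - z) powr (- (?N + \<sigma>))) * indicator E' z)"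
  define ev where "ev = (\<lambda>x z::'a. ennreal (\<bar>v x - v z\<bar> powr q * norm (x - z) powr (- (?N + \<sigma>))) * indicator E z)"
  have [measurable]: "(\<lambda>(x, z). e x z) \<in> borel_measurable (borel \<Otimes>\<^sub>M borel)" "(\<lambda>(x, z). ev x z) \<in> borel_measurable (borel \<Otimes>\<^sub>M borel)"
    unfolding e_def ev_def by measurable
  have ee: "e (x0 + R *\<^sub>R x) (x0 + R *\<^sub>R y) = ennreal (R powr (- (?N + \<sigma>)) * c powr q) * ev x y" for x y
  proof -
    have "norm ((x0 + R *\<^sub>R x) - (x0 + R *\<^sub>R y)) = R * norm (x - y)"
      using R by (simp add: scaleR_diff_right[symmetric])
    moreover have "\<bar>w (x0 + R *\<^sub>R x) - w (x0 + R *\<^sub>R y)\<bar> = c * \<bar>v x - v y\<bar>"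
      unfolding v using c by (simp add: right_diff_distrib[symmetric] abs_mult)
    moreover have "(indicator E' (x0 + R *\<^sub>R y) :: ennreal) = indicator E y" using E by (simp add: indicator_def)
    ultimately show ?thesis unfolding e_def ev_def
      by (simp add: powr_mult ennreal_mult mult_ac)
  qed
  have "kernel_energy \<sigma> q E' w = (\<integral>\<^sup>+x\<in>E'. (\<integral>\<^sup>+z. e x z \<partial>lborel) \<partial>lborel)"
    unfolding kernel_energy_def e_def ..
  also have "\<dots> = ennreal (R powr ?N) * (\<integral>\<^sup>+x. (\<integral>\<^sup>+z. e (x0 + R *\<^sub>R x) z \<partial>lborel) * indicator E' (x0 + R *\<^sub>R x) \<partial>lborel)"
    by (rule nn_integral_lborel_affine[OF _ R]) measurable
  also have "(\<lambda>x. (\<integral>\<^sup>+z. e (x0 + R *\<^sub>R x) z \<partial>lborel) * indicator E' (x0 + R *\<^sub>R x))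
      = (\<lambda>x. ennreal (R powr ?N) * ennreal (R powr (- (?N + \<sigma>)) * c powr q) * ((\<integral>\<^sup>+z. ev x z \<partial>lborel) * indicator E x))"
  proof
    fix x
    have "(\<integral>\<^sup>+z. e (x0 + R *\<^sub>R x) z \<partial>lborel) = ennreal (R powr ?N) * (\<integral>\<^sup>+z. e (x0 + R *\<^sub>R x) (x0 + R *\<^sub>R z) \<partial>lborel)"
      by (rule nn_integral_lborel_affine[OF _ R]) measurable
    also have "\<dots> = ennreal (R powr ?N) * (ennreal (R powr (- (?N + \<sigma>)) * c powr q) * (\<integral>\<^sup>+z. ev x z \<partial>lborel))"
      unfolding ee by (subst nn_integral_cmult) auto
    finally show "(\<integral>\<^sup>+z. e (x0 + R *\<^sub>R x) z \<partial>lborel) * indicator E' (x0 + R *\<^sub>R x)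
      = ennreal (R powr ?N) * ennreal (R powr (- (?N + \<sigma>)) * c powr q) * ((\<integral>\<^sup>+z. ev x z \<partial>lborel) * indicator E x)"
      using E by (simp add: indicator_def mult_ac)
  qed
  also have "(\<integral>\<^sup>+x. ennreal (R powr ?N) * ennreal (R powr (- (?N + \<sigma>)) * c powr q) * ((\<integral>\<^sup>+z. ev x z \<partial>lborel) * indicator E x) \<partial>lborel)
     = ennreal (R powr ?N) * ennreal (R powr (- (?N + \<sigma>)) * c powr q) * (\<integral>\<^sup>+x\<in>E. (\<integral>\<^sup>+z. ev x z \<partial>lborel) \<partial>lborel)"
    by (rule nn_integral_cmult) measurable
  also have "(\<integral>\<^sup>+x\<in>E. (\<integral>\<^sup>+z. ev x z \<partial>lborel) \<partial>lborel) = kernel_energy \<sigma> q E v"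
    unfolding kernel_energy_def ev_def ..
  also have "ennreal (R powr ?N) * (ennreal (R powr ?N) * ennreal (R powr (- (?N + \<sigma>)) * c powr q) * kernel_energy \<sigma> q E v)
     = ennreal (R powr (?N - \<sigma>) * c powr q) * kernel_energy \<sigma> q E v"
  proof -
    have "R powr ?N * (R powr ?N * (R powr (- (?N + \<sigma>)) * c powr q)) = R powr (?N + (?N + - (?N + \<sigma>))) * c powr q"
      by (simp only: powr_add mult.assoc)
    then have "R powr ?N * (R powr ?N * (R powr (- (?N + \<sigma>)) * c powr q)) = R powr (?N - \<sigma>) * c powr q" by simp
    then have "ennreal (R powr ?N) * (ennreal (R powr ?N) * ennreal (R powr (- (?N + \<sigma>)) * c powr q)) = ennreal (R powr (?N - \<sigma>) * c powr q)"
      by (simp add: ennreal_mult[symmetric])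
    then show ?thesis by (simp only: mult.assoc[symmetric])
  qed
  finally show ?thesis .
qed

lemma signed_power_scale:
  assumes "0 < c"
  shows "signed_power r (c * t) = c powr (r + 1) * signed_power r t"
  using assms by (simp add: signed_power_def abs_mult powr_mult powr_add)

lemma compactly_contained_ball_iff:
  fixes x :: "'a::euclidean_space"
  assumes "0 < r"
  shows "compactly_contained (ball x r) \<Omega> \<longleftrightarrow> cball x r \<subseteq> \<Omega>"
  using assms by (simp add: compactly_contained_def closure_ball)

text \<open>
  The pointwise bound is arranged by clipping on the ball, where it changes the function only on a null set.
\<close>

lemma borel_version:
  fixes u :: "'a::euclidean_space \<Rightarrow> real"
  assumes u: "u \<in> borel_measurable lebesgue" and M: "Linf_norm (ball x0 R) u \<le> ennreal M" and M0: "0 \<le> M"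
  obtains u' where "u' \<in> borel_measurable borel" "AE x in lborel. u x = u' x" "\<And>x. x \<in> ball x0 R \<Longrightarrow> \<bar>u' x\<bar> \<le> M"
proof -
  obtain w where w: "w \<in> borel_measurable lborel" "AE x in lborel. u x = w x"
    using completion_ex_borel_measurable_real[OF u] by blast
  have "AE x in lebesgue_on (ball x0 R). ennreal \<bar>u x\<bar> \<le> ennreal M"
    using esssup_AE[of "\<lambda>x. ennreal \<bar>u x\<bar>" "lebesgue_on (ball x0 R)"] M
    unfolding Linf_norm_def by (auto elim!: eventually_mono intro: order_trans)
  then have "AE x in lebesgue. x \<in> ball x0 R \<longrightarrow> ennreal \<bar>u x\<bar> \<le> ennreal M"
    by (subst (asm) AE_restrict_space_iff) auto
  then have b: "AE x in lborel. x \<in> ball x0 R \<longrightarrow> \<bar>u x\<bar> \<le> M"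
    using M0 by (simp add: AE_completion_iff ennreal_le_iff)
  have [measurable]: "w \<in> borel_measurable borel" using w by simp
  define u' where "u' = (\<lambda>x. if x \<in> ball x0 R then max (- M) (min M (w x)) else w x)"
  show thesis
  proof (rule that)
    show "u' \<in> borel_measurable borel" unfolding u'_def by measurable
    show "AE x in lborel. u x = u' x" using w(2) b by eventually_elim (auto simp: u'_def)
    show "\<bar>u' x\<bar> \<le> M" if "x \<in> ball x0 R" for x using that M0 by (auto simp: u'_def)
  qed
qed

text \<open>
  Outside a ball around \<open>x0\<close> the weights \<open>|x-x0|\<close> and \<open>1+|x|\<close> are comparable.
\<close>

lemma Tail_finite:
  fixes u :: "'a::euclidean_space \<Rightarrow> real"
  assumes u: "u \<in> tail_space s p" and R: "0 < R" and sp: "0 < s" "0 < p"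
  shows "Tail s p u x0 R < \<infinity>"
proof -
  let ?b = "real DIM('a) + s * p"
  define k where "k = (1 + norm x0) / R + 1"
  have b: "0 < ?b" using sp by (simp add: add_pos_pos)
  have k: "0 < k" unfolding k_def using R by (intro add_nonneg_pos divide_nonneg_pos) auto
  have [measurable]: "u \<in> borel_measurable lebesgue" using u by (simp add: tail_space_def)
  have id: "(\<lambda>x. x :: 'a) \<in> lebesgue \<rightarrow>\<^sub>M borel" by (intro measurable_completion) simp
  have [measurable]: "(\<lambda>x. norm x) \<in> borel_measurable (lebesgue :: 'a measure)"
    using measurable_compose[OF id borel_measurable_norm] by simp
  have pt: "ennreal (\<bar>u x\<bar> powr (p - 1) / norm (x - x0) powr ?b) * indicator (- ball x0 R) x
     \<le> ennreal (k powr ?b) * ennreal (\<bar>u x\<bar> powr (p - 1) / (1 + norm x) powr ?b)" for x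
  proof (cases "x \<in> ball x0 R")
    case False
    then have d: "R \<le> norm (x - x0)" by (simp add: dist_norm norm_minus_commute)
    have "1 + norm x \<le> (1 + norm x0) + norm (x - x0)" using norm_triangle_ineq[of x0 "x - x0"] by simp
    also have "1 + norm x0 \<le> (1 + norm x0) / R * norm (x - x0)"
    proof -
      have "(1 + norm x0) / R * R \<le> (1 + norm x0) / R * norm (x - x0)" using d R by (intro mult_left_mono) auto
      then show ?thesis using R by simp
    qed
    finally have le: "1 + norm x \<le> k * norm (x - x0)" by (simp add: k_def algebra_simps)
    have n0: "0 < norm (x - x0)" using d R by linarith
    have "(1 + norm x) powr ?b \<le> (k * norm (x - x0)) powr ?b" using le b by (intro powr_mono2) auto
    also have "\<dots> = k powr ?b * norm (x - x0) powr ?b" by (rule powr_mult)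
    finally have "1 / norm (x - x0) powr ?b \<le> k powr ?b / (1 + norm x) powr ?b"
    proof -
      assume a: "(1 + norm x) powr ?b \<le> k powr ?b * norm (x - x0) powr ?b"
      have "0 < (1 + norm x) powr ?b" using norm_ge_zero[of x] by (intro powr_gt_zero[THEN iffD2]) linarith
      moreover have "0 < norm (x - x0) powr ?b" using n0 by simp
      ultimately show ?thesis using a by (simp add: divide_simps mult.commute)
    qed
    then have "\<bar>u x\<bar> powr (p - 1) * (1 / norm (x - x0) powr ?b) \<le> \<bar>u x\<bar> powr (p - 1) * (k powr ?b / (1 + norm x) powr ?b)"
      by (rule mult_left_mono) auto
    then show ?thesis using False by (simp add: ennreal_mult[symmetric] ennreal_leI mult_ac)
  qed simp
  have "(\<integral>\<^sup>+x. ennreal (\<bar>u x\<bar> powr (p - 1) / norm (x - x0) powr ?b) \<partial>lebesgue_on (- ball x0 R))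
     = (\<integral>\<^sup>+x. ennreal (\<bar>u x\<bar> powr (p - 1) / norm (x - x0) powr ?b) * indicator (- ball x0 R) x \<partial>lebesgue)"
    by (rule nn_integral_restrict_space) auto
  also have "\<dots> \<le> (\<integral>\<^sup>+x. ennreal (k powr ?b) * ennreal (\<bar>u x\<bar> powr (p - 1) / (1 + norm x) powr ?b) \<partial>lebesgue)"
    by (intro nn_integral_mono pt)
  also have "\<dots> = ennreal (k powr ?b) * (\<integral>\<^sup>+x. ennreal (\<bar>u x\<bar> powr (p - 1) / (1 + norm x) powr ?b) \<partial>lebesgue)"
    by (rule nn_integral_cmult) measurable
  also have "\<dots> < \<infinity>" using u unfolding tail_space_def by (simp add: ennreal_mult_less_top)
  finally have "(\<integral>\<^sup>+x. ennreal (\<bar>u x\<bar> powr (p - 1) / norm (x - x0) powr ?b) \<partial>lebesgue_on (- ball x0 R)) < \<infinity>" .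
  then show ?thesis unfolding Tail_def enn_powr_less_top_iff by (simp add: ennreal_mult_less_top)
qed


lemma has_bochner_integral_lborel_affine:
  fixes F :: "'a::euclidean_space \<Rightarrow> real"
  assumes F: "has_bochner_integral lborel F 0" and R: "0 < R"
  shows "has_bochner_integral lborel (\<lambda>z. F (x0 + R *\<^sub>R z)) 0"
proof -
  define c where "c = \<bar>R\<bar> ^ DIM('a)"
  have c: "0 < c" using R by (simp add: c_def)
  let ?D = "distr lborel borel (\<lambda>z. x0 + R *\<^sub>R z) :: 'a measure"
  have [measurable]: "F \<in> borel_measurable borel"
    using borel_measurable_has_bochner_integral[OF F] by simp
  have "has_bochner_integral (density ?D (\<lambda>_. ennreal c)) F 0"
    using F R unfolding c_def by (subst lborel_affine[of R x0, symmetric]) auto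
  then have "integrable ?D (\<lambda>x. c * F x)" "(\<integral>x. c * F x \<partial>?D) = 0"
    using c by (auto simp: has_bochner_integral_iff integrable_density integral_density)
  then have "integrable ?D F" "(\<integral>x. F x \<partial>?D) = 0" using c by auto
  then show ?thesis by (simp add: has_bochner_integral_iff integrable_distr_eq integral_distr)
qed

lemma ennreal_mult_le_cancel:
  assumes "0 < k" "ennreal k * x \<le> ennreal k"
  shows "x \<le> 1"
proof -
  have "ennreal (1 / k) * (ennreal k * x) \<le> ennreal (1 / k) * ennreal k"
    using assms by (intro mult_left_mono) auto
  then show ?thesis using assms(1) by (simp add: mult.assoc[symmetric] ennreal_mult[symmetric])
qed

lemma tail_rescaled_le_1:
  fixes u v :: "'a::euclidean_space \<Rightarrow> real"
  assumes u' [measurable]: "u' \<in> borel_measurable borel" and ae: "AE x in lborel. u x = u' x"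
    and v: "\<And>y. u' (x0 + R *\<^sub>R y) = M * v y" and vm [measurable]: "v \<in> borel_measurable borel"
    and R: "0 < R" and M: "0 < M" and p: "1 < p" and T: "Tail s p u x0 R \<le> ennreal M"
  shows "(\<integral>\<^sup>+y\<in>- ball 0 1. ennreal (\<bar>v y\<bar> powr (p - 1) * norm y powr (- (real DIM('a) + s * p))) \<partial>lborel) \<le> 1"
    (is "?T \<le> 1")
proof -
  let ?N = "real DIM('a)" let ?b = "real DIM('a) + s * p"
  have [measurable]: "- ball x0 R \<in> sets borel" "- ball (0::'a) 1 \<in> sets borel" by auto
  define f where "f = (\<lambda>x. ennreal (\<bar>u' x\<bar> powr (p - 1) * norm (x - x0) powr (- ?b)) * indicator (- ball x0 R) x)"
  have [measurable]: "f \<in> borel_measurable borel" unfolding f_def by measurable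
  have "(\<integral>\<^sup>+x. ennreal (\<bar>u x\<bar> powr (p - 1) / norm (x - x0) powr ?b) \<partial>lebesgue_on (- ball x0 R))
     = (\<integral>\<^sup>+x. ennreal (\<bar>u x\<bar> powr (p - 1) / norm (x - x0) powr ?b) * indicator (- ball x0 R) x \<partial>lborel)"
    by (simp add: nn_integral_restrict_space nn_integral_completion)
  also have "\<dots> = (\<integral>\<^sup>+x. f x \<partial>lborel)"
    by (rule nn_integral_cong_AE, rule eventually_mono[OF ae])
      (simp add: f_def powr_minus_divide minus_add_distrib[symmetric] del: minus_add_distrib)
  also have "\<dots> = ennreal (R powr ?N) * (\<integral>\<^sup>+y. f (x0 + R *\<^sub>R y) \<partial>lborel)"
    by (rule nn_integral_lborel_affine[OF _ R]) measurable
  also have "(\<lambda>y. f (x0 + R *\<^sub>R y)) = (\<lambda>y. ennreal (M powr (p - 1) * R powr (- ?b)) * (ennreal (\<bar>v y\<bar> powr (p - 1) * norm y powr (- ?b)) * indicator (- ball 0 1) y))"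
  proof
    fix y :: 'a
    have i: "(indicator (- ball x0 R) (x0 + R *\<^sub>R y) :: ennreal) = indicator (- ball 0 1) y"
      using R by (auto simp: indicator_def dist_norm)
    have "\<bar>u' (x0 + R *\<^sub>R y)\<bar> powr (p - 1) * norm (x0 + R *\<^sub>R y - x0) powr (- ?b) = (M powr (p - 1) * R powr (- ?b)) * (\<bar>v y\<bar> powr (p - 1) * norm y powr (- ?b))"
      unfolding v using R M by (simp add: abs_mult powr_mult mult_ac)
    then show "f (x0 + R *\<^sub>R y) = ennreal (M powr (p - 1) * R powr (- ?b)) * (ennreal (\<bar>v y\<bar> powr (p - 1) * norm y powr (- ?b)) * indicator (- ball 0 1) y)"
      unfolding f_def i by (simp add: ennreal_mult mult.assoc)
  qed
  also have "(\<integral>\<^sup>+y. ennreal (M powr (p - 1) * R powr (- ?b)) * (ennreal (\<bar>v y\<bar> powr (p - 1) * norm y powr (- ?b)) * indicator (- ball 0 1) y) \<partial>lborel)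
     = ennreal (M powr (p - 1) * R powr (- ?b)) * ?T"
    by (rule nn_integral_cmult) measurable
  finally have eq: "ennreal (R powr (s * p)) * (\<integral>\<^sup>+x. ennreal (\<bar>u x\<bar> powr (p - 1) / norm (x - x0) powr ?b) \<partial>lebesgue_on (- ball x0 R))
     = ennreal (R powr (s * p)) * (ennreal (R powr ?N) * (ennreal (M powr (p - 1) * R powr (- ?b)) * ?T))" by simp
  have "R powr (s * p) * (R powr ?N * (M powr (p - 1) * R powr (- ?b))) = M powr (p - 1) * R powr (s * p + (?N + - ?b))"
    by (simp only: powr_add mult_ac)
  then have "R powr (s * p) * (R powr ?N * (M powr (p - 1) * R powr (- ?b))) = M powr (p - 1)" using R by simp
  then have "ennreal (R powr (s * p)) * (ennreal (R powr ?N) * ennreal (M powr (p - 1) * R powr (- ?b))) = ennreal (M powr (p - 1))"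
    by (simp add: ennreal_mult[symmetric])
  then have "ennreal (R powr (s * p)) * (ennreal (R powr ?N) * (ennreal (M powr (p - 1) * R powr (- ?b)) * ?T)) = ennreal (M powr (p - 1)) * ?T"
    by (simp only: mult.assoc[symmetric])
  then have "enn_powr (ennreal (M powr (p - 1)) * ?T) (1 / (p - 1)) \<le> ennreal M"
    using T unfolding Tail_def eq by simp
  then have "ennreal (M powr (p - 1)) * ?T \<le> ennreal (M powr (p - 1))"
    using M p by (subst (asm) enn_powr_le_iff) auto
  then show ?thesis using M by (intro ennreal_mult_le_cancel[of "M powr (p - 1)"]) auto
qed

lemma measurable_lebesgue_on_of_borel:
  "f \<in> borel_measurable borel \<Longrightarrow> f \<in> borel_measurable (lebesgue_on (E :: 'a::euclidean_space set))"
  by (intro measurable_restrict_space1 measurable_completion) simp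

lemma frac_sobolev_of_compact_support:
  fixes f :: "'a::euclidean_space \<Rightarrow> real"
  assumes [measurable]: "f \<in> borel_measurable borel" and B: "\<And>x. \<bar>f x\<bar> \<le> B"
    and fin: "kernel_energy (s * p) p UNIV f < \<infinity>" and \<Omega>: "bounded \<Omega>" "open \<Omega>" and p: "0 < p"
  shows "f \<in> frac_sobolev s p \<Omega>"
proof -
  have \<Omega>m [measurable]: "\<Omega> \<in> sets borel" using \<Omega> by auto
  have fm: "f \<in> borel_measurable (lebesgue_on \<Omega>)" by (rule measurable_lebesgue_on_of_borel) measurable
  have "(\<integral>\<^sup>+x. ennreal (\<bar>f x\<bar> powr p) \<partial>lebesgue_on \<Omega>) = (\<integral>\<^sup>+x. ennreal (\<bar>f x\<bar> powr p) * indicator \<Omega> x \<partial>lborel)"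
    by (simp add: nn_integral_restrict_space nn_integral_completion)
  also have "\<dots> \<le> (\<integral>\<^sup>+x. ennreal (B powr p) * indicator \<Omega> x \<partial>lborel)"
    using B p by (intro nn_integral_mono mult_right_mono ennreal_leI powr_mono2) auto
  also have "\<dots> < \<infinity>"
    using emeasure_bounded_finite[OF \<Omega>(1)] by (simp add: nn_integral_cmult_indicator ennreal_mult_less_top)
  finally have 1: "Lq_norm p \<Omega> f < \<infinity>" unfolding Lq_norm_def enn_powr_less_top_iff .
  have "kernel_energy (s * p) p \<Omega> f < \<infinity>"
    by (rule le_less_trans[OF kernel_energy_mono_set fin]) simp
  moreover have "gagliardo s p \<Omega> f = enn_powr (kernel_energy (s * p) p \<Omega> f) (1 / p)"
    by (rule gagliardo_eq_kernel_energy[OF fm]) simp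
  ultimately have 2: "gagliardo s p \<Omega> f < \<infinity>" by (simp only: enn_powr_less_top_iff)
  show ?thesis unfolding frac_sobolev_def using fm 1 2 by simp
qed

text \<open>
  A test function at unit scale is transported to the original ball, and the resulting identity is
  transported back by an affine change of variables on pairs of points. The kernel is homogeneous, so this
  produces only a constant factor.
\<close>

lemma rescaled_equation:
  fixes u v :: "'a::euclidean_space \<Rightarrow> real"
  assumes sol: "local_weak_solution s p \<Omega> u" and \<Omega>: "bounded \<Omega>" "open \<Omega>"
    and R: "0 < R" "cball x0 R \<subseteq> \<Omega>" and p: "2 < p" and M: "0 < M"
    and u' [measurable]: "u' \<in> borel_measurable borel" and ae: "AE x in lborel. u x = u' x"
    and v: "\<And>y. u' (x0 + R *\<^sub>R y) = M * v y" and vm [measurable]: "v \<in> borel_measurable borel"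
    and \<phi> [measurable]: "\<phi> \<in> borel_measurable borel" and B: "\<And>x. \<bar>\<phi> x\<bar> \<le> B"
    and r: "0 < r" "r < 1" and supp: "\<And>x. r \<le> norm x \<Longrightarrow> \<phi> x = 0" and fin: "kernel_energy (s * p) p UNIV \<phi> < \<infinity>"
  shows "has_bochner_integral (lborel \<Otimes>\<^sub>M lborel)
          (\<lambda>(x, y). signed_power (p - 2) (v x - v y) * (\<phi> x - \<phi> y) * norm (x - y) powr (- (real DIM('a) + s * p))) 0"
proof -
  let ?N = "real DIM('a)" let ?b = "real DIM('a) + s * p"
  let ?L = "lebesgue \<Otimes>\<^sub>M lebesgue :: ('a \<times> 'a) measure"
  define \<Phi> where "\<Phi> = (\<lambda>x. \<phi> ((1 / R) *\<^sub>R (x - x0)))"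
  have \<Phi>m [measurable]: "\<Phi> \<in> borel_measurable borel" unfolding \<Phi>_def by measurable
  have \<Phi>: "\<Phi> (x0 + R *\<^sub>R y) = \<phi> y" for y using R by (simp add: \<Phi>_def)
  have "kernel_energy (s * p) p UNIV \<Phi> = ennreal (R powr (?N - s * p) * 1 powr p) * kernel_energy (s * p) p UNIV \<phi>"
    using R by (intro kernel_energy_affine[where ?x0.0 = x0]) (auto simp: \<Phi>)
  then have "kernel_energy (s * p) p UNIV \<Phi> < \<infinity>" using fin by (simp add: ennreal_mult_less_top)
  then have 1: "\<Phi> \<in> frac_sobolev s p \<Omega>"
    using B p \<Omega> by (intro frac_sobolev_of_compact_support[where B = B]) (auto simp: \<Phi>_def)
  have "{x. \<Phi> x \<noteq> 0} \<subseteq> cball x0 R"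
  proof
    fix x assume "x \<in> {x. \<Phi> x \<noteq> 0}"
    then have "norm ((1 / R) *\<^sub>R (x - x0)) < r" using supp by (force simp: \<Phi>_def not_le[symmetric])
    then have "norm (x - x0) / R < r" using R(1) by (simp only: norm_scaleR) simp
    then have "norm (x - x0) < r * R" using R(1) by (simp add: field_simps)
    also have "\<dots> \<le> 1 * R" using r R by (intro mult_right_mono) auto
    finally show "x \<in> cball x0 R" by (simp add: dist_norm norm_minus_commute)
  qed
  then have "closure {x. \<Phi> x \<noteq> 0} \<subseteq> cball x0 R" by (rule closure_minimal) simp
  then have 2: "compactly_contained {x. \<Phi> x \<noteq> 0} \<Omega>"
    unfolding compactly_contained_def using R(2) bounded_subset[OF bounded_cball] by (auto simp: compact_eq_bounded_closed)
  define f where "f = (\<lambda>z. \<bar>u (fst z) - u (snd z)\<bar> powr (p - 2) * (u (fst z) - u (snd z)) * (\<Phi> (fst z) - \<Phi> (snd z)) / norm (fst z - snd z) powr ?b)"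
  define F where "F = (\<lambda>z. signed_power (p - 2) (u' (fst z) - u' (snd z)) * (\<Phi> (fst z) - \<Phi> (snd z)) * norm (fst z - snd z) powr (- ?b))"
  have f: "has_bochner_integral ?L f 0"
    using sol 1 2 unfolding local_weak_solution_def f_def by (auto simp: case_prod_beta')
  have Fm [measurable]: "F \<in> borel_measurable (borel \<Otimes>\<^sub>M borel)" unfolding F_def by measurable
  \<comment> \<open>The set where \<open>u\<close> differs from its Borel version, enlarged to a Borel null set so that it can be removed from pairs.\<close>
  obtain Nl where Nl: "{x. u x \<noteq> u' x} \<subseteq> Nl" "emeasure lborel Nl = 0" "Nl \<in> sets lborel"
    using AE_E[OF ae] by auto
  have Nlm [measurable]: "Nl \<in> sets borel" using Nl by simp
  have aeN: "AE x in lborel. x \<notin> Nl" using Nl by (intro AE_not_in) (auto simp: null_sets_def)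
  have "AE z in lborel \<Otimes>\<^sub>M lborel. fst z \<notin> Nl \<and> snd z \<notin> Nl"
  proof (rule lborel_pair.AE_pair_measure)
    show "{z \<in> space (lborel \<Otimes>\<^sub>M lborel). fst z \<notin> Nl \<and> snd z \<notin> Nl} \<in> sets (lborel \<Otimes>\<^sub>M lborel)"
      by measurable
    show "AE x in lborel. AE y in lborel. fst (x, y) \<notin> Nl \<and> snd (x, y) \<notin> Nl"
      by (rule eventually_mono[OF aeN], rule eventually_mono[OF aeN]) simp
  qed
  then have "AE z in distr ?L (borel \<Otimes>\<^sub>M borel) (\<lambda>z. z). fst z \<notin> Nl \<and> snd z \<notin> Nl"
    unfolding lborel_pair_eq_distr_lebesgue .
  moreover have "{z \<in> space (borel \<Otimes>\<^sub>M borel). fst z \<notin> Nl \<and> snd z \<notin> Nl} \<in> sets (borel \<Otimes>\<^sub>M borel)"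
    by measurable
  ultimately have "AE z in ?L. fst z \<notin> Nl \<and> snd z \<notin> Nl"
    by (simp only: AE_distr_iff[OF measurable_lebesgue_pair_borel])
  then have "AE z in ?L. f z = F z"
  proof (rule eventually_mono)
    fix z assume z: "fst z \<notin> Nl \<and> snd z \<notin> Nl"
    then have "u (fst z) = u' (fst z)" "u (snd z) = u' (snd z)" using Nl(1) by auto
    then show "f z = F z" unfolding f_def F_def signed_power_def
      by (simp add: powr_minus_divide minus_add_distrib[symmetric] del: minus_add_distrib)
  qed
  then have "has_bochner_integral ?L F 0"
    using f borel_measurable_has_bochner_integral[OF f] measurable_compose[OF measurable_lebesgue_pair_borel Fm]
    by (subst has_bochner_integral_cong_AE[of _ _ f]) (auto elim: eventually_mono)
  then have "has_bochner_integral (distr ?L (borel \<Otimes>\<^sub>M borel) (\<lambda>z. z)) F 0"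
    by (intro has_bochner_integral_distr Fm measurable_lebesgue_pair_borel)
  then have "has_bochner_integral lborel F 0"
    unfolding lborel_pair_eq_distr_lebesgue lborel_prod .
  then have A: "has_bochner_integral lborel (\<lambda>z. F ((x0, x0) + R *\<^sub>R z)) 0"
    by (rule has_bochner_integral_lborel_affine[OF _ R(1)])
  define c where "c = M powr (p - 1) * R powr (- ?b)"
  have c: "0 < c" using M R by (simp add: c_def)
  define g where "g = (\<lambda>z. signed_power (p - 2) (v (fst z) - v (snd z)) * (\<phi> (fst z) - \<phi> (snd z)) * norm (fst z - snd z) powr (- ?b))"
  have "F ((x0, x0) + R *\<^sub>R z) = c * g z" for z
  proof -
    have "M * v (fst z) - M * v (snd z) = M * (v (fst z) - v (snd z))" by (simp add: algebra_simps)
    moreover have "norm (x0 + R *\<^sub>R fst z - (x0 + R *\<^sub>R snd z)) = R * norm (fst z - snd z)"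
      using R by (simp add: scaleR_diff_right[symmetric])
    ultimately show ?thesis
      unfolding F_def g_def c_def using M by (simp add: \<Phi> v signed_power_scale powr_mult mult_ac)
  qed
  then have "has_bochner_integral lborel (\<lambda>z. (1 / c) * (c * g z)) ((1 / c) * 0)"
    using A by (intro has_bochner_integral_mult_right) simp
  then have "has_bochner_integral lborel g 0" using c by simp
  then show ?thesis unfolding g_def lborel_prod by (simp add: case_prod_beta')
qed

text \<open>
  The function \<open>v(y) = u(x0 + R y) / M\<close>, after passing to a Borel version of \<open>u\<close>. The three assumed
  bounds are those that the normalisation of \<open>v\<close> requires.
\<close>

lemma rescaled_solution:
  fixes u :: "'a::euclidean_space \<Rightarrow> real"
  assumes sol: "local_weak_solution s p \<Omega> u" and \<Omega>: "bounded \<Omega>" "open \<Omega>"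
    and R: "0 < R" "cball x0 R \<subseteq> \<Omega>" and p: "2 < p" and M: "0 < M"
    and bd: "Linf_norm (ball x0 R) u \<le> ennreal M" "Tail s p u x0 R \<le> ennreal M"
      "ennreal (R powr (s - real DIM('a) / p)) * gagliardo s p (ball x0 R) u \<le> ennreal M"
  obtains v :: "'a \<Rightarrow> real" where "normalized_solution s p v"
    "\<And>\<sigma> q \<rho>. 0 < \<rho> \<Longrightarrow> kernel_energy \<sigma> q (ball x0 (R * \<rho>)) u = ennreal (R powr (real DIM('a) - \<sigma>) * M powr q) * kernel_energy \<sigma> q (ball 0 \<rho>) v"
proof -
  let ?N = "real DIM('a)"
  have u: "u \<in> borel_measurable lebesgue" using sol by (simp add: local_weak_solution_def tail_space_def)
  obtain u' where u' [measurable]: "u' \<in> borel_measurable borel" and ae: "AE x in lborel. u x = u' x"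
    and u'M: "\<And>x. x \<in> ball x0 R \<Longrightarrow> \<bar>u' x\<bar> \<le> M"
    by (rule borel_version[OF u bd(1) less_imp_le[OF M]], rule that)
  define v where "v = (\<lambda>y. u' (x0 + R *\<^sub>R y) / M)"
  have vm [measurable]: "v \<in> borel_measurable borel" unfolding v_def by measurable
  have v: "u' (x0 + R *\<^sub>R y) = M * v y" for y using M by (simp add: v_def)
  have KE: "kernel_energy \<sigma> q (ball x0 (R * \<rho>)) u = ennreal (R powr (?N - \<sigma>) * M powr q) * kernel_energy \<sigma> q (ball 0 \<rho>) v"
    if "0 < \<rho>" for \<sigma> q \<rho>
  proof -
    have "kernel_energy \<sigma> q (ball x0 (R * \<rho>)) u = kernel_energy \<sigma> q (ball x0 (R * \<rho>)) u'"
      using ae by (intro kernel_energy_cong_AE) (auto elim: eventually_mono)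
    also have "\<dots> = ennreal (R powr (?N - \<sigma>) * M powr q) * kernel_energy \<sigma> q (ball 0 \<rho>) v"
      using R M that by (intro kernel_energy_affine[where ?x0.0 = x0] v) (auto simp: dist_norm)
    finally show ?thesis .
  qed
  show thesis
  proof (rule that[of v])
    have n1: "\<forall>x\<in>ball 0 1. \<bar>v x\<bar> \<le> 1"
    proof
      fix x :: 'a assume "x \<in> ball 0 1"
      then have "\<bar>u' (x0 + R *\<^sub>R x)\<bar> \<le> M" using R by (intro u'M) (simp add: dist_norm)
      then show "\<bar>v x\<bar> \<le> 1" using M by (simp add: v_def)
    qed
    have n2: "kernel_energy (s * p) p (ball 0 1) v \<le> 1"
    proof -
      have um: "u \<in> borel_measurable (lebesgue_on (ball x0 R))" using u by (rule measurable_restrict_space1)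
      let ?g = "gagliardo s p (ball x0 R) u"
      have "ennreal (R powr (?N / p - s)) * (ennreal (R powr (s - ?N / p)) * ?g) \<le> ennreal (R powr (?N / p - s)) * ennreal M"
        by (intro mult_left_mono bd) auto
      moreover have "ennreal (R powr (?N / p - s)) * ennreal (R powr (s - ?N / p)) = 1"
        using R by (simp add: ennreal_mult[symmetric] powr_add[symmetric])
      ultimately have "?g \<le> ennreal (R powr (?N / p - s) * M)"
        using M by (simp add: mult.assoc[symmetric] ennreal_mult)
      then have "kernel_energy (s * p) p (ball x0 R) u \<le> ennreal ((R powr (?N / p - s) * M) powr p)"
        using p M um by (subst (asm) gagliardo_eq_kernel_energy) (auto simp: enn_powr_le_iff)
      also have "(R powr (?N / p - s) * M) powr p = R powr (?N - s * p) * M powr p"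
        using p by (simp add: powr_mult powr_powr left_diff_distrib)
      finally have "ennreal (R powr (?N - s * p) * M powr p) * kernel_energy (s * p) p (ball 0 1) v \<le> ennreal (R powr (?N - s * p) * M powr p)"
        using KE[of 1 "s * p" p] by simp
      then show ?thesis using R M by (intro ennreal_mult_le_cancel) auto
    qed
    have n3: "(\<integral>\<^sup>+y\<in>- ball 0 1. ennreal (\<bar>v y\<bar> powr (p - 1) * norm y powr (- (?N + s * p))) \<partial>lborel) \<le> 1"
      using p by (intro tail_rescaled_le_1[OF u' ae v vm R(1) M _ bd(2)]) simp
    show "normalized_solution s p v"
      unfolding normalized_solution_def
    proof (intro conjI vm n1 n2 n3 allI impI, elim conjE)
      fix \<phi> :: "'a \<Rightarrow> real" and B r :: real
      assume a: "\<phi> \<in> borel_measurable borel" "\<forall>x. \<bar>\<phi> x\<bar> \<le> B" "0 < r" "r < 1" "\<forall>x. r \<le> norm x \<longrightarrow> \<phi> x = 0"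
        "kernel_energy (s * p) p UNIV \<phi> < \<infinity>"
      show "has_bochner_integral (lborel \<Otimes>\<^sub>M lborel)
          (\<lambda>(x, y). signed_power (p - 2) (v x - v y) * (\<phi> x - \<phi> y) * norm (x - y) powr (- (?N + s * p))) 0"
        by (rule rescaled_equation[OF sol \<Omega> R p M u' ae v vm a(1) a(2)[THEN spec] a(3,4) a(5)[THEN spec, THEN mp] a(6)])
    qed
  qed (rule KE)
qed

lemma gagliardo_le_of_kernel_energy:
  fixes u v :: "'a::euclidean_space \<Rightarrow> real"
  assumes u: "u \<in> borel_measurable lebesgue" and q: "0 < q" and R: "0 < R" and M: "0 < M" and b: "0 \<le> b"
    and eq: "kernel_energy (\<gamma> * q) q (ball x0 r) u = ennreal (R powr (real DIM('a) - \<gamma> * q) * M powr q) * kernel_energy (\<gamma> * q) q (ball 0 \<rho>) v"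
    and le: "kernel_energy (\<gamma> * q) q (ball 0 \<rho>) v \<le> ennreal b"
  shows "gagliardo \<gamma> q (ball x0 r) u \<le> ennreal (R powr (real DIM('a) / q - \<gamma>) * M * b powr (1 / q))"
proof -
  have um: "u \<in> borel_measurable (lebesgue_on (ball x0 r))" using u by (rule measurable_restrict_space1)
  have "kernel_energy (\<gamma> * q) q (ball x0 r) u \<le> ennreal (R powr (real DIM('a) - \<gamma> * q) * M powr q) * ennreal b"
    unfolding eq by (rule mult_left_mono[OF le]) simp
  also have "\<dots> = ennreal ((R powr (real DIM('a) / q - \<gamma>) * M * b powr (1 / q)) powr q)"
    using q M b by (simp add: powr_mult powr_powr left_diff_distrib ennreal_mult[symmetric])
  finally show ?thesis
    using q M um by (subst gagliardo_eq_kernel_energy) (auto simp: enn_powr_le_iff)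
qed

section \<open>Regularity on the original domain\<close>

text \<open>
  The ball in question is slightly enlarged within \<open>\<Omega>\<close>; after scaling the larger ball to the unit ball
  it becomes a concentric ball of radius less than \<open>1\<close>, so no covering is needed.
\<close>

lemma frac_sobolev_loc_of_solution:
  fixes u :: "'a::euclidean_space \<Rightarrow> real"
  assumes p: "2 < p" and s: "0 < s" "s \<le> (p - 2) / p" and q: "p \<le> q" and \<gamma>: "s \<le> \<gamma>" "\<gamma> < s * p / (p - 2)"
    and \<Omega>: "bounded \<Omega>" "open \<Omega>" and sol: "local_weak_solution s p \<Omega> u" and lb: "locally_bounded \<Omega> u"
  shows "u \<in> frac_sobolev_loc \<gamma> q \<Omega>"
  unfolding frac_sobolev_loc_def
proof (intro CollectI allI impI, elim conjE)
  fix x0 :: 'a and r :: real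
  assume r: "0 < r" and "compactly_contained (ball x0 r) \<Omega>"
  then have sub: "cball x0 r \<subseteq> \<Omega>" by (simp add: compactly_contained_ball_iff)
  have u: "u \<in> borel_measurable lebesgue" using sol by (simp add: local_weak_solution_def tail_space_def)
  have q0: "0 < q" using p q by linarith
  have um: "u \<in> borel_measurable (lebesgue_on (ball x0 r))" using u by (rule measurable_restrict_space1)
  obtain e where e: "0 < e" "(\<Union>x\<in>cball x0 r. cball x e) \<subseteq> \<Omega>"
    using compact_subset_open_imp_cball_epsilon_subset[OF compact_cball \<Omega>(2) sub] by blast
  \<comment> \<open>The closed ball of radius \<open>r+e\<close> consists of the points within distance \<open>e\<close> of the closed ball of radius \<open>r\<close>.\<close>
  define R where "R = r + e"
  have R: "0 < R" "r < R" using r e by (auto simp: R_def)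
  have RS: "cball x0 R \<subseteq> \<Omega>"
  proof
    fix x assume x: "x \<in> cball x0 R"
    have "x \<in> (\<Union>y\<in>cball x0 r. cball y e)"
    proof (cases "dist x0 x \<le> r")
      case True
      then show ?thesis using e by (intro UN_I[of x]) auto
    next
      case False
      define y where "y = x0 + (r / dist x0 x) *\<^sub>R (x - x0)"
      have d: "0 < dist x0 x" using False r by linarith
      have n: "norm (x - x0) = dist x0 x" by (simp add: dist_norm norm_minus_commute)
      have "dist x0 y = r" using d r unfolding y_def dist_norm by (simp add: n[unfolded dist_norm] norm_minus_commute)
      moreover have "dist y x = dist x0 x - r"
      proof -
        have "x - y = (1 - r / dist x0 x) *\<^sub>R (x - x0)" unfolding y_def by (simp add: algebra_simps)
        then have "norm (x - y) = \<bar>1 - r / dist x0 x\<bar> * dist x0 x" by (simp only: norm_scaleR n)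
        also have "\<dots> = dist x0 x - r" using d False by (simp add: abs_of_nonneg field_simps)
        finally show ?thesis by (simp add: dist_norm norm_minus_commute)
      qed
      ultimately show ?thesis using x by (intro UN_I[of y]) (auto simp: R_def)
    qed
    then show "x \<in> \<Omega>" using e by blast
  qed
  have cc: "compactly_contained (ball x0 R) \<Omega>" using R RS by (simp add: compactly_contained_ball_iff)
  have Lf: "Linf_norm (ball x0 R) u < \<infinity>" using lb cc R unfolding locally_bounded_def by blast
  have Gf: "gagliardo s p (ball x0 R) u < \<infinity>"
    using sol cc R unfolding local_weak_solution_def frac_sobolev_loc_def frac_sobolev_def by auto
  have Tf: "Tail s p u x0 R < \<infinity>"
    using sol R p s by (intro Tail_finite) (auto simp: local_weak_solution_def)
  define M where "M = enn2real (ennreal (R powr (s - real DIM('a) / p)) * gagliardo s p (ball x0 R) u + Linf_norm (ball x0 R) u + Tail s p u x0 R) + 1"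
  have M0: "0 < M" by (simp add: M_def add_nonneg_pos)
  have fin: "ennreal (R powr (s - real DIM('a) / p)) * gagliardo s p (ball x0 R) u + Linf_norm (ball x0 R) u + Tail s p u x0 R < \<infinity>"
    using Lf Gf Tf by (simp add: ennreal_mult_less_top)
  have sum: "ennreal (R powr (s - real DIM('a) / p)) * gagliardo s p (ball x0 R) u + Linf_norm (ball x0 R) u + Tail s p u x0 R \<le> ennreal M"
    using fin by (simp add: M_def ennreal_plus less_top)
  have bd: "Linf_norm (ball x0 R) u \<le> ennreal M" "Tail s p u x0 R \<le> ennreal M"
    "ennreal (R powr (s - real DIM('a) / p)) * gagliardo s p (ball x0 R) u \<le> ennreal M"
    by (rule order_trans[OF _ sum], simp add: add_increasing add_increasing2)+
  obtain v :: "'a \<Rightarrow> real" where v: "normalized_solution s p v"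
    "\<And>\<sigma> q \<rho>. 0 < \<rho> \<Longrightarrow> kernel_energy \<sigma> q (ball x0 (R * \<rho>)) u = ennreal (R powr (real DIM('a) - \<sigma>) * M powr q) * kernel_energy \<sigma> q (ball 0 \<rho>) v"
    by (rule rescaled_solution[OF sol \<Omega> R(1) RS p M0 bd], rule that)
  have \<gamma>0: "0 < \<gamma>" using s \<gamma> by linarith
  have rR: "0 < r / R" "r / R < 1" using r R by auto
  obtain b where b: "0 \<le> b" "\<forall>u :: 'a \<Rightarrow> real. normalized_solution s p u \<longrightarrow> kernel_energy (\<gamma> * q) q (ball 0 (r / R)) u \<le> ennreal b"
    using normalized_energy_bound[OF p s q \<gamma>0 \<gamma>(2) rR] by blast
  have eq: "kernel_energy (\<gamma> * q) q (ball x0 r) u = ennreal (R powr (real DIM('a) - \<gamma> * q) * M powr q) * kernel_energy (\<gamma> * q) q (ball 0 (r / R)) v"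
    using v(2)[OF rR(1), of "\<gamma> * q" q] R by simp
  have "gagliardo \<gamma> q (ball x0 r) u \<le> ennreal (R powr (real DIM('a) / q - \<gamma>) * M * b powr (1 / q))"
    by (rule gagliardo_le_of_kernel_energy[OF u q0 R(1) M0 b(1) eq b(2)[THEN spec, THEN mp, OF v(1)]])
  then have G: "gagliardo \<gamma> q (ball x0 r) u < \<infinity>" by (rule le_less_trans) simp
  have L: "Lq_norm q (ball x0 r) u < \<infinity>"
  proof -
    have "AE x in lebesgue_on (ball x0 R). ennreal \<bar>u x\<bar> \<le> ennreal M"
      using esssup_AE[of "\<lambda>x. ennreal \<bar>u x\<bar>" "lebesgue_on (ball x0 R)"] bd(1)
      unfolding Linf_norm_def by (auto elim!: eventually_mono intro: order_trans)
    then have ae: "AE x in lebesgue. x \<in> ball x0 R \<longrightarrow> ennreal \<bar>u x\<bar> \<le> ennreal M"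
      by (subst (asm) AE_restrict_space_iff) auto
    have "(\<integral>\<^sup>+x. ennreal (\<bar>u x\<bar> powr q) \<partial>lebesgue_on (ball x0 r)) = (\<integral>\<^sup>+x. ennreal (\<bar>u x\<bar> powr q) * indicator (ball x0 r) x \<partial>lebesgue)"
      by (rule nn_integral_restrict_space) simp
    also have "\<dots> \<le> (\<integral>\<^sup>+x. ennreal (M powr q) * indicator (ball x0 r) x \<partial>lebesgue)"
    proof (rule nn_integral_mono_AE, rule eventually_mono[OF ae])
      fix x assume x: "x \<in> ball x0 R \<longrightarrow> ennreal \<bar>u x\<bar> \<le> ennreal M"
      show "ennreal (\<bar>u x\<bar> powr q) * indicator (ball x0 r) x \<le> ennreal (M powr q) * indicator (ball x0 r) x"
      proof (cases "x \<in> ball x0 r")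
        case True
        then have "\<bar>u x\<bar> \<le> M" using x R M0 by (simp add: ennreal_le_iff)
        then have "\<bar>u x\<bar> powr q \<le> M powr q" using q0 by (intro powr_mono2) auto
        then show ?thesis using True by (simp add: ennreal_leI)
      qed simp
    qed
    also have "\<dots> < \<infinity>" using r by (simp add: nn_integral_completion nn_integral_cmult_indicator emeasure_ball ennreal_mult_less_top)
    finally show ?thesis unfolding Lq_norm_def enn_powr_less_top_iff .
  qed
  show "u \<in> frac_sobolev \<gamma> q (ball x0 r)"
    unfolding frac_sobolev_def using um G L by simp
qed

text \<open>
  The estimate for \<open>M\<close> strictly above the sum of the three data holds by scaling, and \<open>M\<close> then
  decreases to that sum. Taking \<open>M\<close> larger avoids dividing by zero when all data vanish. If the data are
  infinite there is nothing to prove.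
\<close>

lemma gagliardo_half_ball_le:
  fixes u :: "'a::euclidean_space \<Rightarrow> real"
  assumes p: "2 < p" and q: "p \<le> q"
    and \<Omega>: "bounded \<Omega>" "open \<Omega>" and sol: "local_weak_solution s p \<Omega> u"
    and R: "0 < R" "cball x0 R \<subseteq> \<Omega>"
    and b: "0 \<le> b" "\<And>v :: 'a \<Rightarrow> real. normalized_solution s p v \<Longrightarrow> kernel_energy (\<gamma> * q) q (ball 0 (1 / 2)) v \<le> ennreal b"
    and C: "b powr (1 / q) \<le> C" "0 < C"
  shows "gagliardo \<gamma> q (ball x0 (R / 2)) u \<le> ennreal (C / R powr \<gamma>) *
    (ennreal (R powr (s - real DIM('a) * (1 / p - 1 / q))) * gagliardo s p (ball x0 R) u
      + ennreal (R powr (real DIM('a) / q)) * (Linf_norm (ball x0 R) u + Tail s p u x0 R))"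
proof -
  let ?N = "real DIM('a)"
  define A where "A = ennreal (R powr (s - ?N / p)) * gagliardo s p (ball x0 R) u + Linf_norm (ball x0 R) u + Tail s p u x0 R"
  define k where "k = C / R powr \<gamma> * R powr (?N / q)"
  have u: "u \<in> borel_measurable lebesgue" using sol by (simp add: local_weak_solution_def tail_space_def)
  have q0: "0 < q" using p q by linarith
  have k: "0 < k" using C R by (simp add: k_def)
  have rhs: "ennreal (C / R powr \<gamma>) *
    (ennreal (R powr (s - ?N * (1 / p - 1 / q))) * gagliardo s p (ball x0 R) u
      + ennreal (R powr (?N / q)) * (Linf_norm (ball x0 R) u + Tail s p u x0 R)) = ennreal k * A"
  proof -
    have "s - ?N * (1 / p - 1 / q) = ?N / q + (s - ?N / p)" by (simp add: right_diff_distrib)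
    then have 1: "ennreal (R powr (s - ?N * (1 / p - 1 / q))) = ennreal (R powr (?N / q)) * ennreal (R powr (s - ?N / p))"
      by (simp only: powr_add) (simp add: ennreal_mult)
    have 2: "ennreal k = ennreal (C / R powr \<gamma>) * ennreal (R powr (?N / q))"
      unfolding k_def by (rule ennreal_mult) (use C in auto)
    show ?thesis unfolding 1 2 A_def by (simp only: distrib_left mult.assoc add.assoc)
  qed
  show ?thesis unfolding rhs
  proof (cases "A = \<infinity>")
    case True
    then show "gagliardo \<gamma> q (ball x0 (R / 2)) u \<le> ennreal k * A" using k by (simp add: ennreal_mult_top)
  next
    case False
    define a where "a = enn2real A"
    have a: "A = ennreal a" "0 \<le> a" using False by (auto simp: a_def less_top)
    have key: "gagliardo \<gamma> q (ball x0 (R / 2)) u \<le> ennreal (k * M)" if M: "a < M" for M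
    proof -
      have M0: "0 < M" using a M by linarith
      have sum: "A \<le> ennreal M" unfolding a(1) using M by (intro ennreal_leI) simp
      have bd: "Linf_norm (ball x0 R) u \<le> ennreal M" "Tail s p u x0 R \<le> ennreal M"
        "ennreal (R powr (s - ?N / p)) * gagliardo s p (ball x0 R) u \<le> ennreal M"
        by (rule order_trans[OF _ sum], simp add: A_def add_increasing add_increasing2)+
      obtain v :: "'a \<Rightarrow> real" where v: "normalized_solution s p v"
        "\<And>\<sigma> q \<rho>. 0 < \<rho> \<Longrightarrow> kernel_energy \<sigma> q (ball x0 (R * \<rho>)) u = ennreal (R powr (?N - \<sigma>) * M powr q) * kernel_energy \<sigma> q (ball 0 \<rho>) v"
        by (rule rescaled_solution[OF sol \<Omega> R p M0 bd], rule that)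
      have eq: "kernel_energy (\<gamma> * q) q (ball x0 (R / 2)) u = ennreal (R powr (?N - \<gamma> * q) * M powr q) * kernel_energy (\<gamma> * q) q (ball 0 (1 / 2)) v"
        using v(2)[of "1 / 2" "\<gamma> * q" q] by simp
      have "gagliardo \<gamma> q (ball x0 (R / 2)) u \<le> ennreal (R powr (?N / q - \<gamma>) * M * b powr (1 / q))"
        by (rule gagliardo_le_of_kernel_energy[OF u q0 R(1) M0 b(1) eq b(2)[OF v(1)]])
      also have "\<dots> \<le> ennreal (R powr (?N / q - \<gamma>) * M * C)"
        using C M0 by (intro ennreal_leI mult_left_mono) auto
      also have "R powr (?N / q - \<gamma>) * M * C = k * M"
        unfolding k_def by (simp add: powr_diff)
      finally show ?thesis .
    qed
    have "gagliardo \<gamma> q (ball x0 (R / 2)) u \<le> ennreal (k * a)"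
    proof (rule ennreal_le_epsilon)
      fix e :: real assume e: "0 < e"
      have "gagliardo \<gamma> q (ball x0 (R / 2)) u \<le> ennreal (k * (a + e / k))"
        using e k by (intro key) simp
      also have "k * (a + e / k) = k * a + e" using k by (simp add: field_simps)
      finally show "gagliardo \<gamma> q (ball x0 (R / 2)) u \<le> ennreal (k * a) + ennreal e"
        using k a e by (simp add: ennreal_plus)
    qed
    then show "gagliardo \<gamma> q (ball x0 (R / 2)) u \<le> ennreal k * A"
      using k a by (simp add: ennreal_mult)
  qed
qed

theorem theorem1p1:
  fixes p s :: real
  assumes "2 \<le> CARD('n::finite)" and "2 < p" and "0 < s" and "s \<le> (p - 2) / p"
  shows "(\<forall>(\<Omega> :: (real ^ 'n) set) u q \<gamma>.
            bounded \<Omega> \<and> open \<Omega> \<and> local_weak_solution s p \<Omega> u \<and> locally_bounded \<Omega> u \<and>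
            p \<le> q \<and> s \<le> \<gamma> \<and> \<gamma> < s * p / (p - 2) \<longrightarrow>
            u \<in> frac_sobolev_loc \<gamma> q \<Omega>) \<and>
         (\<exists>C :: real \<Rightarrow> real \<Rightarrow> real.
            (\<forall>q \<gamma>. p \<le> q \<and> s \<le> \<gamma> \<and> \<gamma> < s * p / (p - 2) \<longrightarrow>
               1 \<le> C q \<gamma> \<and>
               (\<forall>(\<Omega> :: (real ^ 'n) set) u x0 R.
                  bounded \<Omega> \<and> open \<Omega> \<and> local_weak_solution s p \<Omega> u \<and> locally_bounded \<Omega> u \<and>
                  0 < R \<and> compactly_contained (ball x0 R) \<Omega> \<longrightarrow>
                  gagliardo \<gamma> q (ball x0 (R / 2)) u
                    \<le> ennreal (C q \<gamma> / R powr \<gamma>) *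
                        (ennreal (R powr (s - real CARD('n) * (1 / p - 1 / q)))
                           * gagliardo s p (ball x0 R) u
                         + ennreal (R powr (real CARD('n) / q))
                           * (Linf_norm (ball x0 R) u + Tail s p u x0 R)))) \<and>
            (\<forall>q. p \<le> q \<longrightarrow> filterlim (C q) at_top (at_left (s * p / (p - 2)))))"
proof (intro conjI)
  note p = assms(2) and s = assms(3,4)
  let ?\<Theta> = "s * p / (p - 2)"
  show "\<forall>(\<Omega> :: (real ^ 'n) set) u q \<gamma>.
            bounded \<Omega> \<and> open \<Omega> \<and> local_weak_solution s p \<Omega> u \<and> locally_bounded \<Omega> u \<and>
            p \<le> q \<and> s \<le> \<gamma> \<and> \<gamma> < ?\<Theta> \<longrightarrow>
            u \<in> frac_sobolev_loc \<gamma> q \<Omega>"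
    by (intro allI impI, elim conjE) (rule frac_sobolev_loc_of_solution[OF p s])
  define b where "b = (\<lambda>q \<gamma>. SOME b. 0 \<le> b \<and> (\<forall>v :: real ^ 'n \<Rightarrow> real. normalized_solution s p v \<longrightarrow> kernel_energy (\<gamma> * q) q (ball 0 (1 / 2)) v \<le> ennreal b))"
  have b: "0 \<le> b q \<gamma> \<and> (\<forall>v :: real ^ 'n \<Rightarrow> real. normalized_solution s p v \<longrightarrow> kernel_energy (\<gamma> * q) q (ball 0 (1 / 2)) v \<le> ennreal (b q \<gamma>))"
    if "p \<le> q" "s \<le> \<gamma>" "\<gamma> < ?\<Theta>" for q \<gamma>
    unfolding b_def
    by (rule someI_ex, rule normalized_energy_bound[OF p s that(1) _ that(3)]) (use s that in auto)
  \<comment> \<open>The summand \<open>1/(\<Theta>-\<gamma>)\<close> makes this admissible constant blow up as \<open>\<gamma>\<close> increases to \<open>\<Theta>\<close>.\<close>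
  define C where "C = (\<lambda>q \<gamma>. max 1 (b q \<gamma> powr (1 / q)) + 1 / (?\<Theta> - \<gamma>))"
  have C: "1 \<le> C q \<gamma>" "b q \<gamma> powr (1 / q) \<le> C q \<gamma>" if "\<gamma> < ?\<Theta>" for q \<gamma>
    using that unfolding C_def by (simp_all add: add_increasing2 add.commute add_increasing)
  show "\<exists>C :: real \<Rightarrow> real \<Rightarrow> real.
            (\<forall>q \<gamma>. p \<le> q \<and> s \<le> \<gamma> \<and> \<gamma> < ?\<Theta> \<longrightarrow>
               1 \<le> C q \<gamma> \<and>
               (\<forall>(\<Omega> :: (real ^ 'n) set) u x0 R.
                  bounded \<Omega> \<and> open \<Omega> \<and> local_weak_solution s p \<Omega> u \<and> locally_bounded \<Omega> u \<and>
                  0 < R \<and> compactly_contained (ball x0 R) \<Omega> \<longrightarrow>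
                  gagliardo \<gamma> q (ball x0 (R / 2)) u
                    \<le> ennreal (C q \<gamma> / R powr \<gamma>) *
                        (ennreal (R powr (s - real CARD('n) * (1 / p - 1 / q)))
                           * gagliardo s p (ball x0 R) u
                         + ennreal (R powr (real CARD('n) / q))
                           * (Linf_norm (ball x0 R) u + Tail s p u x0 R)))) \<and>
            (\<forall>q. p \<le> q \<longrightarrow> filterlim (C q) at_top (at_left ?\<Theta>))"
  proof (intro exI[of _ C] conjI allI impI, goal_cases)
    case (1 q \<gamma>)
    then show ?case using C by blast
  next
    case (2 q \<gamma> \<Omega> u x0 R)
    then have q: "p \<le> q" "s \<le> \<gamma>" "\<gamma> < ?\<Theta>" and \<Omega>: "bounded \<Omega>" "open \<Omega>" "local_weak_solution s p \<Omega> u"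
      and R1: "0 < R" and cc: "compactly_contained (ball x0 R) \<Omega>" by simp_all
    have R: "0 < R" "cball x0 R \<subseteq> \<Omega>" using R1 cc compactly_contained_ball_iff[OF R1] by auto
    have N: "DIM(real ^ 'n) = CARD('n)" by simp
    have C1: "0 < C q \<gamma>" using C(1)[OF q(3), of q] by linarith
    have b2: "kernel_energy (\<gamma> * q) q (ball 0 (1 / 2)) v \<le> ennreal (b q \<gamma>)" if "normalized_solution s p v" for v :: "real ^ 'n \<Rightarrow> real"
      using b[OF q] that by blast
    show ?case
      by (rule gagliardo_half_ball_le[OF p q(1) \<Omega> R conjunct1[OF b[OF q]] b2 C(2)[OF q(3)] C1, unfolded N])
  next
    case (3 q)
    have "filterlim (\<lambda>\<gamma>. 1 / (?\<Theta> - \<gamma>)) at_top (at_left ?\<Theta>)"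
    proof -
      have "((\<lambda>\<gamma>. ?\<Theta> - \<gamma>) \<longlongrightarrow> ?\<Theta> - ?\<Theta>) (at_left ?\<Theta>)" by (intro tendsto_intros)
      moreover have "eventually (\<lambda>\<gamma>. 0 < ?\<Theta> - \<gamma>) (at_left ?\<Theta>)"
        unfolding eventually_at_filter by (intro always_eventually) auto
      ultimately have "filterlim (\<lambda>\<gamma>. ?\<Theta> - \<gamma>) (at_right 0) (at_left ?\<Theta>)"
        unfolding filterlim_at by (auto elim: eventually_mono)
      then have "filterlim (\<lambda>\<gamma>. inverse (?\<Theta> - \<gamma>)) at_top (at_left ?\<Theta>)"
        by (rule filterlim_compose[OF filterlim_inverse_at_top_right])
      then show ?thesis by (simp add: inverse_eq_divide)
    qed
    then show ?case
      by (rule filterlim_at_top_mono) (auto simp: C_def intro!: always_eventually)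
  qed
qed
end
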